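(* Let $k\{y_1,\ldots,y_l\}$ be a ring of differential polynomials (with finitely many commuting derivations) over a differential field $k$ of characteristic zero, with a fixed ranking. Suppose a function $h$ from the set of prime differential ideals of $k\{y_1,\ldots,y_l\}$ to $\mathbb{Z}_{\geq 0}$ is such that for any prime differential ideal $P$ there exists a characteristic set $C_1,\ldots,C_p$ of $P$ with $\operatorname{ord} C_i \leq h(P)$ for all $1\leq i\leq p$. Then for any characterizable differential ideal $I$ there exists a characteristic set $\mathbb{B} = B_1,\ldots,B_m$ of $I$ characterizing this ideal (that is, $I = [\mathbb{B}]:H_{\mathbb{B}}^\infty$) such that $$\operatorname{ord} B_i \leq \max_{1\leq j\leq n} h(P_j)$$ for all $1\leq i\leq m$, where $\{P_j : 1\leq j\leq n\}$ is the minimal prime decomposition of $I$ (the set of essential prime components of $I$).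
   Context: $\Delta=\{\delta_1,\ldots,\delta_n\}$ is a finite set of commuting derivations, $\Theta$ the free commutative monoid of derivative operators $\delta_1^{k_1}\cdots\delta_n^{k_n}$. $k\{y_1,\ldots,y_l\}$ is the polynomial ring over $k$ in the differential variables $\theta y_j$. The order of $\delta_1^{k_1}\cdots\delta_n^{k_n}y_j$ is $k_1+\cdots+k_n$; $\operatorname{ord} f$ is the maximal order of a differential variable appearing effectively in $f$. $[F]$ is the differential ideal generated by $F$. A ranking is a total order on the differential variables such that $\theta u\geq u$ and ($u\geq v\Rightarrow\theta u\geq\theta v$). The leader $u_f$ of $f\notin k$ is the highest differential variable appearing in $f$; if $d=\deg_{u_f}f$, the initial $I_f$ is the coefficient of $u_f^d$ in $f$, the separant is $S_f=\partial f/\partial u_f$, and the rank is $u_f^d$. Ranks are compared by $u^{d}>v^{e}$ iff $u>v$, or $u=v$ and $d>e$. $f$ is reduced with respect to $g$ if no proper derivative of $u_g$ appears in $f$ and $\deg_{u_g}f<\deg_{u_g}g$. A set $\mathbb{A}\subset k\{y_1,\ldots,y_l\}\setminus k$ is autoreduced if each element is reduced with respect to all the others; such sets are finite and written in order of increasing rank. $\mathbb{A}=A_1,\ldots,A_r$ has lower rank than $\mathbb{B}=B_1,\ldots,B_s$ if there is $j\le r,s$ with $\operatorname{rank}A_i=\operatorname{rank}B_i$ for $i<j$ and $\operatorname{rank}A_j<\operatorname{rank}B_j$, or if $r>s$ and $\operatorname{rank}A_i=\operatorname{rank}B_i$ for $1\le i\le s$. A characteristic set of an ideal is an autoreduced subset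 of it of lowest rank. $H_{\mathbb{A}}$ is the product of the initials and separants of the elements of $\mathbb{A}$, and $J:H_{\mathbb{A}}^\infty=\{a : H_{\mathbb{A}}^m a\in J\text{ for some }m\geq0\}$. A differential ideal $I$ is characterizable if $I=[\mathbb{A}]:H_{\mathbb{A}}^\infty$ for some characteristic set $\mathbb{A}$ of $I$. Characterizable ideals are radical; every radical differential ideal is the intersection of finitely many prime differential ideals containing it, and the essential (minimal) prime components are those not containing another prime component, i.e. the prime differential ideals minimal over $I$. *)

theory Defs
  imports Complex_Main "HOL-Library.Poly_Mapping"
begin

text \<open>
  \<^typ>\<open>'d\<close> indexes the derivations and \<^typ>\<open>'y\<close> the differential indeterminates (both finite in the
  intended use).  A derivative operator is its exponent vector, so composition of operators
  is addition; the differential variable \<open>\<theta> y\<close> is the pair \<open>(\<theta>, y)\<close>.  A polynomial maps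
  monomials (finitely supported exponent functions on the differential variables) to
  coefficients; the product of \<^typ>\<open>'a \<Rightarrow>\<^sub>0 'b\<close> is the convolution product.
\<close>

type_synonym ('d, 'y) dvar = "('d \<Rightarrow>\<^sub>0 nat) \<times> 'y"
type_synonym ('d, 'y, 'k) dpoly = "(('d, 'y) dvar \<Rightarrow>\<^sub>0 nat) \<Rightarrow>\<^sub>0 'k"

definition dapply :: "('d \<Rightarrow>\<^sub>0 nat) \<Rightarrow> ('d, 'y) dvar \<Rightarrow> ('d, 'y) dvar" where
  "dapply \<theta> v = (\<theta> + fst v, snd v)"

definition dvar_order :: "('d::finite, 'y) dvar \<Rightarrow> nat" where
  "dvar_order v = (\<Sum>i\<in>UNIV. Poly_Mapping.lookup (fst v) i)"

definition var :: "('d, 'y) dvar \<Rightarrow> ('d, 'y, 'k::comm_ring_1) dpoly" where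
  "var v = Poly_Mapping.single (Poly_Mapping.single v 1) 1"

definition vars :: "('d, 'y, 'k::comm_ring_1) dpoly \<Rightarrow> ('d, 'y) dvar set" where
  "vars f = (\<Union>m\<in>Poly_Mapping.keys f. Poly_Mapping.keys m)"

text \<open>Order, with the convention that elements of the ground field have order 0.\<close>

definition poly_order :: "('d::finite, 'y, 'k::comm_ring_1) dpoly \<Rightarrow> nat" where
  "poly_order f = Max (insert 0 (dvar_order ` vars f))"

definition deg_in :: "('d, 'y) dvar \<Rightarrow> ('d, 'y, 'k::comm_ring_1) dpoly \<Rightarrow> nat" where
  "deg_in v f = Max (insert 0 ((\<lambda>m. Poly_Mapping.lookup m v) ` Poly_Mapping.keys f))"

text \<open>The coefficient of \<open>v ^ d\<close> in \<open>f\<close>, regarded as a univariate polynomial in \<open>v\<close>.\<close>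

definition coeff_in ::
  "('d, 'y) dvar \<Rightarrow> nat \<Rightarrow> ('d, 'y, 'k::comm_ring_1) dpoly \<Rightarrow> ('d, 'y, 'k) dpoly" where
  "coeff_in v d f =
    (\<Sum>m\<in>{m \<in> Poly_Mapping.keys f. Poly_Mapping.lookup m v = d}.
      Poly_Mapping.single (m - Poly_Mapping.single v d) (Poly_Mapping.lookup f m))"

definition pdiff ::
  "('d, 'y) dvar \<Rightarrow> ('d, 'y, 'k::comm_ring_1) dpoly \<Rightarrow> ('d, 'y, 'k) dpoly" where
  "pdiff v f =
    (\<Sum>m\<in>Poly_Mapping.keys f.
      Poly_Mapping.single (m - Poly_Mapping.single v 1)
        (of_nat (Poly_Mapping.lookup m v) * Poly_Mapping.lookup f m))"

definition differential_field :: "('d \<Rightarrow> 'k::field \<Rightarrow> 'k) \<Rightarrow> bool" where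
  "differential_field D \<longleftrightarrow>
    (\<forall>i a b. D i (a + b) = D i a + D i b) \<and>
    (\<forall>i a b. D i (a * b) = D i a * b + a * D i b) \<and>
    (\<forall>i j a. D i (D j a) = D j (D i a))"

text \<open>
  The unique extension of \<open>D i\<close> to differential polynomials that sends the variable \<open>\<theta> y\<close>
  to \<open>\<delta>\<^sub>i \<theta> y\<close>: differentiate the coefficients and add \<open>\<Sum>\<^sub>v (\<partial>f / \<partial>v) \<delta>\<^sub>i v\<close>.
\<close>

definition pderivation ::
  "('d \<Rightarrow> 'k::field \<Rightarrow> 'k) \<Rightarrow> 'd \<Rightarrow> ('d, 'y, 'k) dpoly \<Rightarrow> ('d, 'y, 'k) dpoly" where
  "pderivation D i f =
    Poly_Mapping.map (D i) f +
    (\<Sum>v\<in>vars f. pdiff v f * var (dapply (Poly_Mapping.single i 1) v))"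

text \<open>Ideals are the submodules of the ring, viewed as a module over itself.\<close>

definition differential_ideal ::
  "('d \<Rightarrow> 'k::field \<Rightarrow> 'k) \<Rightarrow> ('d, 'y, 'k) dpoly set \<Rightarrow> bool" where
  "differential_ideal D I \<longleftrightarrow>
    module.subspace (*) I \<and> (\<forall>i. \<forall>f\<in>I. pderivation D i f \<in> I)"

definition prime_differential_ideal ::
  "('d \<Rightarrow> 'k::field \<Rightarrow> 'k) \<Rightarrow> ('d, 'y, 'k) dpoly set \<Rightarrow> bool" where
  "prime_differential_ideal D P \<longleftrightarrow>
    differential_ideal D P \<and> P \<noteq> UNIV \<and> (\<forall>f g. f * g \<in> P \<longrightarrow> f \<in> P \<or> g \<in> P)"

definition differential_ideal_gen ::
  "('d \<Rightarrow> 'k::field \<Rightarrow> 'k) \<Rightarrow> ('d, 'y, 'k) dpoly set \<Rightarrow> ('d, 'y, 'k) dpoly set" where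
  "differential_ideal_gen D F = \<Inter>{I. differential_ideal D I \<and> F \<subseteq> I}"

definition saturation :: "'r::comm_ring_1 set \<Rightarrow> 'r \<Rightarrow> 'r set" where
  "saturation J H = {a. \<exists>m::nat. H ^ m * a \<in> J}"

definition essential_prime_components ::
  "('d \<Rightarrow> 'k::field \<Rightarrow> 'k) \<Rightarrow> ('d, 'y, 'k) dpoly set \<Rightarrow> ('d, 'y, 'k) dpoly set set" where
  "essential_prime_components D I =
    {P. prime_differential_ideal D P \<and> I \<subseteq> P \<and>
        (\<forall>Q. prime_differential_ideal D Q \<longrightarrow> I \<subseteq> Q \<longrightarrow> Q \<subseteq> P \<longrightarrow> Q = P)}"

text \<open>Here \<open>le u v\<close> reads \<open>u \<le> v\<close>.\<close>

definition ranking :: "(('d, 'y) dvar \<Rightarrow> ('d, 'y) dvar \<Rightarrow> bool) \<Rightarrow> bool" where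
  "ranking le \<longleftrightarrow>
    reflp le \<and> transp le \<and> antisymp le \<and> totalp le \<and>
    (\<forall>\<theta> u. le u (dapply \<theta> u)) \<and>
    (\<forall>\<theta> u v. le v u \<longrightarrow> le (dapply \<theta> v) (dapply \<theta> u))"

text \<open>Leader, initial, separant and rank are only meaningful when \<open>vars f \<noteq> {}\<close>.\<close>

definition leader ::
  "(('d, 'y) dvar \<Rightarrow> ('d, 'y) dvar \<Rightarrow> bool) \<Rightarrow> ('d, 'y, 'k::comm_ring_1) dpoly \<Rightarrow> ('d, 'y) dvar" where
  "leader le f = (THE u. u \<in> vars f \<and> (\<forall>v\<in>vars f. le v u))"

definition initial ::
  "(('d, 'y) dvar \<Rightarrow> ('d, 'y) dvar \<Rightarrow> bool) \<Rightarrow> ('d, 'y, 'k::comm_ring_1) dpoly \<Rightarrow> ('d, 'y, 'k) dpoly" where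
  "initial le f = coeff_in (leader le f) (deg_in (leader le f) f) f"

definition separant ::
  "(('d, 'y) dvar \<Rightarrow> ('d, 'y) dvar \<Rightarrow> bool) \<Rightarrow> ('d, 'y, 'k::comm_ring_1) dpoly \<Rightarrow> ('d, 'y, 'k) dpoly" where
  "separant le f = pdiff (leader le f) f"

text \<open>The rank \<open>u ^ d\<close> is represented by the pair \<open>(u, d)\<close>.\<close>

definition rank ::
  "(('d, 'y) dvar \<Rightarrow> ('d, 'y) dvar \<Rightarrow> bool) \<Rightarrow> ('d, 'y, 'k::comm_ring_1) dpoly \<Rightarrow> ('d, 'y) dvar \<times> nat" where
  "rank le f = (leader le f, deg_in (leader le f) f)"

definition rank_less ::
  "(('d, 'y) dvar \<Rightarrow> ('d, 'y) dvar \<Rightarrow> bool) \<Rightarrow> ('d, 'y) dvar \<times> nat \<Rightarrow> ('d, 'y) dvar \<times> nat \<Rightarrow> bool" where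
  "rank_less le r s \<longleftrightarrow>
    (le (fst r) (fst s) \<and> fst r \<noteq> fst s) \<or> (fst r = fst s \<and> snd r < snd s)"

definition reduced ::
  "(('d, 'y) dvar \<Rightarrow> ('d, 'y) dvar \<Rightarrow> bool) \<Rightarrow>
    ('d, 'y, 'k::comm_ring_1) dpoly \<Rightarrow> ('d, 'y, 'k) dpoly \<Rightarrow> bool" where
  "reduced le f g \<longleftrightarrow>
    (\<forall>\<theta>. \<theta> \<noteq> 0 \<longrightarrow> dapply \<theta> (leader le g) \<notin> vars f) \<and>
    deg_in (leader le g) f < deg_in (leader le g) g"

definition autoreduced ::
  "(('d, 'y) dvar \<Rightarrow> ('d, 'y) dvar \<Rightarrow> bool) \<Rightarrow> ('d, 'y, 'k::comm_ring_1) dpoly set \<Rightarrow> bool" where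
  "autoreduced le A \<longleftrightarrow>
    (\<forall>f\<in>A. vars f \<noteq> {}) \<and> (\<forall>f\<in>A. \<forall>g\<in>A. f \<noteq> g \<longrightarrow> reduced le f g)"

text \<open>
  Autoreduced sets are finite and their elements have pairwise distinct ranks, so each is
  uniquely written as a list of increasing rank.  The empty list is allowed; it is the
  characteristic set of the zero ideal.
\<close>

definition autoreduced_list ::
  "(('d, 'y) dvar \<Rightarrow> ('d, 'y) dvar \<Rightarrow> bool) \<Rightarrow> ('d, 'y, 'k::comm_ring_1) dpoly list \<Rightarrow> bool" where
  "autoreduced_list le A \<longleftrightarrow>
    autoreduced le (set A) \<and> sorted_wrt (\<lambda>f g. rank_less le (rank le f) (rank le g)) A"

definition lower_rank ::
  "(('d, 'y) dvar \<Rightarrow> ('d, 'y) dvar \<Rightarrow> bool) \<Rightarrow>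
    ('d, 'y, 'k::comm_ring_1) dpoly list \<Rightarrow> ('d, 'y, 'k) dpoly list \<Rightarrow> bool" where
  "lower_rank le A B \<longleftrightarrow>
    (\<exists>j. j < length A \<and> j < length B \<and>
      (\<forall>i<j. rank le (A ! i) = rank le (B ! i)) \<and>
      rank_less le (rank le (A ! j)) (rank le (B ! j))) \<or>
    (length A > length B \<and> (\<forall>i<length B. rank le (A ! i) = rank le (B ! i)))"

definition characteristic_set ::
  "(('d, 'y) dvar \<Rightarrow> ('d, 'y) dvar \<Rightarrow> bool) \<Rightarrow>
    ('d, 'y, 'k::comm_ring_1) dpoly set \<Rightarrow> ('d, 'y, 'k) dpoly list \<Rightarrow> bool" where
  "characteristic_set le I A \<longleftrightarrow>
    autoreduced_list le A \<and> set A \<subseteq> I \<and>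
    (\<forall>B. autoreduced_list le B \<longrightarrow> set B \<subseteq> I \<longrightarrow> \<not> lower_rank le B A)"

definition init_sep_prod ::
  "(('d, 'y) dvar \<Rightarrow> ('d, 'y) dvar \<Rightarrow> bool) \<Rightarrow> ('d, 'y, 'k::comm_ring_1) dpoly list \<Rightarrow> ('d, 'y, 'k) dpoly" where
  "init_sep_prod le A = (\<Prod>f\<in>set A. initial le f * separant le f)"

definition characterizes ::
  "('d \<Rightarrow> 'k::field \<Rightarrow> 'k) \<Rightarrow> (('d, 'y) dvar \<Rightarrow> ('d, 'y) dvar \<Rightarrow> bool) \<Rightarrow>
    ('d, 'y, 'k) dpoly list \<Rightarrow> ('d, 'y, 'k) dpoly set \<Rightarrow> bool" where
  "characterizes D le A I \<longleftrightarrow>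
    characteristic_set le I A \<and>
    I = saturation (differential_ideal_gen D (set A)) (init_sep_prod le A)"

definition characterizable ::
  "('d \<Rightarrow> 'k::field \<Rightarrow> 'k) \<Rightarrow> (('d, 'y) dvar \<Rightarrow> ('d, 'y) dvar \<Rightarrow> bool) \<Rightarrow>
    ('d, 'y, 'k) dpoly set \<Rightarrow> bool" where
  "characterizable D le I \<longleftrightarrow> differential_ideal D I \<and> (\<exists>A. characterizes D le A I)"

end

theory Submission
  imports
    Defs
    "HOL-Computational_Algebra.Polynomial"
    "HOL-Library.FuncSet"
    "HOL-Library.Infinite_Set"
begin

text \<open>
  Let \<open>A\<close> characterize \<open>I\<close>, let \<open>L\<close> be the set of its leaders and \<open>N\<close> the set of variables that
  are not derivatives of elements of \<open>L\<close>.  Every differential polynomial can be reduced modulo \<open>I\<close>,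
  after multiplication by a non-zero-divisor, to a combination over \<open>k[N]\<close> of finitely many monomials
  in \<open>L\<close>, and these monomials are independent modulo \<open>I\<close>.  Linear algebra over \<open>k[N]\<close> then shows that
  \<open>I\<close> has finitely many essential prime components \<open>P\<close>, that the characteristic sets of each \<open>P\<close> have the
  same leaders as \<open>A\<close>, and that for every \<open>a \<in> A\<close> there is \<open>b \<in> I\<close> of the same rank whose initial lies in
  \<open>k[N]\<close>.  Let \<open>M\<close> be the maximum of the \<open>h(P)\<close>.  Expand \<open>b\<close> in monomials in the variables of \<open>N\<close> of
  order greater than \<open>M\<close>.  Since each \<open>P\<close> has a characteristic set of order at most \<open>M\<close>, all the
  coefficients lie in every \<open>P\<close>, hence in \<open>I\<close>, because \<open>I\<close> is radical.  A coefficient of the same rank as \<open>b\<close>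
  replaces \<open>a\<close>: its initial is a non-zero-divisor modulo \<open>I\<close> since it lies in \<open>k[N]\<close>, and then so is
  its separant.
\<close>

text \<open>A characterizable ideal need not be prime, so taking coefficients of the elements of
  \<open>A\<close> directly could produce initials that are zero divisors. The polynomials known in
  advance to be regular are the nonzero ones over \<open>N\<close> (\<open>regular_N\<close>), which
  is why each initial is first moved into k[N]: every nonzero coefficient of it is then regular too.
  Coefficients of an element of an ideal stay in the ideal only if reduction does not mix the
  extracted variables with the others, so reduction has to run inside a set of variables closed
  under it (\<open>admissible\<close>). A characteristic set of \<open>P\<close> of order at most M
  supplies such a set, whereas \<open>A\<close> has no order bound; hence coefficients are extracted
  in each \<open>P\<close> separately and the results are joined by radicality of \<open>I\<close>.
  The leaders of \<open>A\<close> occur among the leaders of each characteristic set of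
  \<open>P\<close>, so their order is at most M already and only variables of \<open>N\<close> have
  to be removed.\<close>

abbreviation lookup :: "('a \<Rightarrow>\<^sub>0 'b::zero) \<Rightarrow> 'a \<Rightarrow> 'b" where
  "lookup \<equiv> Poly_Mapping.lookup"

abbreviation keys :: "('a \<Rightarrow>\<^sub>0 'b::zero) \<Rightarrow> 'a set" where
  "keys \<equiv> Poly_Mapping.keys"

abbreviation single :: "'a \<Rightarrow> 'b \<Rightarrow> 'a \<Rightarrow>\<^sub>0 'b::zero" where
  "single \<equiv> Poly_Mapping.single"

abbreviation mon :: "('v \<Rightarrow>\<^sub>0 nat) \<Rightarrow> ('v \<Rightarrow>\<^sub>0 nat) \<Rightarrow>\<^sub>0 'k::comm_ring_1" where
  "mon \<mu> \<equiv> single \<mu> 1"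

abbreviation const :: "'k::comm_ring_1 \<Rightarrow> ('v \<Rightarrow>\<^sub>0 nat) \<Rightarrow>\<^sub>0 'k" where
  "const c \<equiv> single 0 c"

section \<open>Finitely supported maps and exponent arithmetic\<close>

lemma poly_mapping_additive_induct [case_names single add]:
  fixes f :: "'a \<Rightarrow>\<^sub>0 'b::comm_monoid_add"
  assumes single: "\<And>m a. P (single m a)"
    and add: "\<And>f g. P f \<Longrightarrow> P g \<Longrightarrow> P (f + g)"
  shows "P f"
proof (induction f rule: update_induct)
  case const
  show ?case using single[of undefined 0] by simp
next
  case (update f a b)
  have "Poly_Mapping.update a b f = f + single a b"
    using update(1)
    by (intro poly_mapping_eqI) (auto simp: lookup_update lookup_add lookup_single when_def in_keys_iff)
  then show ?case using add[OF update(3) single[of a b]] by simp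
qed

lemma exp_add_diff: "(m::'v \<Rightarrow>\<^sub>0 nat) + n - n = m"
  by (intro poly_mapping_eqI) (simp add: lookup_add lookup_minus)

text \<open>Subtraction of exponents is truncated, so divisibility of \<open>m\<close> by \<mu> has
  to be a condition of its own.\<close>

lemma lookup_mult_single:
  fixes f :: "('v \<Rightarrow>\<^sub>0 nat) \<Rightarrow>\<^sub>0 'k::comm_ring_1"
  shows "lookup (f * single \<mu> a) m =
    (if \<exists>n. m = n + \<mu> then lookup f (m - \<mu>) * a else 0)"
proof (induction f rule: poly_mapping_additive_induct)
  case (single n b)
  then show ?case
    by (auto simp: mult_single lookup_single when_def exp_add_diff) metis
next
  case (add f g)
  then show ?case by (simp add: distrib_right lookup_add)
qed

lemma single_eq_const_mon: "single \<mu> a = const a * mon \<mu>"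
  by (simp add: mult_single)

subsection \<open>Variables\<close>

lemma in_vars_iff: "v \<in> vars f \<longleftrightarrow> (\<exists>m. lookup f m \<noteq> 0 \<and> lookup m v \<noteq> 0)"
  by (auto simp: vars_def in_keys_iff)

lemma finite_vars [simp]: "finite (vars f)"
  by (simp add: vars_def)

lemma vars_zero [simp]: "vars 0 = {}"
  by (simp add: vars_def)

lemma vars_single: "vars (single m a) = (if a = 0 then {} else keys m)"
  by (simp add: vars_def)

lemma vars_one [simp]: "vars 1 = {}"
  by (simp add: vars_def)

lemma vars_add: "vars (f + g) \<subseteq> vars f \<union> vars g"
  using keys_add[of f g] by (auto simp: vars_def)

lemma vars_uminus [simp]: "vars (- f) = vars f"
  by (auto simp: in_vars_iff)

lemma vars_diff: "vars (f - g) \<subseteq> vars f \<union> vars g"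
  using vars_add[of f "- g"] by simp

lemma vars_mult: "vars (f * g) \<subseteq> vars f \<union> vars g"
proof
  fix v assume "v \<in> vars (f * g)"
  then obtain m where m: "m \<in> keys (f * g)" "v \<in> keys m"
    by (auto simp: vars_def)
  obtain a b where ab: "m = a + b" "a \<in> keys f" "b \<in> keys g"
    using m(1) keys_mult[of f g] by blast
  have "v \<in> keys a \<union> keys b"
    using m(2) keys_add[of a b] unfolding ab(1) by blast
  then show "v \<in> vars f \<union> vars g"
    using ab by (auto simp: vars_def)
qed

lemma vars_sum: "vars (sum f A) \<subseteq> (\<Union>i\<in>A. vars (f i))"
proof (induction A rule: infinite_finite_induct)
  case (insert x F)
  then show ?case using vars_add[of "f x" "sum f F"] by auto
qed auto

lemma vars_power: "vars (f ^ n) \<subseteq> vars f"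
proof (induction n)
  case (Suc n)
  then show ?case using vars_mult[of f "f ^ n"] by auto
qed simp

lemma vars_var [simp]: "vars (var v :: ('d, 'y, 'k::comm_ring_1) dpoly) = {v}"
  by (simp add: var_def vars_single)

lemma vars_empty_imp_const:
  assumes "vars f = {}"
  shows "f = const (lookup f 0)"
proof (intro poly_mapping_eqI)
  fix m
  show "lookup f m = lookup (const (lookup f 0)) m"
  proof (cases "m = 0")
    case False
    then obtain v where "lookup m v \<noteq> 0"
      by (metis lookup_zero poly_mapping_eqI)
    then show ?thesis using assms False in_vars_iff[of v f] by (auto simp: lookup_single when_def)
  qed simp
qed

definition polys_in :: "('d, 'y) dvar set \<Rightarrow> ('d, 'y, 'k::comm_ring_1) dpoly set" where
  "polys_in V = {f. vars f \<subseteq> V}"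

lemma polys_in_simps [simp]:
  "0 \<in> polys_in V" "1 \<in> polys_in V" "const c \<in> polys_in V"
  by (auto simp: polys_in_def vars_single)

lemma polys_in_add: "f \<in> polys_in V \<Longrightarrow> g \<in> polys_in V \<Longrightarrow> f + g \<in> polys_in V"
  using vars_add unfolding polys_in_def by blast

lemma polys_in_diff: "f \<in> polys_in V \<Longrightarrow> g \<in> polys_in V \<Longrightarrow> f - g \<in> polys_in V"
  using vars_diff unfolding polys_in_def by blast

lemma polys_in_mult: "f \<in> polys_in V \<Longrightarrow> g \<in> polys_in V \<Longrightarrow> f * g \<in> polys_in V"
  using vars_mult unfolding polys_in_def by blast

lemma polys_in_power: "f \<in> polys_in V \<Longrightarrow> f ^ n \<in> polys_in V"
  using vars_power unfolding polys_in_def by blast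

lemma polys_in_sum: "(\<And>i. i \<in> A \<Longrightarrow> f i \<in> polys_in V) \<Longrightarrow> sum f A \<in> polys_in V"
  using vars_sum unfolding polys_in_def by blast

lemma polys_in_mono: "V \<subseteq> W \<Longrightarrow> polys_in V \<subseteq> polys_in W"
  unfolding polys_in_def by blast

lemma polys_in_mon: "keys \<mu> \<subseteq> V \<Longrightarrow> mon \<mu> \<in> polys_in V"
  by (simp add: polys_in_def vars_single)

subsection \<open>Coefficients with respect to a set of variables\<close>

lift_definition restr :: "'v set \<Rightarrow> ('v \<Rightarrow>\<^sub>0 nat) \<Rightarrow> ('v \<Rightarrow>\<^sub>0 nat)" is
  "\<lambda>S m v. m v when v \<in> S"
proof -
  fix S :: "'v set" and m :: "'v \<Rightarrow> nat"
  assume "finite {v. m v \<noteq> 0}"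
  then show "finite {v. (m v when v \<in> S) \<noteq> 0}"
    by (rule rev_finite_subset) (auto simp: when_def split: if_splits)
qed

text \<open>For \<mu> supported in \<open>S\<close>, this is the coefficient of \<mu> when
  \<open>f\<close> is read as a polynomial in the variables of \<open>S\<close> over the polynomials
  free of \<open>S\<close>. The condition on \<open>n\<close> selects the monomials whose
  \<open>S\<close>-part is exactly \<mu> and not merely divisible by it.\<close>

lift_definition cpart :: "'v set \<Rightarrow> ('v \<Rightarrow>\<^sub>0 nat) \<Rightarrow> (('v \<Rightarrow>\<^sub>0 nat) \<Rightarrow>\<^sub>0 'k::zero) \<Rightarrow> (('v \<Rightarrow>\<^sub>0 nat) \<Rightarrow>\<^sub>0 'k)" is
  "\<lambda>S \<mu> f n. f (n + \<mu>) when keys n \<inter> S = {}"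
proof -
  fix S :: "'v set" and \<mu> :: "'v \<Rightarrow>\<^sub>0 nat" and f :: "('v \<Rightarrow>\<^sub>0 nat) \<Rightarrow> 'k"
  assume "finite {m. f m \<noteq> 0}"
  moreover have "inj (\<lambda>n. n + \<mu>)" by (rule injI) simp
  ultimately have "finite ((\<lambda>n. n + \<mu>) -` {m. f m \<noteq> 0})"
    by (rule finite_vimageI)
  then show "finite {n. (f (n + \<mu>) when keys n \<inter> S = {}) \<noteq> 0}"
    by (rule rev_finite_subset) auto
qed

lemma lookup_restr: "lookup (restr S m) v = (if v \<in> S then lookup m v else 0)"
  by (simp add: restr.rep_eq when_def)

lemma lookup_cpart:
  "lookup (cpart S \<mu> f) n =
    (if keys n \<inter> S = {} then lookup f (n + \<mu>) else 0)"
  by (simp add: cpart.rep_eq when_def)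

lemma keys_restr: "keys (restr S m) = keys m \<inter> S"
  by (auto simp: in_keys_iff lookup_restr split: if_splits)

lemma restr_add:
  assumes "keys n \<inter> S = {}" "keys \<mu> \<subseteq> S"
  shows "restr S (n + \<mu>) = \<mu>"
proof (rule poly_mapping_eqI)
  fix v
  show "lookup (restr S (n + \<mu>)) v = lookup \<mu> v"
    using assms by (auto simp: lookup_restr lookup_add in_keys_iff disjoint_iff)
qed

lemma restr_decomp: "m = restr (- S) m + restr S m"
  by (rule poly_mapping_eqI) (simp add: lookup_add lookup_restr)

lemma cpart_zero [simp]: "cpart S \<mu> 0 = 0"
  by (intro poly_mapping_eqI) (simp add: lookup_cpart)

lemma cpart_add: "cpart S \<mu> (f + g) = cpart S \<mu> f + cpart S \<mu> g"
  by (intro poly_mapping_eqI) (simp add: lookup_cpart lookup_add)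

lemma cpart_sum: "cpart S \<mu> (sum f A) = (\<Sum>i\<in>A. cpart S \<mu> (f i))"
  by (induction A rule: infinite_finite_induct) (auto simp: cpart_add)

lemma vars_cpart:
  fixes f :: "('d, 'y, 'k::comm_ring_1) dpoly"
  shows "vars (cpart S \<mu> f) \<subseteq> vars f - S"
proof
  fix v assume "v \<in> vars (cpart S \<mu> f)"
  then obtain n where n: "keys n \<inter> S = {}" "lookup f (n + \<mu>) \<noteq> 0"
      "lookup n v \<noteq> 0"
    by (auto simp: in_vars_iff lookup_cpart split: if_splits)
  then have "lookup (n + \<mu>) v \<noteq> 0" by (simp add: lookup_add)
  then show "v \<in> vars f - S" using n by (auto simp: in_vars_iff in_keys_iff)
qed

lemma cpart_mult_mon:
  fixes c :: "('d, 'y, 'k::comm_ring_1) dpoly"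
  assumes "vars c \<inter> S = {}" "keys \<mu> \<subseteq> S" "keys \<nu> \<subseteq> S"
  shows "cpart S \<nu> (c * mon \<mu>) = (if \<mu> = \<nu> then c else 0)"
proof (rule poly_mapping_eqI)
  fix n
  have free: "keys m \<inter> S = {}" if "lookup c m \<noteq> 0" for m
    using that assms(1) by (auto simp: in_vars_iff in_keys_iff disjoint_iff)
  show "lookup (cpart S \<nu> (c * mon \<mu>)) n = lookup (if \<mu> = \<nu> then c else 0) n"
  proof (cases "keys n \<inter> S = {}")
    case False
    then show ?thesis using free[of n] by (auto simp: lookup_cpart)
  next
    case True
    show ?thesis
    proof (cases "\<mu> = \<nu>")
      case True
      then show ?thesis using \<open>keys n \<inter> S = {}\<close>
        by (auto simp: lookup_cpart lookup_mult_single exp_add_diff)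
    next
      case False
      have "lookup c p = 0" if "n + \<nu> = p + \<mu>" for p
      proof (rule ccontr)
        assume "lookup c p \<noteq> 0"
        then have "keys p \<inter> S = {}" by (rule free)
        then have "restr S (n + \<nu>) = \<mu>" using restr_add[OF _ assms(2)] that by simp
        moreover have "restr S (n + \<nu>) = \<nu>" using restr_add[OF True assms(3)] .
        ultimately show False using False by simp
      qed
      then show ?thesis using True False
        by (auto simp: lookup_cpart lookup_mult_single exp_add_diff)
    qed
  qed
qed

text \<open>\<open>M\<close> may contain exponents that do not occur in \<open>f\<close>; they get
  coefficient zero. Thus a fixed finite set such as \<open>basis_mons\<close> can serve for several
  polynomials, and a chosen exponent can be forced into the sum.\<close>

lemma cpart_expansion:
  fixes f :: "('d, 'y, 'k::comm_ring_1) dpoly"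
  assumes "finite M" "restr S ` keys f \<subseteq> M" "\<And>\<mu>. \<mu> \<in> M \<Longrightarrow> keys \<mu> \<subseteq> S"
  shows "f = (\<Sum>\<mu>\<in>M. cpart S \<mu> f * mon \<mu>)"
proof (rule poly_mapping_eqI)
  fix m
  have trm: "lookup (cpart S \<mu> f * mon \<mu>) m
      = (if \<mu> = restr S m then lookup f m else 0)" if "\<mu> \<in> M" for \<mu>
  proof (cases "\<mu> = restr S m")
    case True
    have "m = restr (- S) m + \<mu>" unfolding True by (rule restr_decomp)
    moreover from this have "m - \<mu> = restr (- S) m" by (metis exp_add_diff)
    ultimately show ?thesis unfolding lookup_mult_single using True
      by (auto simp: lookup_cpart keys_restr)
  next
    case False
    have "keys n \<inter> S \<noteq> {}" if "m = n + \<mu>" for n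
      using False restr_add[of n S \<mu>] assms(3)[OF \<open>\<mu> \<in> M\<close>] that by auto
    then show ?thesis using False by (auto simp: lookup_mult_single lookup_cpart exp_add_diff)
  qed
  have "lookup (\<Sum>\<mu>\<in>M. cpart S \<mu> f * mon \<mu>) m =
      (\<Sum>\<mu>\<in>M. if \<mu> = restr S m then lookup f m else 0)"
    by (simp add: lookup_sum trm)
  also have "\<dots> = lookup f m"
  proof (cases "restr S m \<in> M")
    case False
    then have "m \<notin> keys f" using assms(2) by auto
    then show ?thesis using False assms(1) by (simp add: in_keys_iff)
  qed (use assms(1) in simp)
  finally show "lookup f m = lookup (\<Sum>\<mu>\<in>M. cpart S \<mu> f * mon \<mu>) m" by simp
qed

lemma cpart_sum_mon:
  fixes c :: "(('d, 'y) dvar \<Rightarrow>\<^sub>0 nat) \<Rightarrow> ('d, 'y, 'k::comm_ring_1) dpoly"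
  assumes "finite M" "\<And>\<mu>. \<mu> \<in> M \<Longrightarrow> vars (c \<mu>) \<inter> S = {}" "\<And>\<mu>. \<mu> \<in> M \<Longrightarrow> keys \<mu> \<subseteq> S"
    and "\<nu> \<in> M"
  shows "cpart S \<nu> (\<Sum>\<mu>\<in>M. c \<mu> * mon \<mu>) = c \<nu>"
proof -
  have "cpart S \<nu> (\<Sum>\<mu>\<in>M. c \<mu> * mon \<mu>) = (\<Sum>\<mu>\<in>M. if \<mu> = \<nu> then c \<nu> else 0)"
    unfolding cpart_sum using assms by (intro sum.cong) (auto simp: cpart_mult_mon)
  then show ?thesis using assms(1,4) by simp
qed

subsection \<open>Differential polynomials as univariate polynomials\<close>

lemma lookup_coeff_in:
  "lookup (coeff_in v d f) n =
    (if lookup n v = 0 then lookup f (n + single v d) else 0)"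
proof -
  let ?K = "{m \<in> keys f. lookup m v = d}"
  have eq: "m - single v d = n \<longleftrightarrow>
      m = n + single v d \<and> lookup n v = 0"
    if "lookup m v = d" for m
  proof
    assume *: "m - single v d = n"
    have "m = n + single v d"
      unfolding *[symmetric] using that
      by (intro poly_mapping_eqI) (auto simp: lookup_add lookup_minus lookup_single when_def)
    then show "m = n + single v d \<and> lookup n v = 0"
      using that by (auto simp: lookup_add)
  qed (simp add: exp_add_diff)
  have "lookup (coeff_in v d f) n =
      (\<Sum>m\<in>?K. if m = n + single v d \<and> lookup n v = 0
        then lookup f m else 0)"
    unfolding coeff_in_def lookup_sum
    by (intro sum.cong) (auto simp: lookup_single when_def eq)
  also have "\<dots> = (if lookup n v = 0 then lookup f (n + single v d) else 0)"
    by (auto simp: in_keys_iff lookup_add)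
  finally show ?thesis .
qed

lemma coeff_in_eq_cpart: "coeff_in v d f = cpart {v} (single v d) f"
  by (intro poly_mapping_eqI) (simp add: lookup_coeff_in lookup_cpart in_keys_iff)

lemma lookup_le_deg_in: "lookup f m \<noteq> 0 \<Longrightarrow> lookup m v \<le> deg_in v f"
  unfolding deg_in_def by (intro Max_ge) (auto simp: in_keys_iff)

lemma deg_in_le: "(\<And>m. lookup f m \<noteq> 0 \<Longrightarrow> lookup m v \<le> n) \<Longrightarrow> deg_in v f \<le> n"
  unfolding deg_in_def by (intro Max.boundedI) (auto simp: in_keys_iff)

lemma deg_in_attained:
  assumes "deg_in v f \<noteq> 0"
  obtains m where "lookup f m \<noteq> 0" "lookup m v = deg_in v f"
proof -
  have "deg_in v f \<in> insert 0 ((\<lambda>m. lookup m v) ` keys f)"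
    unfolding deg_in_def by (rule Max_in) auto
  then show ?thesis using assms that by (auto simp: in_keys_iff)
qed

lemma deg_in_eq_0_iff: "deg_in v f = 0 \<longleftrightarrow> v \<notin> vars f"
proof
  assume "deg_in v f = 0"
  then show "v \<notin> vars f" using lookup_le_deg_in[of f _ v] by (metis in_vars_iff le_zero_eq)
next
  assume v: "v \<notin> vars f"
  have "deg_in v f \<le> 0"
    using v by (intro deg_in_le) (auto simp: in_vars_iff)
  then show "deg_in v f = 0" by simp
qed

lemma coeff_in_above_deg: "deg_in v f < k \<Longrightarrow> coeff_in v k f = 0"
  using lookup_le_deg_in[of f _ v]
  by (intro poly_mapping_eqI) (force simp: lookup_coeff_in lookup_add)

lemma coeff_in_deg_nonzero:
  assumes "f \<noteq> 0"
  shows "coeff_in v (deg_in v f) f \<noteq> 0"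
proof -
  obtain m where m: "lookup f m \<noteq> 0" "lookup m v = deg_in v f"
  proof (cases "deg_in v f = 0")
    case True
    obtain m where "lookup f m \<noteq> 0"
      using assms by (metis lookup_zero poly_mapping_eqI)
    then show ?thesis using that True lookup_le_deg_in[of f m v] by auto
  qed (use deg_in_attained in blast)
  have "m = restr (- {v}) m + single v (deg_in v f)"
    using m(2) by (intro poly_mapping_eqI) (auto simp: lookup_add lookup_restr lookup_single when_def)
  then have "lookup (coeff_in v (deg_in v f) f) (restr (- {v}) m) \<noteq> 0"
    using m(1) by (simp add: lookup_coeff_in lookup_restr)
  then show ?thesis by auto
qed

text \<open>The coefficients remain in the same type, so that they are free of \<open>v\<close> is a
  lemma and not a typing fact. The representation is unique only among polynomials with
  \<open>v\<close>-free coefficients (\<open>upoly_unique\<close>), and that uniqueness carries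
  products over to univariate polynomials.\<close>

definition upoly :: "('d, 'y) dvar \<Rightarrow> ('d, 'y, 'k::comm_ring_1) dpoly \<Rightarrow> ('d, 'y, 'k) dpoly poly" where
  "upoly v f = Abs_poly (\<lambda>k. coeff_in v k f)"

lemma coeff_upoly [simp]: "coeff (upoly v f) k = coeff_in v k f"
  unfolding upoly_def
  by (subst Abs_poly_inverse) (auto simp: MOST_nat intro!: exI[of _ "deg_in v f"] coeff_in_above_deg)

lemma degree_upoly [simp]: "degree (upoly v f) = deg_in v f"
proof (cases "f = 0")
  case True
  then have "upoly v f = 0" by (intro poly_eqI) (simp add: coeff_in_def)
  then show ?thesis using True by (simp add: deg_in_def)
next
  case False
  show ?thesis
    using coeff_in_deg_nonzero[OF False, of v]
    by (intro antisym degree_le le_degree) (auto simp: coeff_in_above_deg)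
qed

lemma vars_coeff_in: "vars (coeff_in v k f) \<subseteq> vars f - {v}"
  unfolding coeff_in_eq_cpart by (rule vars_cpart)

lemma mon_single: "(mon (single v k) :: ('d, 'y, 'k::comm_ring_1) dpoly) = var v ^ k"
proof (induction k)
  case (Suc k)
  have "(mon (single v (Suc k)) :: ('d, 'y, 'k) dpoly) =
      mon (single v 1) * mon (single v k)"
    by (simp add: mult_single flip: single_add)
  then show ?case using Suc by (simp only: power_Suc var_def)
qed simp

lemma poly_upoly [simp]: "poly (upoly v f) (var v) = f"
proof -
  let ?M = "single v ` {..deg_in v f}"
  have "f = (\<Sum>\<mu>\<in>?M. cpart {v} \<mu> f * mon \<mu>)"
  proof (rule cpart_expansion)
    show "restr {v} ` keys f \<subseteq> ?M"
    proof
      fix \<mu> assume "\<mu> \<in> restr {v} ` keys f"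
      then obtain m where m: "m \<in> keys f" "\<mu> = restr {v} m" by auto
      have "\<mu> = single v (lookup m v)"
        unfolding m by (intro poly_mapping_eqI) (auto simp: lookup_restr lookup_single when_def)
      then show "\<mu> \<in> ?M" using m lookup_le_deg_in[of f m v] by (auto simp: in_keys_iff)
    qed
  qed (auto split: if_splits)
  also have "\<dots> = (\<Sum>k\<le>deg_in v f. coeff_in v k f * var v ^ k)"
    by (subst sum.reindex) (auto simp: inj_on_def coeff_in_eq_cpart mon_single dest: inj_onD[OF inj_single])
  finally show ?thesis by (simp add: poly_altdef)
qed

lemma coeff_in_poly:
  fixes F :: "('d, 'y, 'k::comm_ring_1) dpoly poly"
  assumes "\<And>k. v \<notin> vars (coeff F k)"
  shows "upoly v (poly F (var v)) = F"
proof (rule poly_eqI)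
  fix j
  have "cpart {v} (single v j) (coeff F k * mon (single v k)) =
      (if k = j then coeff F j else 0)" for k
    using assms by (subst cpart_mult_mon) (auto split: if_splits dest: arg_cong[where f = "\<lambda>m. lookup m v"])
  then have "coeff_in v j (poly F (var v)) = (\<Sum>k\<le>degree F. if k = j then coeff F j else 0)"
    by (simp add: poly_altdef coeff_in_eq_cpart cpart_sum mon_single)
  then show "coeff (upoly v (poly F (var v))) j = coeff F j"
    by (simp add: coeff_eq_0)
qed

lemma upoly_unique:
  assumes "\<And>k. v \<notin> vars (coeff F k)" "poly F (var v) = f"
  shows "upoly v f = F"
  using coeff_in_poly[of v F] assms by simp

lemma coeff_in_free: "v \<notin> vars (coeff_in v k f)"
  using vars_coeff_in[of v k f] by auto

lemma upoly_mult: "upoly v (f * g) = upoly v f * upoly v g"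
proof (rule upoly_unique)
  fix k
  have "coeff (upoly v f * upoly v g) k \<in> polys_in (- {v})"
    unfolding coeff_mult coeff_upoly
    by (intro polys_in_sum polys_in_mult) (auto simp: polys_in_def coeff_in_free)
  then show "v \<notin> vars (coeff (upoly v f * upoly v g) k)" by (auto simp: polys_in_def)
qed simp

lemma upoly_add: "upoly v (f + g) = upoly v f + upoly v g"
  by (rule poly_eqI) (simp add: coeff_in_eq_cpart cpart_add)

lemma upoly_free:
  assumes "v \<notin> vars f"
  shows "upoly v f = [:f:]"
  by (rule upoly_unique) (use assms in \<open>auto simp: coeff_pCons split: nat.splits\<close>)

lemma upoly_power: "upoly v (f ^ n) = upoly v f ^ n"
  by (induction n) (simp_all add: upoly_free upoly_mult one_pCons)

lemma upoly_diff: "upoly v (f - g) = upoly v f - upoly v g"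
proof -
  have "upoly v f = upoly v (f - g) + upoly v g" by (simp flip: upoly_add)
  then show ?thesis by simp
qed

text \<open>Induction on the number of variables that occur: the leading coefficients with respect
  to one of them are free of it, and their product is the top coefficient of the zero
  product.\<close>

lemma dpoly_no_zero_divisors:
  fixes f g :: "('d, 'y, 'k::idom) dpoly"
  assumes "f * g = 0"
  shows "f = 0 \<or> g = 0"
  using assms
proof (induction "card (vars f \<union> vars g)" arbitrary: f g rule: less_induct)
  case less
  show ?case
  proof (cases "vars f \<union> vars g = {}")
    case True
    then obtain a b where "f = const a" "g = const b" using vars_empty_imp_const by blast
    moreover from this have "a * b = 0"
      using less.prems by (metis add.right_neutral lookup_single_eq lookup_zero mult_single)
    ultimately show ?thesis by auto
  next
    case False
    then obtain v where v: "v \<in> vars f \<union> vars g" by auto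
    let ?c = "coeff_in v (deg_in v f) f" and ?d = "coeff_in v (deg_in v g) g"
    have "vars ?c \<union> vars ?d \<subseteq> vars f \<union> vars g - {v}"
      using vars_coeff_in[of v _ f] vars_coeff_in[of v _ g] by blast
    then have "vars ?c \<union> vars ?d \<subset> vars f \<union> vars g" using v by blast
    then have "card (vars ?c \<union> vars ?d) < card (vars f \<union> vars g)"
      by (intro psubset_card_mono) auto
    moreover have "?c * ?d = coeff (upoly v f * upoly v g) (degree (upoly v f) + degree (upoly v g))"
      unfolding coeff_mult_degree_sum by simp
    then have "?c * ?d = 0"
      by (simp add: less.prems coeff_in_eq_cpart flip: upoly_mult)
    ultimately have "?c = 0 \<or> ?d = 0" using less.hyps by blast
    then show ?thesis using coeff_in_deg_nonzero by blast
  qed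
qed

text \<open>The induction eliminates one coordinate by pivoting.\<close>

lemma linear_dependence:
  fixes x :: "'i \<Rightarrow> 'j \<Rightarrow> 'r::comm_ring_1" and K :: "'r set"
  assumes K: "0 \<in> K" "1 \<in> K" "\<And>a b. a \<in> K \<Longrightarrow> b \<in> K \<Longrightarrow> a - b \<in> K"
      "\<And>a b. a \<in> K \<Longrightarrow> b \<in> K \<Longrightarrow> a * b \<in> K"
      "\<And>a b. a \<in> K \<Longrightarrow> b \<in> K \<Longrightarrow> a * b = 0 \<Longrightarrow> a = 0 \<or> b = 0"
    and "finite J" "finite X" "card J < card X" "\<And>i j. i \<in> X \<Longrightarrow> j \<in> J \<Longrightarrow> x i j \<in> K"
  shows "\<exists>e. (\<forall>i\<in>X. e i \<in> K) \<and> (\<exists>i\<in>X. e i \<noteq> 0) \<and> (\<forall>j\<in>J. (\<Sum>i\<in>X. e i * x i j) = 0)"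
  using assms(6-)
proof (induction J arbitrary: X x rule: finite_induct)
  case empty
  then obtain i where "i \<in> X" by fastforce
  then show ?case using K(1,2) by (intro exI[of _ "\<lambda>_. 1"]) auto
next
  case (insert j0 J)
  show ?case
  proof (cases "\<forall>i\<in>X. x i j0 = 0")
    case True
    have "\<exists>e. (\<forall>i\<in>X. e i \<in> K) \<and> (\<exists>i\<in>X. e i \<noteq> 0) \<and> (\<forall>j\<in>J. (\<Sum>i\<in>X. e i * x i j) = 0)"
      using insert by (intro insert.IH) auto
    then show ?thesis using True by auto
  next
    case False
    then obtain p where p: "p \<in> X" "x p j0 \<noteq> 0" by auto
    \<comment> \<open>Fraction-free elimination: cross-multiplying keeps the entries in
      \<open>K\<close>, which is only a domain, and makes column \<open>j0\<close> vanish.\<close>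
    define z where "z i j = x p j0 * x i j - x i j0 * x p j" for i j
    have "\<exists>e. (\<forall>i\<in>X - {p}. e i \<in> K) \<and> (\<exists>i\<in>X - {p}. e i \<noteq> 0) \<and> (\<forall>j\<in>J. (\<Sum>i\<in>X - {p}. e i * z i j) = 0)"
      using insert p by (intro insert.IH) (auto simp: z_def intro!: K)
    then obtain e where e: "\<And>i. i \<in> X - {p} \<Longrightarrow> e i \<in> K" "\<exists>i\<in>X - {p}. e i \<noteq> 0"
      "\<And>j. j \<in> J \<Longrightarrow> (\<Sum>i\<in>X - {p}. e i * z i j) = 0" by blast
    define c where "c = (\<Sum>i\<in>X - {p}. e i * x i j0)"
    \<comment> \<open>The factor \<open>x p j0\<close> clears the denominator of the elimination and
      is nonzero, so the solution stays nontrivial; the pivot coefficient \<open>- c\<close> cancels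
      column \<open>j0\<close>.\<close>
    define e' where "e' i = (if i = p then - c else x p j0 * e i)" for i
    have uminus: "- a \<in> K" if "a \<in> K" for a using K(3)[OF K(1) that] by simp
    have sum: "sum f A \<in> K" if "\<And>i. i \<in> A \<Longrightarrow> f i \<in> K" for f :: "'i \<Rightarrow> 'r" and A
      using that
    proof (induction A rule: infinite_finite_induct)
      case (insert i A)
      then have "f i - (- sum f A) \<in> K" by (intro K(3) uminus) auto
      then show ?case using insert by simp
    qed (use K(1) in auto)
    have "c \<in> K" unfolding c_def using e(1) insert.prems by (intro sum K(4)) auto
    then have 1: "e' i \<in> K" if "i \<in> X" for i
      using that e(1) p insert.prems uminus by (auto simp: e'_def intro!: K(4))
    obtain i where i: "i \<in> X - {p}" "e i \<noteq> 0" using e(2) by auto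
    have "e' i \<noteq> 0" using K(5)[of "x p j0" "e i"] i p e(1) insert.prems by (auto simp: e'_def)
    then have 2: "\<exists>i\<in>X. e' i \<noteq> 0" using i by auto
    have "(\<Sum>i\<in>X. e' i * x i j) = 0" if j: "j \<in> insert j0 J" for j
    proof -
      have "(\<Sum>i\<in>X. e' i * x i j) = e' p * x p j + (\<Sum>i\<in>X - {p}. e' i * x i j)"
        using p insert.prems by (simp add: sum.remove)
      also have "(\<Sum>i\<in>X - {p}. e' i * x i j) = (\<Sum>i\<in>X - {p}. e i * z i j + (e i * x i j0) * x p j)"
        by (intro sum.cong) (auto simp: e'_def z_def algebra_simps)
      also have "\<dots> = (\<Sum>i\<in>X - {p}. e i * z i j) + c * x p j"
        by (simp add: sum.distrib c_def sum_distrib_right)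
      also have "(\<Sum>i\<in>X - {p}. e i * z i j) = 0"
        using j e(3) by (cases "j = j0") (auto simp: z_def mult.commute)
      finally show ?thesis by (simp add: e'_def)
    qed
    then show ?thesis using 1 2 by blast
  qed
qed

subsection \<open>Ideals and primes\<close>

abbreviation ideal :: "'r::comm_ring_1 set \<Rightarrow> bool" where
  "ideal \<equiv> module.subspace (*)"

lemma ideal_iff:
  "ideal I \<longleftrightarrow> (0::'r::comm_ring_1) \<in> I \<and> (\<forall>x\<in>I. \<forall>y\<in>I. x + y \<in> I) \<and> (\<forall>c. \<forall>x\<in>I. c * x \<in> I)"
proof -
  interpret module "(*) :: 'r \<Rightarrow> 'r \<Rightarrow> 'r" by unfold_locales (auto simp: algebra_simps)
  show ?thesis by (rule subspace_def)
qed

context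
  fixes I :: "'r::comm_ring_1 set"
  assumes I: "ideal I"
begin

lemma ideal_0: "0 \<in> I"
  and ideal_add: "x \<in> I \<Longrightarrow> y \<in> I \<Longrightarrow> x + y \<in> I"
  and ideal_mult: "x \<in> I \<Longrightarrow> c * x \<in> I"
  using I by (auto simp: ideal_iff)

lemma ideal_mult_right: "x \<in> I \<Longrightarrow> x * c \<in> I"
  using ideal_mult[of x c] by (simp add: mult.commute)

lemma ideal_diff: "x \<in> I \<Longrightarrow> y \<in> I \<Longrightarrow> x - y \<in> I"
  using ideal_add[of x "- y"] ideal_mult[of y "- 1"] by simp

lemma ideal_sum: "(\<And>i. i \<in> A \<Longrightarrow> f i \<in> I) \<Longrightarrow> sum f A \<in> I"
  by (induction A rule: infinite_finite_induct) (auto intro: ideal_0 ideal_add)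

lemma ideal_cong: "x - y \<in> I \<Longrightarrow> x \<in> I \<longleftrightarrow> y \<in> I"
  using ideal_add[of "x - y" y] ideal_diff[of x "x - y"] by auto

end

definition prime_ideal :: "'r::comm_ring_1 set \<Rightarrow> bool" where
  "prime_ideal P \<longleftrightarrow> ideal P \<and> P \<noteq> UNIV \<and> (\<forall>f g. f * g \<in> P \<longrightarrow> f \<in> P \<or> g \<in> P)"

lemma ideal_UNIV_iff: "ideal I \<Longrightarrow> I = UNIV \<longleftrightarrow> (1::'r::comm_ring_1) \<in> I"
  using ideal_mult[of I 1] by auto

text \<open>An ideal maximal among those containing \<open>I\<close> and avoiding \<open>M\<close>
  is prime: if neither \<open>f\<close> nor \<open>g\<close> lies in it, adjoining either one meets
  \<open>M\<close>, and the product of the two elements found lies in \<open>M\<close> and, when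
  \<open>f * g\<close> is in the ideal, also in the ideal.\<close>

lemma ex_prime_ideal_disjoint:
  fixes I :: "'r::comm_ring_1 set"
  assumes "ideal I" "1 \<in> M" "\<And>a b. a \<in> M \<Longrightarrow> b \<in> M \<Longrightarrow> a * b \<in> M" "I \<inter> M = {}"
  shows "\<exists>P. prime_ideal P \<and> I \<subseteq> P \<and> P \<inter> M = {}"
proof -
  define A where "A = {J. ideal J \<and> I \<subseteq> J \<and> J \<inter> M = {}}"
  have "\<exists>P\<in>A. \<forall>X\<in>A. P \<subseteq> X \<longrightarrow> X = P"
  proof (rule subset_Zorn_nonempty)
    show "A \<noteq> {}" using assms by (auto simp: A_def)
    fix C assume C: "C \<noteq> {}" "subset.chain A C"
    then have sub: "C \<subseteq> A" and chain: "\<And>X Y. X \<in> C \<Longrightarrow> Y \<in> C \<Longrightarrow> X \<subseteq> Y \<or> Y \<subseteq> X"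
      by (auto simp: subset.chain_def subset_chain_def)
    have "ideal (\<Union>C)" unfolding ideal_iff
    proof (intro conjI ballI allI)
      show "0 \<in> \<Union>C" using C(1) sub by (auto simp: A_def dest!: ideal_0)
    next
      fix x y assume "x \<in> \<Union>C" "y \<in> \<Union>C"
      then obtain X where "X \<in> C" "x \<in> X" "y \<in> X" using chain by blast
      then show "x + y \<in> \<Union>C" using sub by (auto simp: A_def intro: ideal_add)
    next
      fix c x assume "x \<in> \<Union>C"
      then show "c * x \<in> \<Union>C" using sub by (auto simp: A_def intro: ideal_mult)
    qed
    then show "\<Union>C \<in> A" using C(1) sub by (auto simp: A_def)
  qed
  then obtain P where P: "P \<in> A" "\<And>X. X \<in> A \<Longrightarrow> P \<subseteq> X \<Longrightarrow> X = P" by auto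
  have P': "ideal P" "I \<subseteq> P" "P \<inter> M = {}" using P(1) by (auto simp: A_def)
  have ext: "\<exists>c p. p \<in> P \<and> p + c * f \<in> M" if "f \<notin> P" for f
  proof -
    let ?Q = "{p + c * f | p c. p \<in> P}"
    have "ideal ?Q" unfolding ideal_iff
    proof (intro conjI ballI allI)
      show "0 \<in> ?Q" using ideal_0[OF P'(1)] by (force intro: exI[of _ 0])
    next
      fix x y assume "x \<in> ?Q" "y \<in> ?Q"
      then obtain p c q d where "x = p + c * f" "y = q + d * f" "p \<in> P" "q \<in> P" by auto
      then have "x + y = (p + q) + (c + d) * f" "p + q \<in> P"
        using ideal_add[OF P'(1)] by (auto simp: algebra_simps)
      then show "x + y \<in> ?Q" by blast
    next
      fix d x assume "x \<in> ?Q"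
      then obtain p c where "x = p + c * f" "p \<in> P" by auto
      then have "d * x = d * p + (d * c) * f" "d * p \<in> P"
        by (auto simp: distrib_left mult.assoc intro: ideal_mult[OF P'(1)])
      then show "d * x \<in> ?Q" by blast
    qed
    moreover have "P \<subseteq> ?Q" by (force intro: exI[of _ 0])
    moreover have "f \<in> ?Q" using ideal_0[OF P'(1)] by (force intro: exI[of _ 1])
    ultimately have "?Q \<notin> A" using P(2)[of ?Q] that by blast
    then have "?Q \<inter> M \<noteq> {}" using \<open>ideal ?Q\<close> \<open>P \<subseteq> ?Q\<close> P'(2) unfolding A_def by blast
    then show ?thesis by blast
  qed
  have "f \<in> P \<or> g \<in> P" if "f * g \<in> P" for f g
  proof (rule ccontr)
    assume "\<not> (f \<in> P \<or> g \<in> P)"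
    then obtain c p d q where *: "p \<in> P" "p + c * f \<in> M" "q \<in> P" "q + d * g \<in> M"
      using ext by meson
    have "(p + c * f) * (q + d * g) = (q + d * g) * p + c * f * q + c * d * (f * g)"
      by (simp add: algebra_simps)
    also have "\<dots> \<in> P"
      using * that by (auto intro!: ideal_add[OF P'(1)] intro: ideal_mult[OF P'(1)])
    finally show False using assms(3)[OF *(2,4)] P'(3) by auto
  qed
  moreover have "P \<noteq> UNIV" using assms(2) P'(3) by auto
  ultimately show ?thesis using P' unfolding prime_ideal_def by blast
qed

text \<open>Consider the lowest coefficients outside the prime.\<close>

lemma prime_ideal_poly_mult:
  fixes F G :: "'r::comm_ring_1 poly"
  assumes P: "prime_ideal P" and "coeff F i \<notin> P" "coeff G j \<notin> P"
  shows "\<exists>k. coeff (F * G) k \<notin> P"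
proof -
  define m where "m = (LEAST i. coeff F i \<notin> P)"
  define n where "n = (LEAST j. coeff G j \<notin> P)"
  have m: "coeff F m \<notin> P" "\<And>i. i < m \<Longrightarrow> coeff F i \<in> P"
    unfolding m_def using LeastI[of "\<lambda>i. coeff F i \<notin> P"] not_less_Least assms(2) by auto
  have n: "coeff G n \<notin> P" "\<And>i. i < n \<Longrightarrow> coeff G i \<in> P"
    unfolding n_def using LeastI[of "\<lambda>i. coeff G i \<notin> P"] not_less_Least assms(3) by auto
  have I: "ideal P" using P by (simp add: prime_ideal_def)
  have "coeff (F * G) (m + n) = coeff F m * coeff G n + (\<Sum>i\<in>{..m + n} - {m}. coeff F i * coeff G (m + n - i))"
    unfolding coeff_mult by (subst sum.remove[of _ m]) auto
  moreover have "(\<Sum>i\<in>{..m + n} - {m}. coeff F i * coeff G (m + n - i)) \<in> P"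
  proof (rule ideal_sum[OF I])
    fix i assume i: "i \<in> {..m + n} - {m}"
    show "coeff F i * coeff G (m + n - i) \<in> P"
    proof (cases "i < m")
      case False
      then have "m + n - i < n" using i by auto
      then show ?thesis using n(2) ideal_mult[OF I] by blast
    qed (use m(2) ideal_mult_right[OF I] in blast)
  qed
  ultimately have "coeff (F * G) (m + n) \<in> P \<longleftrightarrow> coeff F m * coeff G n \<in> P"
    by (intro ideal_cong[OF I]) simp
  then show ?thesis using P m(1) n(1) unfolding prime_ideal_def by blast
qed

lemma prime_ideal_poly_power:
  assumes P: "prime_ideal P" and "coeff F i \<notin> P"
  shows "\<exists>k. coeff (F ^ n) k \<notin> P"
proof (induction n)
  case 0
  have "coeff (1::'a poly) 0 \<notin> P" using P ideal_UNIV_iff unfolding prime_ideal_def by auto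
  then show ?case unfolding power_0 by blast
next
  case (Suc n)
  then show ?case using prime_ideal_poly_mult[OF assms] by auto
qed

subsection \<open>Derivations\<close>

lemma single_add_cases: "m - single v 1 = n \<and> lookup m v \<noteq> 0 \<longleftrightarrow> m = n + single v (1::nat)"
proof
  assume *: "m - single v 1 = n \<and> lookup m v \<noteq> 0"
  then have n: "n = m - single v 1" by simp
  show "m = n + single v 1"
    unfolding n using * by (intro poly_mapping_eqI) (auto simp: lookup_add lookup_minus lookup_single when_def)
qed (auto simp: exp_add_diff lookup_add)

lemma pdiff_single:
  "pdiff v (single m a) =
    single (m - single v 1) (of_nat (lookup m v) * a)"
  by (simp add: pdiff_def)

lemma pdiff_add: "pdiff v (f + g) = pdiff v f + pdiff v g"
  unfolding pdiff_def
  by (rule setsum_keys_plus_distrib) (auto simp: distrib_left single_add)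

lemma lookup_pdiff:
  "lookup (pdiff v f) n =
    of_nat (lookup n v + 1) * lookup f (n + single v 1)"
proof (induction f rule: poly_mapping_additive_induct)
  case (single m a)
  show ?case
    using single_add_cases[of m v n]
    by (cases "m = n + single v 1")
      (auto simp: pdiff_single lookup_single when_def lookup_add exp_add_diff)
next
  case (add f g)
  then show ?case by (simp add: pdiff_add lookup_add distrib_left)
qed

lemma coeff_in_pdiff: "coeff_in v k (pdiff v f) = of_nat (Suc k) * coeff_in v (Suc k) f"
proof (rule poly_mapping_eqI)
  fix n
  have "lookup (of_nat (Suc k) * coeff_in v (Suc k) f) n =
      of_nat (Suc k) * lookup (coeff_in v (Suc k) f) n"
    using lookup_mult_single[of "coeff_in v (Suc k) f" 0 "of_nat (Suc k)" n]
    by (simp add: mult.commute del: of_nat_Suc)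
  then show "lookup (coeff_in v k (pdiff v f)) n =
      lookup (of_nat (Suc k) * coeff_in v (Suc k) f) n"
    by (simp add: lookup_coeff_in lookup_pdiff lookup_add add.assoc del: of_nat_Suc flip: single_add)
qed

lemma pdiff_free:
  assumes "v \<notin> vars f"
  shows "pdiff v f = 0"
proof (rule poly_mapping_eqI)
  fix n
  have "lookup f (n + single v 1) = 0"
    using assms unfolding in_vars_iff by (metis add_is_0 lookup_add lookup_single_eq one_neq_zero)
  then show "lookup (pdiff v f) n = lookup 0 n"
    by (simp add: lookup_pdiff)
qed

lemma vars_pdiff: "vars (pdiff v f) \<subseteq> vars f"
proof
  fix w assume "w \<in> vars (pdiff v f)"
  then obtain m where "lookup f (m + single v 1) \<noteq> 0" "lookup m w \<noteq> 0"
    unfolding in_vars_iff lookup_pdiff by (metis mult_zero_right)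
  then show "w \<in> vars f"
    unfolding in_vars_iff by (intro exI[of _ "m + single v 1"]) (simp add: lookup_add)
qed

lemma pdiff_mult: "pdiff v (f * g) = pdiff v f * g + f * pdiff v g"
proof (induction f rule: poly_mapping_additive_induct)
  case (single m a)
  show ?case
  proof (induction g rule: poly_mapping_additive_induct)
    case (single n b)
    have 1: "m - single v 1 + n = m + n - single v 1" if "lookup m v \<noteq> 0"
      using that by (intro poly_mapping_eqI) (auto simp: lookup_add lookup_minus lookup_single when_def)
    have 2: "m + (n - single v 1) = m + n - single v 1" if "lookup n v \<noteq> 0"
      using that by (intro poly_mapping_eqI) (auto simp: lookup_add lookup_minus lookup_single when_def)
    show ?case
      using 1 2
      by (cases "lookup m v = 0"; cases "lookup n v = 0")
        (simp_all add: mult_single pdiff_single lookup_add ring_distribs single_add ac_simps)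
  qed (simp add: pdiff_add ring_distribs)
qed (simp add: pdiff_add ring_distribs)

text \<open>\<open>pderivation\<close> is the sum of its action on the coefficients and this action
  on the variables; the Leibniz rule is proved for each summand separately.\<close>

definition vderiv :: "'d \<Rightarrow> ('d, 'y, 'k::comm_ring_1) dpoly \<Rightarrow> ('d, 'y, 'k) dpoly" where
  "vderiv i f = (\<Sum>v\<in>vars f. pdiff v f * var (dapply (single i 1) v))"

text \<open>A common index set makes the sums for \<open>f\<close>, \<open>g\<close> and their sum
  or product comparable term by term.\<close>

lemma vderiv_superset:
  "finite V \<Longrightarrow> vars f \<subseteq> V \<Longrightarrow> vderiv i f = (\<Sum>v\<in>V. pdiff v f * var (dapply (single i 1) v))"
  unfolding vderiv_def by (rule sum.mono_neutral_left) (auto simp: pdiff_free)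

lemma vderiv_add: "vderiv i (f + g) = vderiv i f + vderiv i g"
proof -
  let ?V = "vars f \<union> vars g"
  show ?thesis
    using vars_add[of f g]
    by (subst (1 2 3) vderiv_superset[of ?V]) (auto simp: pdiff_add sum.distrib ring_distribs)
qed

lemma vderiv_mult: "vderiv i (f * g) = vderiv i f * g + f * vderiv i g"
proof -
  let ?V = "vars f \<union> vars g"
  show ?thesis
    using vars_mult[of f g]
    by (subst (1 2 3) vderiv_superset[of ?V])
      (auto simp: pdiff_mult sum.distrib ring_distribs sum_distrib_left sum_distrib_right ac_simps)
qed

text \<open>Commutation of the derivations then needs checking only on constants and
  variables.\<close>

lemma dpoly_ring_induct [case_names const var add mult]:
  fixes f :: "('d, 'y, 'k::comm_ring_1) dpoly"
  assumes const: "\<And>c. P (const c)" and var: "\<And>v. P (var v)"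
    and add: "\<And>f g. P f \<Longrightarrow> P g \<Longrightarrow> P (f + g)" and mult: "\<And>f g. P f \<Longrightarrow> P g \<Longrightarrow> P (f * g)"
  shows "P f"
proof (induction f rule: poly_mapping_additive_induct)
  case (single m a)
  have "P (mon m)"
  proof (induction m rule: poly_mapping_additive_induct)
    case (single v n)
    have "P (var v ^ n)"
    proof (induction n)
      case 0
      then show ?case using const[of 1] by simp
    qed (simp add: mult var)
    then show ?case by (simp add: mon_single)
  next
    case (add m n)
    then show ?case using mult[of "mon m" "mon n"] by (simp add: mult_single)
  qed
  then show ?case unfolding single_eq_const_mon[of m a] by (intro mult const)
qed (rule add)

locale diff_field =
  fixes D :: "'d \<Rightarrow> 'k::field \<Rightarrow> 'k"
  assumes differential_field: "differential_field D"
begin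

lemma D_add: "D i (a + b) = D i a + D i b"
  and D_mult: "D i (a * b) = D i a * b + a * D i b"
  and D_commute: "D i (D j a) = D j (D i a)"
  using differential_field by (auto simp: differential_field_def)

lemma D_0 [simp]: "D i 0 = 0"
  using D_add[of i 0 0] by (metis add_0 add_cancel_right_right)

lemma D_1 [simp]: "D i 1 = 0"
  using D_mult[of i 1 1] by (metis add_cancel_right_right mult.left_neutral mult.right_neutral)

lemma lookup_map_D: "lookup (Poly_Mapping.map (D i) f) m = D i (lookup f m)"
  by (simp add: map.rep_eq when_def)

lemma map_D_add: "Poly_Mapping.map (D i) (f + g) = Poly_Mapping.map (D i) f + Poly_Mapping.map (D i) g"
  by (intro poly_mapping_eqI) (simp add: lookup_map_D lookup_add D_add)

lemma map_D_single: "Poly_Mapping.map (D i) (single m a) = single m (D i a)"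
  by (intro poly_mapping_eqI) (simp add: lookup_map_D lookup_single when_def)

lemma map_D_mult:
  fixes f g :: "('d, 'y, 'k) dpoly"
  shows "Poly_Mapping.map (D i) (f * g) = Poly_Mapping.map (D i) f * g + f * Poly_Mapping.map (D i) g"
proof (induction f rule: poly_mapping_additive_induct)
  case (single m a)
  show ?case
  proof (induction g rule: poly_mapping_additive_induct)
    case (single n b)
    show ?case by (simp add: mult_single map_D_single D_mult single_add)
  qed (simp add: map_D_add ring_distribs)
qed (simp add: map_D_add ring_distribs)

lemma pderivation_eq: "pderivation D i f = Poly_Mapping.map (D i) f + vderiv i f"
  by (simp add: pderivation_def vderiv_def)

lemma pderivation_add: "pderivation D i (f + g) = pderivation D i f + pderivation D i g"
  by (simp add: pderivation_eq map_D_add vderiv_add)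

lemma pderivation_mult: "pderivation D i (f * g) = pderivation D i f * g + f * pderivation D i g"
  by (simp add: pderivation_eq map_D_mult vderiv_mult ring_distribs)

lemma pderivation_const: "pderivation D i (const c) = const (D i c)"
  by (simp add: pderivation_eq map_D_single vderiv_def vars_single)

lemma pderivation_0 [simp]: "pderivation D i 0 = 0"
  using pderivation_const[of i 0] by simp

lemma pderivation_1 [simp]: "pderivation D i 1 = 0"
  using pderivation_const[of i 1] by simp

lemma pderivation_var:
  "pderivation D i (var v :: ('d, 'y, 'k) dpoly) = var (dapply (single i 1) v)"
proof -
  have "Poly_Mapping.map (D i) (var v :: ('d, 'y, 'k) dpoly) = 0"
    by (simp add: var_def map_D_single)
  moreover have "pdiff v (var v :: ('d, 'y, 'k) dpoly) = 1"
    by (simp add: var_def pdiff_single)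
  ultimately show ?thesis by (simp add: pderivation_eq vderiv_def)
qed

lemma dapply_dapply: "dapply \<theta> (dapply \<theta>' v) = dapply (\<theta> + \<theta>') v"
  by (simp add: dapply_def add.assoc)

lemma pderivation_commute:
  fixes f :: "('d, 'y, 'k) dpoly"
  shows "pderivation D i (pderivation D j f) = pderivation D j (pderivation D i f)"
  by (induction f rule: dpoly_ring_induct)
    (auto simp: pderivation_const pderivation_var pderivation_add pderivation_mult D_commute
      dapply_dapply add.commute ring_distribs)

lemma vars_map_D: "vars (Poly_Mapping.map (D i) (f :: ('d, 'y, 'k) dpoly)) \<subseteq> vars f"
  by (auto simp: in_vars_iff lookup_map_D) (metis D_0)

lemma vars_pderivation:
  fixes f :: "('d, 'y, 'k) dpoly"
  shows "vars (pderivation D i f) \<subseteq> vars f \<union> dapply (single i 1) ` vars f"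
proof -
  have "f \<in> polys_in (vars f)" by (simp add: polys_in_def)
  then have "pdiff v f \<in> polys_in (vars f)" "Poly_Mapping.map (D i) f \<in> polys_in (vars f)" for v
    using vars_pdiff[of v f] vars_map_D[of i f] by (auto simp: polys_in_def)
  then have "pderivation D i f \<in> polys_in (vars f \<union> dapply (single i 1) ` vars f)"
    unfolding pderivation_eq vderiv_def
    by (intro polys_in_add polys_in_sum polys_in_mult) (auto simp: polys_in_def)
  then show ?thesis by (simp add: polys_in_def)
qed

lemma pderivation_power_mult:
  fixes f g :: "('d, 'y, 'k) dpoly"
  shows "(pderivation D i ^^ n) (f * g) =
    (\<Sum>k\<le>n. of_nat (n choose k) * (pderivation D i ^^ k) f * (pderivation D i ^^ (n - k)) g)"
proof (induction n)
  case (Suc n)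
  let ?d = "pderivation D i"
  let ?T = "\<lambda>k. (?d ^^ k) f * (?d ^^ (Suc n - k)) g"
  have dsum: "?d (sum h A) = (\<Sum>a\<in>A. ?d (h a))" if "finite A" for h :: "nat \<Rightarrow> ('d, 'y, 'k) dpoly" and A
    using that by (induction A) (auto simp: pderivation_add)
  have dnat: "?d (of_nat c) = 0" for c :: nat
    by (induction c) (auto simp: pderivation_add pderivation_const simp flip: single_one)
  have "(?d ^^ Suc n) (f * g) =
      (\<Sum>k\<le>n. of_nat (n choose k) * ?T (Suc k)) + (\<Sum>k\<le>n. of_nat (n choose k) * ?T k)"
    by (simp add: Suc.IH dsum pderivation_mult dnat ring_distribs sum.distrib Suc_diff_le mult.assoc)
  also have "(\<Sum>k\<le>n. of_nat (n choose k) * ?T k) = (\<Sum>k\<le>Suc n. of_nat (n choose k) * ?T k)"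
    by (simp add: binomial_eq_0)
  also have "\<dots> = of_nat (n choose 0) * ?T 0 + (\<Sum>k\<le>n. of_nat (n choose Suc k) * ?T (Suc k))"
    by (rule sum.atMost_Suc_shift)
  also have "(\<Sum>k\<le>n. of_nat (n choose k) * ?T (Suc k)) +
        (of_nat (n choose 0) * ?T 0 + (\<Sum>k\<le>n. of_nat (n choose Suc k) * ?T (Suc k))) =
      of_nat (Suc n choose 0) * ?T 0 + (\<Sum>k\<le>n. of_nat (Suc n choose Suc k) * ?T (Suc k))"
    by (simp add: ring_distribs sum.distrib)
  also have "\<dots> = (\<Sum>k\<le>Suc n. of_nat (Suc n choose k) * ?T k)"
    by (rule sum.atMost_Suc_shift[symmetric])
  finally show ?case by (simp add: mult.assoc)
qed simp

end

subsection \<open>Prime differential ideals\<close>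

lemma differential_ideal_iff:
  "differential_ideal D I \<longleftrightarrow> ideal I \<and> (\<forall>i. \<forall>f\<in>I. pderivation D i f \<in> I)"
  by (simp add: differential_ideal_def)

lemma prime_differential_ideal_iff:
  "prime_differential_ideal D P \<longleftrightarrow> prime_ideal P \<and> (\<forall>i. \<forall>f\<in>P. pderivation D i f \<in> P)"
  by (auto simp: prime_differential_ideal_def prime_ideal_def differential_ideal_iff)

locale diff_field_char_0 = diff_field D for D :: "'d::finite \<Rightarrow> 'k::field_char_0 \<Rightarrow> 'k"
begin

text \<open>Applied to one derivation after the other, this turns the prime ideals supplied by Zorn's lemma
  into differential ones.\<close>

definition dcore :: "'d \<Rightarrow> ('d, 'y, 'k) dpoly set \<Rightarrow> ('d, 'y, 'k) dpoly set" where
  "dcore i Q = {f. \<forall>n. (pderivation D i ^^ n) f \<in> Q}"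

lemma pderivation_funpow_add:
  "(pderivation D i ^^ n) (f + g) = (pderivation D i ^^ n) f + (pderivation D i ^^ n) g"
  by (induction n) (auto simp: pderivation_add)

lemma pderivation_funpow_commute:
  fixes f :: "('d, 'y, 'k) dpoly"
  shows "(pderivation D i ^^ n) (pderivation D j f) = pderivation D j ((pderivation D i ^^ n) f)"
  by (induction n) (auto simp: pderivation_commute[of i j])

text \<open>Let \<open>m\<close> and \<open>n\<close> be the least numbers of derivations that take
  \<open>f\<close> and \<open>g\<close> out of \<open>Q\<close>. In the Leibniz expansion of order
  \<open>m + n\<close> of the product all terms but one contain a factor still in \<open>Q\<close>,
  so the remaining term would lie in \<open>Q\<close> as well.\<close>

lemma prime_ideal_dcore:
  fixes Q :: "('d, 'y, 'k) dpoly set"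
  assumes Q: "prime_ideal Q"
  shows "prime_ideal (dcore i Q)"
proof -
  let ?d = "pderivation D i"
  have I: "ideal Q" using Q by (simp add: prime_ideal_def)
  have d0: "(?d ^^ n) 0 = 0" for n by (induction n) auto
  have "ideal (dcore i Q)"
    unfolding ideal_iff dcore_def
    by (auto simp: d0 pderivation_funpow_add pderivation_power_mult
        intro: ideal_0[OF I] ideal_add[OF I] intro!: ideal_sum[OF I] ideal_mult[OF I])
  moreover have "f \<in> dcore i Q \<or> g \<in> dcore i Q" if fg: "f * g \<in> dcore i Q" for f g
  proof (rule ccontr)
    assume "\<not> (f \<in> dcore i Q \<or> g \<in> dcore i Q)"
    then have ex: "\<exists>n. (?d ^^ n) f \<notin> Q" "\<exists>n. (?d ^^ n) g \<notin> Q" by (auto simp: dcore_def)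
    define m where "m = (LEAST n. (?d ^^ n) f \<notin> Q)"
    define n where "n = (LEAST n. (?d ^^ n) g \<notin> Q)"
    have m: "(?d ^^ m) f \<notin> Q" "\<And>k. k < m \<Longrightarrow> (?d ^^ k) f \<in> Q"
      unfolding m_def using LeastI_ex[OF ex(1)] not_less_Least by auto
    have n: "(?d ^^ n) g \<notin> Q" "\<And>k. k < n \<Longrightarrow> (?d ^^ k) g \<in> Q"
      unfolding n_def using LeastI_ex[OF ex(2)] not_less_Least by auto
    let ?t = "\<lambda>k. of_nat (m + n choose k) * (?d ^^ k) f * (?d ^^ (m + n - k)) g"
    have all: "(\<Sum>k\<le>m + n. ?t k) \<in> Q" using fg by (simp add: dcore_def flip: pderivation_power_mult)
    have split: "(\<Sum>k\<le>m + n. ?t k) = ?t m + (\<Sum>k\<in>{..m + n} - {m}. ?t k)"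
      by (rule sum.remove) auto
    have rest: "(\<Sum>k\<in>{..m + n} - {m}. ?t k) \<in> Q"
    proof (rule ideal_sum[OF I])
      fix k assume k: "k \<in> {..m + n} - {m}"
      show "?t k \<in> Q"
      proof (cases "k < m")
        case False
        then have "m + n - k < n" using k by auto
        then show ?thesis using n(2) ideal_mult[OF I] by blast
      next
        case True
        then show ?thesis using m(2) ideal_mult[OF I] ideal_mult_right[OF I] by blast
      qed
    qed
    have "?t m \<in> Q" using ideal_diff[OF I all rest] unfolding split by simp
    \<comment> \<open>Characteristic zero makes the binomial coefficient a unit, so it can be
      removed from the remaining term.\<close>
    then have "const (inverse (of_nat (m + n choose m))) * ?t m \<in> Q" by (rule ideal_mult[OF I])
    moreover have "const (inverse (of_nat (m + n choose m))) * of_nat (m + n choose m) = (1 :: ('d, 'y, 'k) dpoly)"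
    proof -
      have "m + n choose m \<noteq> 0" by simp
      then show ?thesis
        unfolding single_of_nat[symmetric] mult_single by (simp del: single_of_nat)
    qed
    then have "const (inverse (of_nat (m + n choose m))) * ?t m = (?d ^^ m) f * (?d ^^ n) g"
      by (simp flip: mult.assoc)
    ultimately have "(?d ^^ m) f * (?d ^^ n) g \<in> Q" by simp
    then show False using m(1) n(1) Q unfolding prime_ideal_def by blast
  qed
  moreover have "dcore i Q \<noteq> UNIV"
  proof -
    have "dcore i Q \<subseteq> Q" by (auto simp: dcore_def dest: spec[of _ 0])
    then show ?thesis using Q unfolding prime_ideal_def by blast
  qed
  ultimately show ?thesis unfolding prime_ideal_def by blast
qed

text \<open>Since the derivations commute, passing to \<open>dcore j\<close> keeps closure under the
  derivations treated before; it keeps \<open>I\<close> because \<open>I\<close> is closed under all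
  of them. Finitely many passes suffice.\<close>

lemma ex_prime_differential_ideal_subset:
  fixes Q :: "('d, 'y, 'k) dpoly set"
  assumes Q: "prime_ideal Q" and I: "differential_ideal D I" "I \<subseteq> Q"
  shows "\<exists>P. prime_differential_ideal D P \<and> I \<subseteq> P \<and> P \<subseteq> Q"
proof -
  have "\<exists>P. prime_ideal P \<and> I \<subseteq> P \<and> P \<subseteq> Q \<and> (\<forall>i\<in>F. \<forall>f\<in>P. pderivation D i f \<in> P)"
    if "finite F" for F :: "'d set"
    using that
  proof (induction F)
    case empty
    then show ?case using assms by auto
  next
    case (insert j F)
    then obtain P where P: "prime_ideal P" "I \<subseteq> P" "P \<subseteq> Q" "\<And>i f. i \<in> F \<Longrightarrow> f \<in> P \<Longrightarrow> pderivation D i f \<in> P"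
      by blast
    have "(pderivation D j ^^ n) f \<in> I" if "f \<in> I" for f n
      using that I(1) by (induction n) (auto simp: differential_ideal_iff)
    then have "I \<subseteq> dcore j P" using P(2) by (auto simp: dcore_def)
    moreover have "dcore j P \<subseteq> P" by (auto simp: dcore_def dest: spec[of _ 0])
    moreover have "pderivation D i f \<in> dcore j P" if "f \<in> dcore j P" "i \<in> insert j F" for i f
      using that P(4) by (auto simp: dcore_def pderivation_funpow_commute dest: spec[of _ "Suc _"])
    ultimately show ?case using prime_ideal_dcore[OF P(1)] P(3) by blast
  qed
  from this[of UNIV] show ?thesis by (auto simp: prime_differential_ideal_iff)
qed

lemma ex_prime_differential_ideal_disjoint:
  fixes I :: "('d, 'y, 'k) dpoly set"
  assumes "differential_ideal D I" "1 \<in> M" "\<And>a b. a \<in> M \<Longrightarrow> b \<in> M \<Longrightarrow> a * b \<in> M" "I \<inter> M = {}"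
  shows "\<exists>P. prime_differential_ideal D P \<and> I \<subseteq> P \<and> P \<inter> M = {}"
proof -
  have "ideal I" using assms(1) by (simp add: differential_ideal_iff)
  then obtain Q where Q: "prime_ideal Q" "I \<subseteq> Q" "Q \<inter> M = {}"
    using ex_prime_ideal_disjoint[OF _ assms(2-)] by blast
  then show ?thesis using ex_prime_differential_ideal_subset[OF Q(1) assms(1)] by blast
qed

text \<open>The intersection of a chain of prime differential ideals is again one. Zorn's lemma is
  applied to the complements, so that a maximal element is a minimal prime.\<close>

lemma ex_essential_prime_component_subset:
  fixes I :: "('d, 'y, 'k) dpoly set"
  assumes P: "prime_differential_ideal D P" "I \<subseteq> P"
  shows "\<exists>Q\<in>essential_prime_components D I. Q \<subseteq> P"
proof -
  define A where "A = {- Q | Q. prime_differential_ideal D Q \<and> I \<subseteq> Q \<and> Q \<subseteq> P}"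
  have "\<exists>X\<in>A. \<forall>Y\<in>A. X \<subseteq> Y \<longrightarrow> Y = X"
  proof (rule subset_Zorn_nonempty)
    show "A \<noteq> {}" using P by (auto simp: A_def)
    fix C assume C: "C \<noteq> {}" "subset.chain A C"
    then have sub: "C \<subseteq> A" and chain: "\<And>X Y. X \<in> C \<Longrightarrow> Y \<in> C \<Longrightarrow> X \<subseteq> Y \<or> Y \<subseteq> X"
      by (auto simp: subset.chain_def subset_chain_def)
    define Q where "Q = - \<Union>C"
    have Q: "f \<in> Q \<longleftrightarrow> (\<forall>X\<in>C. f \<in> - X)" for f by (auto simp: Q_def)
    have mem: "prime_differential_ideal D (- X) \<and> I \<subseteq> - X \<and> - X \<subseteq> P" if "X \<in> C" for X
      using that sub by (auto simp: A_def)
    have id: "ideal (- X)" if "X \<in> C" for X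
      using mem[OF that] by (simp add: prime_differential_ideal_iff prime_ideal_def)
    have "ideal Q" unfolding ideal_iff
    proof (intro conjI ballI allI)
      show "0 \<in> Q" unfolding Q using ideal_0[OF id] by blast
      show "x + y \<in> Q" if "x \<in> Q" "y \<in> Q" for x y
        using that unfolding Q by (intro ballI ideal_add[OF id]) auto
      show "c * x \<in> Q" if "x \<in> Q" for c x
        using that unfolding Q by (intro ballI ideal_mult[OF id]) auto
    qed
    moreover have pr: "f \<in> Q \<or> g \<in> Q" if "f * g \<in> Q" for f g
    proof (rule ccontr)
      assume "\<not> (f \<in> Q \<or> g \<in> Q)"
      then obtain X Y where XY: "X \<in> C" "f \<in> X" "Y \<in> C" "g \<in> Y" by (auto simp: Q_def)
      obtain Z where Z: "Z \<in> C" "f \<in> Z" "g \<in> Z" using chain[OF XY(1,3)] XY by auto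
      have "f * g \<in> - Z" using that Z(1) by (auto simp: Q_def)
      then show False
        using mem[OF Z(1)] Z(2,3) by (auto simp: prime_differential_ideal_iff prime_ideal_def)
    qed
    moreover have sub': "Q \<subseteq> P" "I \<subseteq> Q" using C(1) mem Q by blast+
    moreover from this have "Q \<noteq> UNIV"
      using P by (auto simp: prime_differential_ideal_iff prime_ideal_def)
    moreover have "pderivation D i f \<in> Q" if f: "f \<in> Q" for i f
      unfolding Q
    proof
      fix X assume X: "X \<in> C"
      then have "f \<in> - X" using f Q by blast
      then show "pderivation D i f \<in> - X" using mem[OF X] by (simp add: prime_differential_ideal_iff)
    qed
    ultimately have "prime_differential_ideal D Q"
      by (simp add: prime_differential_ideal_iff prime_ideal_def)
    then have "- Q \<in> A" using sub' by (auto simp: A_def)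
    then show "\<Union>C \<in> A" by (simp add: Q_def)
  qed
  then obtain X where X: "X \<in> A" "\<And>Y. Y \<in> A \<Longrightarrow> X \<subseteq> Y \<Longrightarrow> Y = X" by auto
  then obtain Q where Q: "prime_differential_ideal D Q" "I \<subseteq> Q" "Q \<subseteq> P" "X = - Q" by (auto simp: A_def)
  have "Q' = Q" if "prime_differential_ideal D Q'" "I \<subseteq> Q'" "Q' \<subseteq> Q" for Q'
  proof -
    have "- Q' \<in> A" using that Q(3) by (auto simp: A_def)
    then show ?thesis using X(2)[of "- Q'"] that(3) Q(4) by auto
  qed
  then show ?thesis using Q unfolding essential_prime_components_def by blast
qed

text \<open>Elements of a minimal prime are zero divisors modulo \<open>I\<close>. If
  \<open>c\<close> were regular, the multiplicative set of products of a power of \<open>c\<close>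
  with an element outside \<open>P\<close> would avoid \<open>I\<close>; a prime differential ideal
  avoiding it lies in \<open>P\<close>, hence equals \<open>P\<close> by minimality, and so cannot
  contain \<open>c\<close>.\<close>

lemma essential_prime_component_regular:
  fixes I :: "('d, 'y, 'k) dpoly set"
  assumes I: "differential_ideal D I" and P: "P \<in> essential_prime_components D I"
    and c: "\<And>a. c * a \<in> I \<Longrightarrow> a \<in> I"
  shows "c \<notin> P"
proof
  assume "c \<in> P"
  have P': "prime_differential_ideal D P" "I \<subseteq> P" "\<And>Q. prime_differential_ideal D Q \<Longrightarrow> I \<subseteq> Q \<Longrightarrow> Q \<subseteq> P \<Longrightarrow> Q = P"
    using P by (auto simp: essential_prime_components_def)
  have pr: "prime_ideal P" using P'(1) by (simp add: prime_differential_ideal_iff)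
  have one: "1 \<notin> P" using pr ideal_UNIV_iff by (auto simp: prime_ideal_def)
  define M where "M = {c ^ n * s | n s. s \<notin> P}"
  have "c ^ n * s \<in> I \<Longrightarrow> s \<in> I" for n s
    by (induction n) (auto simp: mult.assoc dest: c)
  then have "I \<inter> M = {}" using P'(2) by (auto simp: M_def)
  moreover have "1 \<in> M" using one by (force simp: M_def intro: exI[of _ 0])
  moreover have "a * b \<in> M" if "a \<in> M" "b \<in> M" for a b
  proof -
    from that obtain m n s t where "a = c ^ m * s" "b = c ^ n * t" "s \<notin> P" "t \<notin> P" by (auto simp: M_def)
    then have "a * b = c ^ (m + n) * (s * t)" "s * t \<notin> P"
      using pr by (auto simp: power_add ac_simps prime_ideal_def)
    then show ?thesis unfolding M_def by blast
  qed
  ultimately obtain Q where Q: "prime_differential_ideal D Q" "I \<subseteq> Q" "Q \<inter> M = {}"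
    using ex_prime_differential_ideal_disjoint[OF I, of M] by blast
  have "s \<in> M" if "s \<notin> P" for s using that by (force simp: M_def intro: exI[of _ 0])
  then have "Q = P" using Q by (intro P'(3)) auto
  moreover have "c \<in> M" using one by (force simp: M_def intro: exI[of _ 1] exI[of _ "1 :: ('d, 'y, 'k) dpoly"])
  ultimately show False using Q(3) \<open>c \<in> P\<close> by blast
qed

text \<open>The powers of \<open>f\<close> form a multiplicative set disjoint from \<open>I\<close>.
  Closure of \<open>I\<close> under square roots is enough for this, by halving the
  exponent.\<close>

lemma radical_essential_prime_component:
  fixes I :: "('d, 'y, 'k) dpoly set"
  assumes I: "differential_ideal D I" and rad: "\<And>f. f * f \<in> I \<Longrightarrow> f \<in> I" and f: "f \<notin> I"
  shows "\<exists>P\<in>essential_prime_components D I. f \<notin> P"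
proof -
  have id: "ideal I" using I by (simp add: differential_ideal_iff)
  have pow: "f ^ n \<notin> I" for n
  proof (induction n rule: less_induct)
    case (less n)
    show ?case
    proof
      assume n: "f ^ n \<in> I"
      have "n \<noteq> 0" "n \<noteq> 1" using n f ideal_mult[OF id, of 1 f] by (auto intro: ccontr)
      \<comment> \<open>Rounding up makes twice the new exponent at least \<open>n\<close>, so the
        square is a multiple of \<open>f ^ n\<close>; it is still smaller than \<open>n\<close>
        because 0 and 1 are excluded.\<close>
      then have lt: "(n + 1) div 2 < n" by linarith
      have "f ^ ((n + 1) div 2) * f ^ ((n + 1) div 2) = f ^ n * f ^ (2 * ((n + 1) div 2) - n)"
        by (simp add: mult_2 flip: power_add)
      also have "\<dots> \<in> I" using n by (rule ideal_mult_right[OF id])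
      finally show False using less.IH[OF lt] rad by blast
    qed
  qed
  define M where "M = range (\<lambda>n. f ^ n)"
  have M: "f ^ n \<in> M" for n by (simp add: M_def)
  have "1 \<in> M" using M[of 0] by simp
  moreover have "a * b \<in> M" if "a \<in> M" "b \<in> M" for a b
    using that by (auto simp: M_def simp flip: power_add)
  moreover have "I \<inter> M = {}" using pow by (auto simp: M_def)
  ultimately obtain P where P: "prime_differential_ideal D P" "I \<subseteq> P" "P \<inter> M = {}"
    using ex_prime_differential_ideal_disjoint[OF I, of M] by blast
  have "f \<notin> P" using P(3) M[of 1] by auto
  then show ?thesis using ex_essential_prime_component_subset[OF P(1,2)] by blast
qed

end

subsection \<open>Rankings are well-founded\<close>

text \<open>A monotone subsequence always exists; if it decreases, it becomes constant once its
  least value is reached, and the tail serves.\<close>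

lemma nat_seq_mono_subseq:
  fixes s :: "nat \<Rightarrow> nat"
  obtains r :: "nat \<Rightarrow> nat" where "strict_mono r" "mono (s \<circ> r)"
proof -
  obtain f where f: "strict_mono f" "monoseq (\<lambda>n. s (f n))"
    using seq_monosub by blast
  consider "\<forall>m. \<forall>n\<ge>m. s (f m) \<le> s (f n)" | "\<forall>m. \<forall>n\<ge>m. s (f n) \<le> s (f m)"
    using f(2) unfolding monoseq_def by blast
  then show ?thesis
  proof cases
    case 1
    then show ?thesis using f(1) by (intro that[of f]) (auto simp: mono_def)
  next
    case 2
    define c where "c = (LEAST c. \<exists>n. s (f n) = c)"
    have "\<exists>n. s (f n) = c" unfolding c_def by (rule LeastI_ex) auto
    then obtain N where N: "s (f N) = c" by auto
    have "c \<le> s (f n)" for n unfolding c_def by (rule Least_le) auto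
    then have "s (f (N + n)) = c" for n using 2 N by (metis le_add1 le_antisym)
    moreover have "strict_mono (\<lambda>n. f (N + n))" using f(1) by (auto simp: strict_mono_def)
    ultimately show ?thesis by (intro that[of "\<lambda>n. f (N + n)"]) (auto simp: mono_def)
  qed
qed

text \<open>Dickson's lemma for sequences: coordinates are treated one at a time, and a further
  subsequence preserves monotonicity of those already treated.\<close>

lemma dickson_mono_subseq:
  fixes s :: "nat \<Rightarrow> 'i \<Rightarrow> nat"
  assumes "finite F"
  shows "\<exists>r :: nat \<Rightarrow> nat. strict_mono r \<and> (\<forall>i\<in>F. mono (\<lambda>n. s (r n) i))"
  using assms
proof (induction F)
  case empty
  then show ?case by (intro exI[of _ id]) (auto simp: strict_mono_def)
next
  case (insert j F)
  then obtain r :: "nat \<Rightarrow> nat" where r: "strict_mono r" "\<And>i. i \<in> F \<Longrightarrow> mono (\<lambda>n. s (r n) i)" by blast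
  obtain t :: "nat \<Rightarrow> nat" where t: "strict_mono t" "mono ((\<lambda>n. s (r n) j) \<circ> t)"
    by (rule nat_seq_mono_subseq)
  have "mono (\<lambda>n. s ((r \<circ> t) n) i)" if "i \<in> insert j F" for i
    using that t r(2)[of i] strict_mono_mono[OF t(1)] by (auto simp: mono_def)
  moreover have "strict_mono (r \<circ> t)" using r(1) t(1) by (rule strict_mono_o)
  ultimately show ?case by blast
qed

locale ranked =
  fixes le :: "('d::finite, 'y::finite) dvar \<Rightarrow> ('d, 'y) dvar \<Rightarrow> bool"
  assumes ranking: "ranking le"
begin

definition lt :: "('d, 'y) dvar \<Rightarrow> ('d, 'y) dvar \<Rightarrow> bool" where
  "lt u v \<longleftrightarrow> le u v \<and> u \<noteq> v"

lemma le_refl [simp]: "le u u"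
  and le_trans: "le u v \<Longrightarrow> le v w \<Longrightarrow> le u w"
  and le_antisym: "le u v \<Longrightarrow> le v u \<Longrightarrow> u = v"
  and le_total: "le u v \<or> le v u"
  and le_dapply: "le u (dapply \<theta> u)"
  and dapply_mono: "le v u \<Longrightarrow> le (dapply \<theta> v) (dapply \<theta> u)"
proof -
  have r: "reflp le" "transp le" "antisymp le" "totalp le"
    using ranking by (auto simp: ranking_def)
  show refl: "le u u" for u using r(1) by (rule reflpD)
  show "le u v \<Longrightarrow> le v w \<Longrightarrow> le u w" using r(2) by (rule transpD)
  show "le u v \<Longrightarrow> le v u \<Longrightarrow> u = v" using r(3) by (rule antisympD)
  show "le u v \<or> le v u" using totalpD[OF r(4), of u v] refl by (cases "u = v") simp_all
  show "le u (dapply \<theta> u)" and "le v u \<Longrightarrow> le (dapply \<theta> v) (dapply \<theta> u)"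
    using ranking unfolding ranking_def by blast+
qed

lemma lt_le_trans: "lt u v \<Longrightarrow> le v w \<Longrightarrow> lt u w"
  and le_lt_trans: "le u v \<Longrightarrow> lt v w \<Longrightarrow> lt u w"
  and lt_irrefl [simp]: "\<not> lt u u"
  and lt_imp_le: "lt u v \<Longrightarrow> le u v"
  and not_lt_iff: "\<not> lt u v \<longleftrightarrow> le v u"
  unfolding lt_def using le_trans le_antisym le_total le_refl by (metis, metis, metis, metis, metis)

lemma dapply_inj: "dapply \<theta> u = dapply \<theta> v \<longleftrightarrow> u = v"
  by (auto simp: dapply_def prod_eq_iff)

lemma dapply_0 [simp]: "dapply 0 u = u"
  by (simp add: dapply_def)

lemma dapply_eq_iff: "dapply \<theta> u = u \<longleftrightarrow> \<theta> = 0"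
  by (auto simp: dapply_def prod_eq_iff)

lemma lt_dapply: "\<theta> \<noteq> 0 \<Longrightarrow> lt u (dapply \<theta> u)"
  using dapply_eq_iff[of \<theta> u] by (auto simp: lt_def le_dapply)

lemma dapply_lt_mono: "lt v u \<Longrightarrow> lt (dapply \<theta> v) (dapply \<theta> u)"
  by (auto simp: lt_def dapply_mono dapply_inj)

text \<open>An infinite descent contains infinitely many derivatives of one indeterminate. By
  \<open>dickson_mono_subseq\<close> a later one is then a derivative of an earlier one, so it is
  not lower.\<close>

lemma wf_lt: "wf {(u, v). lt u v}"
  unfolding wf_iff_no_infinite_down_chain
proof
  assume "\<exists>f. \<forall>i. (f (Suc i), f i) \<in> {(u, v). lt u v}"
  then obtain f where "\<And>i. lt (f (Suc i)) (f i)" by auto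
  then have desc: "lt (f n) (f m)" if "m < n" for m n
    using that by (induction n) (auto simp: less_Suc_eq intro: lt_le_trans lt_imp_le)
  have "\<exists>y. infinite {n. snd (f n) = y}"
    using pigeonhole_infinite[of UNIV "\<lambda>n. snd (f n)"] by auto
  then obtain y where "infinite {n. snd (f n) = y}" by blast
  then obtain r :: "nat \<Rightarrow> nat" where r: "strict_mono r" "\<And>n. snd (f (r n)) = y"
    using infinite_enumerate by blast
  obtain t :: "nat \<Rightarrow> nat" where t: "strict_mono t" "\<And>i. mono (\<lambda>n. lookup (fst (f (r (t n)))) i)"
    using dickson_mono_subseq[of UNIV "\<lambda>n i. lookup (fst (f (r n))) i"] by auto
  define u v where "u = f (r (t 0))" and "v = f (r (t 1))"
  have "fst v = (fst v - fst u) + fst u"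
    using t(2) unfolding u_def v_def
    by (intro poly_mapping_eqI) (simp add: lookup_add lookup_minus mono_def)
  then have "v = dapply (fst v - fst u) u"
    using r(2) by (simp add: dapply_def prod_eq_iff u_def v_def)
  then have "le u v" using le_dapply by metis
  moreover have "r (t 0) < r (t 1)" using r(1) t(1) by (simp add: strict_mono_def)
  then have "lt v u" unfolding u_def v_def by (rule desc)
  ultimately show False by (simp flip: not_lt_iff)
qed

lemma ex_max:
  assumes "finite V" "V \<noteq> {}"
  shows "\<exists>m\<in>V. \<forall>v\<in>V. le v m"
  using assms
proof (induction V rule: finite_ne_induct)
  case (insert x V)
  then obtain m where m: "m \<in> V" "\<And>v. v \<in> V \<Longrightarrow> le v m" by blast
  show ?case
  proof (cases "le x m")
    case False
    then have "le m x" using le_total by blast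
    then show ?thesis using m by (intro bexI[of _ x]) (auto intro: le_trans)
  qed (use m in auto)
qed simp

lemma leader_eqI: "u \<in> vars f \<Longrightarrow> (\<And>v. v \<in> vars f \<Longrightarrow> le v u) \<Longrightarrow> leader le f = u"
  unfolding leader_def by (rule the_equality) (auto intro: le_antisym)

lemma
  assumes "vars f \<noteq> {}"
  shows leader_in_vars: "leader le f \<in> vars f"
    and le_leader: "v \<in> vars f \<Longrightarrow> le v (leader le f)"
proof -
  obtain u where "u \<in> vars f" "\<And>v. v \<in> vars f \<Longrightarrow> le v u"
    using ex_max[OF finite_vars assms] by blast
  moreover from this have "leader le f = u" by (rule leader_eqI)
  ultimately show "leader le f \<in> vars f" "v \<in> vars f \<Longrightarrow> le v (leader le f)" by auto
qed

lemma deg_in_leader_pos: "vars f \<noteq> {} \<Longrightarrow> 0 < deg_in (leader le f) f"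
  using leader_in_vars[of f] deg_in_eq_0_iff[of "leader le f" f] by auto

lemma initial_nonzero: "vars f \<noteq> {} \<Longrightarrow> initial le f \<noteq> 0"
  unfolding initial_def by (rule coeff_in_deg_nonzero) auto

lemma vars_initial: "vars (initial le f) \<subseteq> vars f - {leader le f}"
  unfolding initial_def by (rule vars_coeff_in)

end

subsection \<open>Pseudo-division\<close>

text \<open>The exponent \<open>n\<close> is prescribed instead of being the number of division
  steps actually needed, so that one multiplier can serve a finite family. The bound on the degree
  of \<open>q\<close> is used in \<open>leading_coeff_square\<close>, and the subring
  \<open>K\<close> records which variables occur.\<close>

lemma poly_pseudo_division:
  fixes p F :: "'r::comm_ring_1 poly" and K :: "'r set"
  assumes K: "0 \<in> K" "1 \<in> K" "\<And>a b. a \<in> K \<Longrightarrow> b \<in> K \<Longrightarrow> a + b \<in> K"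
      "\<And>a b. a \<in> K \<Longrightarrow> b \<in> K \<Longrightarrow> a - b \<in> K" "\<And>a b. a \<in> K \<Longrightarrow> b \<in> K \<Longrightarrow> a * b \<in> K"
    and p: "\<And>k. coeff p k \<in> K" "degree p = d"
    and F: "\<And>k. coeff F k \<in> K" "\<And>k. n + d \<le> k \<Longrightarrow> coeff F k = 0"
  shows "\<exists>q r. smult (coeff p d ^ n) F = q * p + r \<and>
    (\<forall>k\<ge>d. coeff r k = 0) \<and> (\<forall>k\<ge>n. coeff q k = 0) \<and> (\<forall>k. coeff q k \<in> K \<and> coeff r k \<in> K)"
  using F
proof (induction n arbitrary: F)
  case 0
  then show ?case using K(1) by (intro exI[of _ 0] exI[of _ F]) auto
next
  case (Suc n)
  define l c where "l = coeff p d" and "c = coeff F (n + d)"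
  have lpow: "l ^ m \<in> K" for m using K(2,5) p(1) by (induction m) (auto simp: l_def)
  have c: "c \<in> K" using Suc.prems(1) by (simp add: c_def)
  define F' where "F' = smult l F - monom c n * p"
  have coeff_F': "coeff F' k = l * coeff F k - (if n \<le> k then c * coeff p (k - n) else 0)" for k
    by (simp add: F'_def coeff_monom_mult)
  have "\<exists>q r. smult (coeff p d ^ n) F' = q * p + r \<and>
    (\<forall>k\<ge>d. coeff r k = 0) \<and> (\<forall>k\<ge>n. coeff q k = 0) \<and> (\<forall>k. coeff q k \<in> K \<and> coeff r k \<in> K)"
  proof (rule Suc.IH)
    show "coeff F' k \<in> K" for k
      unfolding coeff_F' using K p(1) Suc.prems(1) c by (auto simp: l_def)
    show "coeff F' k = 0" if "n + d \<le> k" for k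
    proof (cases "k = n + d")
      case True
      then show ?thesis by (simp add: coeff_F' l_def c_def mult.commute)
    next
      case False
      then have "coeff F k = 0" "coeff p (k - n) = 0"
        using that Suc.prems(2)[of k] coeff_eq_0[of p "k - n"] p(2) by auto
      then show ?thesis by (simp add: coeff_F')
    qed
  qed
  then obtain q r where qr: "smult (l ^ n) F' = q * p + r" "\<forall>k\<ge>d. coeff r k = 0" "\<forall>k\<ge>n. coeff q k = 0"
    "\<forall>k. coeff q k \<in> K \<and> coeff r k \<in> K" unfolding l_def by blast
  define q' where "q' = q + monom (l ^ n * c) n"
  have "smult (l ^ Suc n) F = smult (l ^ n) F' + smult (l ^ n) (monom c n * p)"
    by (simp add: F'_def smult_diff_right mult.commute)
  also have "\<dots> = q' * p + r"
    by (simp add: qr(1) q'_def smult_monom distrib_right flip: mult_smult_left)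
  finally have "smult (coeff p d ^ Suc n) F = q' * p + r" by (simp add: l_def)
  moreover have "\<forall>k\<ge>Suc n. coeff q' k = 0" using qr(3) by (simp add: q'_def)
  moreover have "\<forall>k. coeff q' k \<in> K" using qr(4) K(1,3,5) lpow c by (simp add: q'_def)
  ultimately show ?case using qr(2,4) by blast
qed

lemma pseudo_division:
  fixes p f :: "('d, 'y, 'k::comm_ring_1) dpoly"
  assumes "deg_in w f < n + deg_in w p"
  shows "\<exists>q r. coeff_in w (deg_in w p) p ^ n * f = q * p + r \<and>
    (\<forall>k\<ge>deg_in w p. coeff_in w k r = 0) \<and> (\<forall>k\<ge>n. coeff_in w k q = 0) \<and>
    vars q \<subseteq> vars p \<union> vars f \<union> {w} \<and> vars r \<subseteq> vars p \<union> vars f \<union> {w}"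
proof -
  define K :: "('d, 'y, 'k) dpoly set" where "K = polys_in (vars p \<union> vars f - {w})"
  have "\<exists>q r. smult (coeff (upoly w p) (deg_in w p) ^ n) (upoly w f) = q * upoly w p + r \<and>
    (\<forall>k\<ge>deg_in w p. coeff r k = 0) \<and> (\<forall>k\<ge>n. coeff q k = 0) \<and> (\<forall>k. coeff q k \<in> K \<and> coeff r k \<in> K)"
  proof (rule poly_pseudo_division)
    show "coeff (upoly w f) k = 0" if "n + deg_in w p \<le> k" for k
      using that assms by (simp add: coeff_in_above_deg)
    show "coeff (upoly w p) k \<in> K" "coeff (upoly w f) k \<in> K" for k
      using vars_coeff_in[of w k p] vars_coeff_in[of w k f] by (auto simp: K_def polys_in_def)
  qed (auto simp: K_def intro: polys_in_add polys_in_diff polys_in_mult)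
  then obtain Q R where QR: "smult (coeff_in w (deg_in w p) p ^ n) (upoly w f) = Q * upoly w p + R"
    "\<And>k. deg_in w p \<le> k \<Longrightarrow> coeff R k = 0" "\<And>k. n \<le> k \<Longrightarrow> coeff Q k = 0"
    "\<And>k. coeff Q k \<in> K" "\<And>k. coeff R k \<in> K" by auto
  have free: "w \<notin> vars (coeff Q k)" "w \<notin> vars (coeff R k)" for k
    using QR(4,5)[of k] by (auto simp: K_def polys_in_def)
  have vars: "vars (poly G (var w)) \<subseteq> vars p \<union> vars f \<union> {w}" if "\<And>k. coeff G k \<in> K" for G
  proof -
    have "coeff G k \<in> polys_in (vars p \<union> vars f \<union> {w})" for k
      using that[of k] polys_in_mono[of "vars p \<union> vars f - {w}" "vars p \<union> vars f \<union> {w}"] by (auto simp: K_def)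
    then have "poly G (var w) \<in> polys_in (vars p \<union> vars f \<union> {w})"
      unfolding poly_altdef by (intro polys_in_sum polys_in_mult polys_in_power) (auto simp: polys_in_def)
    then show ?thesis by (simp add: polys_in_def)
  qed
  have "poly (smult (coeff_in w (deg_in w p) p ^ n) (upoly w f)) (var w) = poly (Q * upoly w p + R) (var w)"
    by (simp only: QR(1))
  then have eq: "coeff_in w (deg_in w p) p ^ n * f = poly Q (var w) * p + poly R (var w)" by simp
  have "coeff_in w k (poly Q (var w)) = coeff Q k" "coeff_in w k (poly R (var w)) = coeff R k" for k
    using coeff_in_poly[of w Q] coeff_in_poly[of w R] free by (metis coeff_upoly)+
  then show ?thesis using eq vars QR by (intro exI[of _ "poly Q (var w)"] exI[of _ "poly R (var w)"]) auto
qed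

subsection \<open>Reduction modulo a regular autoreduced set\<close>

text \<open>Instances: a characterizable ideal with a characterizing set, and a prime differential ideal with
  any of its characteristic sets.\<close>

locale regular_set = diff_field_char_0 D + ranked le
  for D :: "'d::finite \<Rightarrow> 'k::field_char_0 \<Rightarrow> 'k"
    and le :: "('d, 'y::finite) dvar \<Rightarrow> ('d, 'y) dvar \<Rightarrow> bool" +
  fixes J A :: "('d, 'y, 'k) dpoly set"
  assumes differential_ideal_J: "differential_ideal D J"
    and A_subset: "A \<subseteq> J"
    and finite_A: "finite A"
    and autoreduced_A: "autoreduced le A"
    and reduced_zero: "f \<in> J \<Longrightarrow> (\<And>a. a \<in> A \<Longrightarrow> reduced le f a) \<Longrightarrow> f = 0"
    and initial_regular: "a \<in> A \<Longrightarrow> initial le a * f \<in> J \<Longrightarrow> f \<in> J"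
    and separant_regular: "a \<in> A \<Longrightarrow> separant le a * f \<in> J \<Longrightarrow> f \<in> J"
begin

definition regular :: "('d, 'y, 'k) dpoly \<Rightarrow> bool" where
  "regular h \<longleftrightarrow> (\<forall>f. h * f \<in> J \<longrightarrow> f \<in> J)"

definition N :: "('d, 'y) dvar set" where
  "N = {v. \<forall>a\<in>A. \<forall>\<theta>. v \<noteq> dapply \<theta> (leader le a)}"

definition red :: "('d, 'y, 'k) dpoly \<Rightarrow> bool" where
  "red f \<longleftrightarrow> (\<forall>a\<in>A. reduced le f a)"

text \<open>Reducedness with respect to all of \<open>A\<close> is a condition on the individual
  monomials of a polynomial (\<open>red_iff\<close>), hence inherited by sums.\<close>

definition redmon :: "(('d, 'y) dvar \<Rightarrow>\<^sub>0 nat) \<Rightarrow> bool" where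
  "redmon m \<longleftrightarrow> (\<forall>a\<in>A. (\<forall>\<theta>. \<theta> \<noteq> 0 \<longrightarrow> lookup m (dapply \<theta> (leader le a)) = 0) \<and>
    lookup m (leader le a) < deg_in (leader le a) a)"

lemma ideal_J: "ideal J"
  using differential_ideal_J by (simp add: differential_ideal_iff)

lemma pderivation_J: "f \<in> J \<Longrightarrow> pderivation D i f \<in> J"
  using differential_ideal_J by (simp add: differential_ideal_iff)

lemmas J_add = ideal_add[OF ideal_J]
lemmas J_diff = ideal_diff[OF ideal_J]
lemmas J_mult = ideal_mult[OF ideal_J]
lemmas J_mult_right = ideal_mult_right[OF ideal_J]
lemmas J_sum = ideal_sum[OF ideal_J]
lemmas J_0 = ideal_0[OF ideal_J]

lemma vars_A: "a \<in> A \<Longrightarrow> vars a \<noteq> {}"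
  using autoreduced_A by (simp add: autoreduced_def)

lemma reduced_A: "a \<in> A \<Longrightarrow> b \<in> A \<Longrightarrow> a \<noteq> b \<Longrightarrow> reduced le a b"
  using autoreduced_A by (simp add: autoreduced_def)

lemma leader_inj: "a \<in> A \<Longrightarrow> b \<in> A \<Longrightarrow> leader le a = leader le b \<Longrightarrow> a = b"
  using reduced_A[of a b] reduced_A[of b a] unfolding reduced_def by (metis less_asym)

lemma deg_A_pos: "a \<in> A \<Longrightarrow> 0 < deg_in (leader le a) a"
  using deg_in_leader_pos vars_A by blast

lemma red_iff: "red f \<longleftrightarrow> (\<forall>m. lookup f m \<noteq> 0 \<longrightarrow> redmon m)"
proof
  assume f: "red f"
  show "\<forall>m. lookup f m \<noteq> 0 \<longrightarrow> redmon m"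
  proof (intro allI impI)
    fix m assume m: "lookup f m \<noteq> 0"
    show "redmon m" unfolding redmon_def
    proof (intro ballI conjI allI impI)
      fix a assume a: "a \<in> A"
      have ra: "reduced le f a" using f a by (simp add: red_def)
      show "lookup m (dapply \<theta> (leader le a)) = 0" if "\<theta> \<noteq> 0" for \<theta>
        using that ra m by (auto simp: reduced_def in_vars_iff)
      show "lookup m (leader le a) < deg_in (leader le a) a"
        using ra lookup_le_deg_in[OF m, of "leader le a"] by (auto simp: reduced_def)
    qed
  qed
next
  assume f: "\<forall>m. lookup f m \<noteq> 0 \<longrightarrow> redmon m"
  show "red f" unfolding red_def reduced_def
  proof (intro ballI conjI allI impI)
    fix a assume a: "a \<in> A"
    show "dapply \<theta> (leader le a) \<notin> vars f" if "\<theta> \<noteq> 0" for \<theta>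
      using that f a by (auto simp: in_vars_iff redmon_def)
    have "deg_in (leader le a) f \<le> deg_in (leader le a) a - 1"
      using f a by (intro deg_in_le) (force simp: redmon_def)
    then show "deg_in (leader le a) f < deg_in (leader le a) a" using deg_A_pos[OF a] by linarith
  qed
qed

lemma red_eq_0: "red f \<Longrightarrow> f \<in> J \<Longrightarrow> f = 0"
  using reduced_zero by (auto simp: red_def)

lemma redmon_mono: "redmon m' \<Longrightarrow> (\<And>v. lookup m v \<le> lookup m' v) \<Longrightarrow> redmon m"
proof -
  assume m': "redmon m'" and le: "\<And>v. lookup m v \<le> lookup m' v"
  show "redmon m" unfolding redmon_def
  proof (intro ballI conjI allI impI)
    fix a assume a: "a \<in> A"
    show "lookup m (dapply \<theta> (leader le a)) = 0" if "\<theta> \<noteq> 0" for \<theta>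
      using that m' a le[of "dapply \<theta> (leader le a)"] by (simp add: redmon_def)
    show "lookup m (leader le a) < deg_in (leader le a) a"
      using m' a le[of "leader le a"] by (auto simp: redmon_def intro: order_le_less_trans)
  qed
qed

lemma redmon_0: "redmon 0"
  using deg_A_pos by (simp add: redmon_def)

lemma red_1: "red 1"
  by (auto simp: red_iff redmon_0 lookup_one when_def)

lemma red_sum:
  assumes "\<And>i. i \<in> I \<Longrightarrow> red (f i)"
  shows "red (sum f I)"
  unfolding red_iff lookup_sum
proof (intro allI impI)
  fix m assume "(\<Sum>i\<in>I. lookup (f i) m) \<noteq> 0"
  then obtain i where "i \<in> I" "lookup (f i) m \<noteq> 0" by (meson sum.neutral)
  then show "redmon m" using assms by (auto simp: red_iff)
qed

text \<open>With disjoint variables each exponent of a product monomial comes from one factor only,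
  so degrees in the leaders do not add up.\<close>

lemma red_mult_disjoint:
  assumes "red f" "red g" "vars f \<inter> vars g = {}"
  shows "red (f * g)"
  unfolding red_iff
proof (intro allI impI)
  fix m assume "lookup (f * g) m \<noteq> 0"
  then have "m \<in> keys (f * g)" by (simp add: in_keys_iff)
  then obtain p q where pq: "m = p + q" "lookup f p \<noteq> 0" "lookup g q \<noteq> 0"
    using keys_mult[of f g] by (auto simp: in_keys_iff)
  have p: "redmon p" and q: "redmon q" using pq assms by (auto simp: red_iff)
  have "lookup p v = 0 \<or> lookup q v = 0" for v
    using assms(3) pq(2,3) unfolding disjoint_iff in_vars_iff by blast
  then have m: "lookup m v = lookup p v \<or> lookup m v = lookup q v" for v
    by (metis add_0 add.right_neutral lookup_add pq(1))
  show "redmon m" unfolding redmon_def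
  proof (intro ballI conjI allI impI)
    fix a assume a: "a \<in> A"
    show "lookup m (dapply \<theta> (leader le a)) = 0" if "\<theta> \<noteq> 0" for \<theta>
      using that p q a m[of "dapply \<theta> (leader le a)"] by (auto simp: redmon_def)
    show "lookup m (leader le a) < deg_in (leader le a) a"
      using p q a m[of "leader le a"] by (auto simp: redmon_def)
  qed
qed

lemma red_mon: "redmon \<mu> \<Longrightarrow> red (mon \<mu>)"
  by (auto simp: red_iff lookup_single when_def)

lemma redmon_N: "keys m \<subseteq> N \<Longrightarrow> redmon m"
proof -
  assume m: "keys m \<subseteq> N"
  have "lookup m (dapply \<theta> (leader le a)) = 0" if "a \<in> A" for a \<theta>
    using that m unfolding N_def subset_iff in_keys_iff by blast
  from this[of _ 0] this show ?thesis using deg_A_pos by (auto simp: redmon_def)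
qed

text \<open>\<open>redmon\<close> constrains only the leaders and their derivatives; hence the
  reduced polynomials form a module over k[N], the basis of the linear algebra below.\<close>

lemma red_N_mult:
  assumes "vars c \<subseteq> N" "red f"
  shows "red (c * f)"
  unfolding red_iff
proof (intro allI impI)
  fix m assume "lookup (c * f) m \<noteq> 0"
  then have "m \<in> keys (c * f)" by (simp add: in_keys_iff)
  then obtain p q where pq: "m = p + q" "lookup c p \<noteq> 0" "lookup f q \<noteq> 0"
    using keys_mult[of c f] by (auto simp: in_keys_iff)
  have p: "lookup p (dapply \<theta> (leader le a)) = 0" if "a \<in> A" for a \<theta>
  proof -
    have "dapply \<theta> (leader le a) \<notin> vars c" using assms(1) that by (auto simp: N_def)
    then show ?thesis using pq(2) by (auto simp: in_vars_iff)
  qed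
  have "redmon q" using pq assms(2) by (simp add: red_iff)
  then show "redmon m" using p p[of _ 0] by (auto simp: redmon_def pq(1) lookup_add)
qed

lemma regular_mult: "regular f \<Longrightarrow> regular g \<Longrightarrow> regular (f * g)"
  unfolding regular_def mult.assoc by blast

lemma regular_1: "regular 1"
  by (simp add: regular_def)

lemma regular_power: "regular f \<Longrightarrow> regular (f ^ n)"
  by (induction n) (simp_all add: regular_1 regular_mult)

lemma one_notin_J: "1 \<notin> J"
  using red_eq_0[OF red_1] by auto

lemma regular_nonzero: "regular f \<Longrightarrow> f \<noteq> 0"
  using one_notin_J J_0 by (auto simp: regular_def)

lemma in_N_or: "v \<in> N \<or> (\<exists>a\<in>A. v = leader le a) \<or> (\<exists>a\<in>A. \<exists>\<theta>. \<theta> \<noteq> 0 \<and> v = dapply \<theta> (leader le a))"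
proof (cases "v \<in> N")
  case False
  then obtain a \<theta> where "a \<in> A" "v = dapply \<theta> (leader le a)" by (auto simp: N_def)
  then show ?thesis by (cases "\<theta> = 0") auto
qed simp

lemma N_single: "v \<in> N \<Longrightarrow> redmon (single v k)"
  by (rule redmon_N) auto

lemma redmon_leader:
  assumes "a \<in> A" "k < deg_in (leader le a) a"
  shows "redmon (single (leader le a) k)"
  unfolding redmon_def
proof (intro ballI conjI allI impI)
  fix b assume b: "b \<in> A"
  show "lookup (single (leader le a) k) (dapply \<theta> (leader le b)) = 0" if "\<theta> \<noteq> 0" for \<theta>
  proof -
    have "leader le a \<noteq> dapply \<theta> (leader le b)"
    proof (cases "a = b")
      case True
      then show ?thesis using that dapply_eq_iff by metis
    next
      case False
      then have "dapply \<theta> (leader le b) \<notin> vars a" using reduced_A[OF assms(1) b] that by (simp add: reduced_def)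
      then show ?thesis using leader_in_vars[OF vars_A[OF assms(1)]] by metis
    qed
    then show ?thesis by (simp add: lookup_single when_def)
  qed
  show "lookup (single (leader le a) k) (leader le b) < deg_in (leader le b) b"
    using assms deg_A_pos[OF b] leader_inj[OF assms(1) b] by (auto simp: lookup_single when_def)
qed

lemma polys_in_lt_dapply: "f \<in> polys_in {v. lt v w} \<Longrightarrow> f \<in> polys_in {v. lt v (dapply \<theta> w)}"
  by (auto simp: polys_in_def intro: lt_le_trans le_dapply)

lemma polys_in_lt_imp_le: "f \<in> polys_in {v. lt v w} \<Longrightarrow> f \<in> polys_in {v. le v w}"
  by (auto simp: polys_in_def intro: lt_imp_le)

text \<open>Differentiation moves the top variable and keeps its coefficient \<open>S\<close>: the
  derivative of \<open>S\<close> and that of \<open>T\<close> only contribute terms below the new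
  top variable.\<close>

lemma derivative_step:
  assumes p: "S * var w + T \<in> J" and S: "S \<in> polys_in {v. lt v w}" and T: "T \<in> polys_in {v. lt v w}"
  shows "\<exists>T'. S * var (dapply (single i 1) w) + T' \<in> J \<and>
    T' \<in> polys_in {v. lt v (dapply (single i 1) w)}"
proof -
  let ?\<delta> = "dapply (single i 1)"
  have i: "single i (1::nat) \<noteq> 0" by (metis lookup_single_eq lookup_zero one_neq_zero)
  have up: "pderivation D i f \<in> polys_in {v. lt v (?\<delta> w)}" if "f \<in> polys_in {v. lt v w}" for f
    using that vars_pderivation[of i f] dapply_lt_mono[of _ w] lt_le_trans[OF _ le_dapply[of w]]
    unfolding polys_in_def by blast
  have w: "var w \<in> polys_in {v. lt v (?\<delta> w)}" using lt_dapply[OF i] by (simp add: polys_in_def)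
  have "pderivation D i (S * var w + T) = S * var (?\<delta> w) + (pderivation D i S * var w + pderivation D i T)"
    by (simp add: pderivation_add pderivation_mult pderivation_var)
  moreover have "pderivation D i S * var w + pderivation D i T \<in> polys_in {v. lt v (?\<delta> w)}"
    using up w S T by (intro polys_in_add polys_in_mult) auto
  ultimately show ?thesis using pderivation_J[OF p, of i] by metis
qed

lemma derivative_steps:
  assumes "S * var w + T \<in> J" "S \<in> polys_in {v. lt v w}" "T \<in> polys_in {v. lt v w}"
  shows "\<exists>T'. S * var (dapply \<theta> w) + T' \<in> J \<and> T' \<in> polys_in {v. lt v (dapply \<theta> w)}"
  using assms
proof (induction \<theta> arbitrary: w T rule: poly_mapping_additive_induct)
  case (single i n)
  then show ?case
  proof (induction n)
    case (Suc n)
    let ?w = "dapply (single i n) w"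
    obtain T' where T': "S * var ?w + T' \<in> J" "T' \<in> polys_in {v. lt v ?w}" using Suc by blast
    have "S \<in> polys_in {v. lt v ?w}"
      using Suc.prems(2) by (rule polys_in_lt_dapply)
    from derivative_step[OF T'(1) this T'(2), of i] show ?case
      by (simp add: dapply_dapply flip: single_add)
  qed auto
next
  case (add \<theta> \<theta>')
  obtain T' where T': "S * var (dapply \<theta>' w) + T' \<in> J" "T' \<in> polys_in {v. lt v (dapply \<theta>' w)}"
    using add by blast
  have "S \<in> polys_in {v. lt v (dapply \<theta>' w)}"
    using add.prems(2) by (rule polys_in_lt_dapply)
  from add.IH(1)[OF T'(1) this T'(2)] show ?case by (simp add: dapply_dapply)
qed

lemma derivative_leader:
  assumes a: "a \<in> A" and \<theta>: "\<theta> \<noteq> 0"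
  shows "\<exists>T. separant le a * var (dapply \<theta> (leader le a)) + T \<in> J \<and>
    T \<in> polys_in {v. lt v (dapply \<theta> (leader le a))} \<and>
    separant le a \<in> polys_in {v. lt v (dapply \<theta> (leader le a))}"
proof -
  let ?u = "leader le a" and ?S = "separant le a"
  obtain i where i: "lookup \<theta> i \<noteq> 0" using \<theta> by (metis lookup_zero poly_mapping_eqI)
  let ?\<delta> = "dapply (single i 1)"
  have i0: "single i (1::nat) \<noteq> 0" by (metis lookup_single_eq lookup_zero one_neq_zero)
  \<comment> \<open>One derivation is split off. It turns \<open>a\<close>, of any degree in its
    leader, into a polynomial linear in the derivative of the leader with the separant as
    coefficient; the remaining \<eta> is covered by \<open>derivative_steps\<close>.\<close>
  define \<eta> where "\<eta> = \<theta> - single i 1"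
  have \<theta>': "\<theta> = \<eta> + single i 1"
    using single_add_cases[of \<theta> i \<eta>] i by (simp add: \<eta>_def)
  have av: "lt v (?\<delta> ?u)" if "v \<in> vars a" for v
    using le_lt_trans[OF le_leader[OF vars_A[OF a] that] lt_dapply[OF i0]] .
  have S: "?S \<in> polys_in {v. lt v (?\<delta> ?u)}"
    using av vars_pdiff[of ?u a] by (auto simp: polys_in_def separant_def)
  define T where "T = Poly_Mapping.map (D i) a + (\<Sum>v\<in>vars a - {?u}. pdiff v a * var (?\<delta> v))"
  have "pderivation D i a = ?S * var (?\<delta> ?u) + T"
    unfolding pderivation_def T_def separant_def
    using leader_in_vars[OF vars_A[OF a]] by (subst sum.remove[of _ ?u]) (auto simp: ac_simps)
  then have "?S * var (?\<delta> ?u) + T \<in> J" using a A_subset pderivation_J[of a i] by auto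
  moreover have T: "T \<in> polys_in {v. lt v (?\<delta> ?u)}"
    unfolding T_def
  proof (intro polys_in_add polys_in_sum polys_in_mult)
    show "Poly_Mapping.map (D i) a \<in> polys_in {v. lt v (?\<delta> ?u)}"
      using av vars_map_D[of i a] by (auto simp: polys_in_def)
    fix v assume v: "v \<in> vars a - {?u}"
    show "pdiff v a \<in> polys_in {v. lt v (?\<delta> ?u)}"
      using av vars_pdiff[of v a] by (auto simp: polys_in_def)
    have "lt v ?u" using v le_leader[OF vars_A[OF a], of v] by (auto simp: lt_def)
    then show "var (?\<delta> v) \<in> polys_in {v. lt v (?\<delta> ?u)}"
      using dapply_lt_mono by (simp add: polys_in_def)
  qed
  ultimately obtain T' where "?S * var (dapply \<eta> (?\<delta> ?u)) + T' \<in> J" "T' \<in> polys_in {v. lt v (dapply \<eta> (?\<delta> ?u))}"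
    using derivative_steps[OF _ S T, of \<eta>] by blast
  moreover have "?S \<in> polys_in {v. lt v (dapply \<eta> (?\<delta> ?u))}"
    using S by (rule polys_in_lt_dapply)
  ultimately show ?thesis unfolding \<theta>' dapply_dapply by blast
qed

lemma linear_deg_coeff:
  fixes S T :: "('d, 'y, 'k) dpoly"
  assumes "S \<in> polys_in {v. lt v w}" "T \<in> polys_in {v. lt v w}" "S \<noteq> 0"
  shows "deg_in w (S * var w + T) = 1" "coeff_in w 1 (S * var w + T) = S"
proof -
  have "upoly w (S * var w + T) = [:T, S:]"
    by (rule upoly_unique) (use assms in \<open>auto simp: polys_in_def coeff_pCons lt_def split: nat.splits\<close>)
  then show "deg_in w (S * var w + T) = 1" "coeff_in w 1 (S * var w + T) = S"
    using assms(3) by (simp_all flip: degree_upoly coeff_upoly)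
qed

text \<open>Reducing a leader introduces the variables of its polynomial; reducing a proper derivative of a
  leader may introduce any lower variable.\<close>

definition admissible :: "('d, 'y) dvar set \<Rightarrow> bool" where
  "admissible V \<longleftrightarrow> (\<forall>w\<in>V. w \<in> N \<or> (\<exists>a\<in>A. w = leader le a \<and> vars a \<subseteq> V) \<or>
    (\<exists>a\<in>A. \<exists>\<theta>. \<theta> \<noteq> 0 \<and> w = dapply \<theta> (leader le a) \<and> {v. le v w} \<subseteq> V))"

lemma admissible_downclosed:
  assumes "\<And>v u. v \<in> V \<Longrightarrow> le u v \<Longrightarrow> u \<in> V"
  shows "admissible V"
  unfolding admissible_def
proof
  fix w assume w: "w \<in> V"
  have "vars a \<subseteq> V" if "a \<in> A" "w = leader le a" for a
    using that assms[OF w] le_leader[OF vars_A] by blast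
  then show "w \<in> N \<or> (\<exists>a\<in>A. w = leader le a \<and> vars a \<subseteq> V) \<or>
      (\<exists>a\<in>A. \<exists>\<theta>. \<theta> \<noteq> 0 \<and> w = dapply \<theta> (leader le a) \<and> {v. le v w} \<subseteq> V)"
    using in_N_or[of w] assms[OF w] by blast
qed

text \<open>For a leader the divisor is the element of \<open>A\<close>; for a proper derivative of
  a leader it is the linear polynomial of \<open>derivative_leader\<close>. The last conjunct says
  that powers of \<open>w\<close> below the degree of the divisor are reduced, so remainders need no
  further work at \<open>w\<close>.\<close>

lemma ex_divisor:
  assumes V: "admissible V" "w \<in> V" and w: "w \<notin> N"
  shows "\<exists>p. p \<in> J \<and> p \<in> polys_in (V \<inter> {v. le v w}) \<and> regular (coeff_in w (deg_in w p) p) \<and>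
    regular (pdiff w p) \<and> 0 < deg_in w p \<and> redmon (single w (deg_in w p - 1))"
proof (cases "\<exists>a\<in>A. w = leader le a \<and> vars a \<subseteq> V")
  case True
  then obtain a where a: "a \<in> A" "w = leader le a" "vars a \<subseteq> V" by blast
  have "a \<in> polys_in (V \<inter> {v. le v w})"
    using a le_leader[OF vars_A[OF a(1)]] by (auto simp: polys_in_def)
  moreover have "regular (initial le a)" "regular (separant le a)"
    unfolding regular_def using initial_regular[OF a(1)] separant_regular[OF a(1)] by blast+
  then have "regular (coeff_in w (deg_in w a) a)" "regular (pdiff w a)"
    by (simp_all add: a(2) initial_def separant_def)
  moreover have "0 < deg_in w a" using deg_A_pos[OF a(1)] a(2) by simp
  ultimately show ?thesis using a A_subset redmon_leader[OF a(1)] by (intro exI[of _ a]) auto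
next
  case False
  then have "\<exists>a\<in>A. \<exists>\<theta>. \<theta> \<noteq> 0 \<and> w = dapply \<theta> (leader le a) \<and> {v. le v w} \<subseteq> V"
    using bspec[OF V(1)[unfolded admissible_def] V(2)] w by argo
  then obtain a \<theta> where a: "a \<in> A" "\<theta> \<noteq> 0" "w = dapply \<theta> (leader le a)" "{v. le v w} \<subseteq> V"
    by blast
  obtain T where T: "separant le a * var w + T \<in> J" "T \<in> polys_in {v. lt v w}"
    "separant le a \<in> polys_in {v. lt v w}"
    using derivative_leader[OF a(1,2)] unfolding a(3) by blast
  have S: "regular (separant le a)" using separant_regular[OF a(1)] by (simp add: regular_def)
  have "separant le a * var w + T \<in> polys_in {v. le v w}"
    using polys_in_lt_imp_le[OF T(2)] polys_in_lt_imp_le[OF T(3)]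
    by (intro polys_in_add polys_in_mult) (auto simp: polys_in_def)
  moreover have "{v. le v w} = V \<inter> {v. le v w}" using a(4) by blast
  moreover have "w \<notin> vars T" "w \<notin> vars (separant le a)" using T(2,3) by (auto simp: polys_in_def)
  then have "pdiff w (separant le a * var w + T) = separant le a"
    by (simp add: pdiff_add pdiff_mult pdiff_free) (simp add: var_def pdiff_single)
  ultimately show ?thesis
    using linear_deg_coeff[OF T(3,2) regular_nonzero[OF S]] S T(1) redmon_0
    by (intro exI[of _ "separant le a * var w + T"]) auto
qed

text \<open>A single multiplier \<open>h\<close> is required for the whole of \<open>F\<close>: all
  coefficients of a polynomial have to be reduced with the same multiplier to be recombined.\<close>

definition reducible_to :: "('d, 'y) dvar set \<Rightarrow> ('d, 'y, 'k) dpoly set \<Rightarrow> bool" where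
  "reducible_to V F \<longleftrightarrow> (\<exists>h. regular h \<and> (\<forall>f\<in>F. \<exists>y. red y \<and> y \<in> polys_in V \<and> h * f - y \<in> J))"

text \<open>The coefficients with respect to \<open>w\<close> are reduced simultaneously and
  recombined with the powers of \<open>w\<close>, which are themselves reduced and share no variable
  with the new coefficients.\<close>

lemma reducible_coeffs:
  assumes F: "finite F" "F \<subseteq> polys_in (insert w V)" "w \<notin> V"
    and w: "\<And>f. f \<in> F \<Longrightarrow> redmon (single w (deg_in w f))"
    and lower: "\<And>G. finite G \<Longrightarrow> G \<subseteq> polys_in V \<Longrightarrow> reducible_to V G"
  shows "reducible_to (insert w V) F"
proof -
  define G where "G = (\<Union>f\<in>F. (\<lambda>k. coeff_in w k f) ` {..deg_in w f})"
  have "G \<subseteq> polys_in V"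
    using F(2) vars_coeff_in unfolding G_def polys_in_def by blast
  then have "reducible_to V G" using F(1) by (intro lower) (auto simp: G_def)
  then obtain h y where h: "regular h" and y: "\<And>g. g \<in> G \<Longrightarrow> red (y g)" "\<And>g. g \<in> G \<Longrightarrow> y g \<in> polys_in V"
    "\<And>g. g \<in> G \<Longrightarrow> h * g - y g \<in> J"
    unfolding reducible_to_def by metis
  have "\<exists>z. red z \<and> z \<in> polys_in (insert w V) \<and> h * f - z \<in> J" if f: "f \<in> F" for f
  proof -
    define z where "z = (\<Sum>k\<le>deg_in w f. y (coeff_in w k f) * var w ^ k)"
    have G: "coeff_in w k f \<in> G" if "k \<le> deg_in w f" for k using that f by (auto simp: G_def)
    have "red z" unfolding z_def
    proof (rule red_sum)
      fix k assume k: "k \<in> {..deg_in w f}"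
      have "redmon (single w k)"
        by (rule redmon_mono[OF w[OF f]]) (use k in \<open>auto simp: lookup_single when_def\<close>)
      then have "red (var w ^ k)" by (simp flip: mon_single add: red_mon)
      moreover have "vars (y (coeff_in w k f)) \<inter> vars (var w ^ k) = {}"
        using y(2)[OF G[of k]] k F(3) vars_power[of "var w" k] by (auto simp: polys_in_def)
      ultimately show "red (y (coeff_in w k f) * var w ^ k)"
        using y(1)[OF G] k by (intro red_mult_disjoint) auto
    qed
    moreover have "z \<in> polys_in (insert w V)"
      unfolding z_def using y(2)[OF G] by (intro polys_in_sum polys_in_mult polys_in_power) (auto simp: polys_in_def)
    moreover have "h * f - z = (\<Sum>k\<le>deg_in w f. (h * coeff_in w k f - y (coeff_in w k f)) * var w ^ k)"
    proof -
      have "f = (\<Sum>k\<le>deg_in w f. coeff_in w k f * var w ^ k)"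
        using poly_upoly[of w f] by (simp add: poly_altdef)
      then have "h * f - z = h * (\<Sum>k\<le>deg_in w f. coeff_in w k f * var w ^ k) - z" by simp
      then show ?thesis
        by (simp add: z_def sum_distrib_left sum_subtractf left_diff_distrib mult.assoc)
    qed
    then have "h * f - z \<in> J" using y(3)[OF G] by (auto intro: J_sum J_mult_right)
    ultimately show ?thesis by blast
  qed
  then show ?thesis using h unfolding reducible_to_def by blast
qed

lemma reducible_divide:
  assumes F: "finite F" "F \<subseteq> polys_in V"
    and p: "p \<in> J" "p \<in> polys_in V" "regular (coeff_in w (deg_in w p) p)" "w \<in> V"
    and lower: "\<And>G. finite G \<Longrightarrow> G \<subseteq> polys_in V \<Longrightarrow>
      (\<And>g k. g \<in> G \<Longrightarrow> deg_in w p \<le> k \<Longrightarrow> coeff_in w k g = 0) \<Longrightarrow> reducible_to V G"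
  shows "reducible_to V F"
proof -
  let ?I = "coeff_in w (deg_in w p) p"
  \<comment> \<open>An exponent large enough for every element of the finite set
    \<open>F\<close>.\<close>
  define n where "n = Suc (Max (insert 0 (deg_in w ` F)))"
  have "deg_in w f < n + deg_in w p" if "f \<in> F" for f
    using that F(1) by (simp add: n_def less_Suc_eq_le trans_le_add1)
  then have "\<exists>q r. ?I ^ n * f = q * p + r \<and> (\<forall>k\<ge>deg_in w p. coeff_in w k r = 0) \<and> r \<in> polys_in V" if "f \<in> F" for f
    using pseudo_division[of w f n p] that F(2) p(2,4) unfolding polys_in_def by blast
  then obtain q r where qr: "\<And>f. f \<in> F \<Longrightarrow> ?I ^ n * f = q f * p + r f"
    "\<And>f k. f \<in> F \<Longrightarrow> deg_in w p \<le> k \<Longrightarrow> coeff_in w k (r f) = 0" "\<And>f. f \<in> F \<Longrightarrow> r f \<in> polys_in V"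
    by metis
  have "reducible_to V (r ` F)" using F(1) qr by (intro lower) auto
  then obtain h where h: "regular h" "\<And>f. f \<in> F \<Longrightarrow> \<exists>y. red y \<and> y \<in> polys_in V \<and> h * r f - y \<in> J"
    unfolding reducible_to_def by blast
  have "\<exists>y. red y \<and> y \<in> polys_in V \<and> (h * ?I ^ n) * f - y \<in> J" if f: "f \<in> F" for f
  proof -
    obtain y where y: "red y" "y \<in> polys_in V" "h * r f - y \<in> J" using h(2)[OF f] by blast
    have "(h * ?I ^ n) * f - y = h * q f * p + (h * r f - y)"
      by (simp add: mult.assoc qr(1)[OF f] distrib_left)
    also have "\<dots> \<in> J" by (intro J_add J_mult p(1) y(3))
    finally show ?thesis using y by blast
  qed
  then show ?thesis
    unfolding reducible_to_def using regular_mult[OF h(1) regular_power[OF p(3)]] by blast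
qed

lemma reducible_mono: "reducible_to V F \<Longrightarrow> V \<subseteq> W \<Longrightarrow> reducible_to W F"
  unfolding reducible_to_def using polys_in_mono[of V W] by (meson subsetD)

lemma reducible_no_vars:
  assumes "\<And>f. f \<in> F \<Longrightarrow> vars f = {}"
  shows "reducible_to V F"
  unfolding reducible_to_def
proof (rule exI[of _ 1], intro conjI ballI)
  fix f assume "f \<in> F"
  then have "vars f = {}" by (rule assms)
  then have "red f"
    unfolding red_iff
  proof (intro allI impI redmon_N)
    fix m assume "lookup f m \<noteq> 0"
    then have "keys m \<subseteq> vars f" by (auto simp: vars_def in_keys_iff)
    then show "keys m \<subseteq> N" using \<open>vars f = {}\<close> by simp
  qed
  then show "\<exists>y. red y \<and> y \<in> polys_in V \<and> 1 * f - y \<in> J"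
    using J_0 \<open>vars f = {}\<close> by (intro exI[of _ f]) (auto simp: polys_in_def)
qed (simp add: regular_def)

text \<open>Well-founded induction on the highest variable \<open>w\<close>. A variable of
  \<open>N\<close> leaves only its coefficients to be reduced; any other is first divided by the
  polynomial of \<open>ex_divisor\<close>, which by admissibility brings in only variables of
  \<open>V\<close>.\<close>

lemma reducible_le:
  assumes V: "admissible V" and "finite F" "F \<subseteq> polys_in (V \<inter> {v. le v w})"
  shows "reducible_to (V \<inter> {v. le v w}) F"
  using wf_lt assms(2,3)
proof (induction w arbitrary: F)
  case (less w)
  let ?V = "V \<inter> {v. lt v w}" and ?W = "V \<inter> {v. le v w}"
  have lower: "reducible_to ?V G" if G: "finite G" "G \<subseteq> polys_in ?V" for G
  proof (cases "\<Union>(vars ` G) = {}")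
    case True
    then show ?thesis by (intro reducible_no_vars) auto
  next
    case False
    then obtain u where u: "u \<in> \<Union>(vars ` G)" "\<And>v. v \<in> \<Union>(vars ` G) \<Longrightarrow> le v u"
      using ex_max[of "\<Union>(vars ` G)"] G(1) by auto
    have "\<Union>(vars ` G) \<subseteq> ?V" using G(2) by (auto simp: polys_in_def)
    then have "lt u w" "G \<subseteq> polys_in (V \<inter> {v. le v u})"
      using u by (auto simp: polys_in_def)
    then have "reducible_to (V \<inter> {v. le v u}) G" using less.IH[of u G] G(1) by auto
    then show ?thesis
      by (rule reducible_mono) (use \<open>lt u w\<close> le_lt_trans in blast)
  qed
  show ?case
  proof (cases "w \<in> V")
    case False
    then have "?W = ?V" by (auto simp: lt_def)
    then show ?thesis using lower less.prems by auto
  next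
    case True
    then have W: "?W = insert w ?V" by (auto simp: lt_def)
    have coeffs: "reducible_to ?W G"
      if "finite G" "G \<subseteq> polys_in ?W" "\<And>g. g \<in> G \<Longrightarrow> redmon (single w (deg_in w g))" for G
      using reducible_coeffs[of G w ?V] that lower unfolding W by auto
    show ?thesis
    proof (cases "w \<in> N")
      case True
      then show ?thesis using coeffs[OF less.prems] N_single by blast
    next
      case False
      obtain p where p: "p \<in> J" "p \<in> polys_in ?W" "regular (coeff_in w (deg_in w p) p)"
          "0 < deg_in w p" "redmon (single w (deg_in w p - 1))"
        using ex_divisor[OF V \<open>w \<in> V\<close> False] by blast
      show ?thesis
      proof (rule reducible_divide[OF less.prems p(1-3)])
        fix G :: "('d, 'y, 'k) dpoly set"
        assume G: "finite G" "G \<subseteq> polys_in ?W" "\<And>g k. g \<in> G \<Longrightarrow> deg_in w p \<le> k \<Longrightarrow> coeff_in w k g = 0"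
        have "redmon (single w (deg_in w g))" if g: "g \<in> G" for g
        proof (rule redmon_mono[OF p(5)])
          have "deg_in w g < deg_in w p"
          proof (rule ccontr)
            assume "\<not> deg_in w g < deg_in w p"
            then have "coeff_in w (deg_in w g) g = 0" using G(3)[OF g] by simp
            then have "g = 0" using coeff_in_deg_nonzero by blast
            then show False using \<open>\<not> deg_in w g < deg_in w p\<close> p(4) by (simp add: deg_in_def)
          qed
          then show "lookup (single w (deg_in w g)) v
              \<le> lookup (single w (deg_in w p - 1)) v" for v
            by (auto simp: lookup_single when_def)
        qed
        then show "reducible_to ?W G" using coeffs G by blast
      qed (use W in blast)
    qed
  qed
qed

lemma reducible:
  assumes V: "admissible V" and F: "finite F" "F \<subseteq> polys_in V"
  shows "reducible_to V F"
proof (cases "\<Union>(vars ` F) = {}")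
  case True
  then show ?thesis by (intro reducible_no_vars) auto
next
  case False
  then obtain u where u: "\<And>v. v \<in> \<Union>(vars ` F) \<Longrightarrow> le v u"
    using ex_max[of "\<Union>(vars ` F)"] F(1) by auto
  have "F \<subseteq> polys_in (V \<inter> {v. le v u})" using u F(2) by (auto simp: polys_in_def)
  then have "reducible_to (V \<inter> {v. le v u}) F" using reducible_le[OF V F(1)] by blast
  then show ?thesis by (rule reducible_mono) auto
qed

end

section \<open>Coefficient extraction, linear algebra over k[N] and radicality\<close>

context regular_set
begin

text \<open>Reducing the coefficients inside \<open>V\<close> leaves the monomials \<mu> untouched,
  as these avoid \<open>V\<close>. The outcome is a reduced element of \<open>J\<close>, hence zero,
  so every reduced coefficient vanishes and the regular multiplier can be cancelled.\<close>

lemma coeffs_in_J: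
  assumes M: "finite M" "(\<Sum>\<mu>\<in>M. c \<mu> * mon \<mu>) \<in> J"
    and \<mu>: "\<And>\<mu>. \<mu> \<in> M \<Longrightarrow> redmon \<mu>" "\<And>\<mu>. \<mu> \<in> M \<Longrightarrow> keys \<mu> \<inter> V = {}"
    and c: "\<And>\<mu>. \<mu> \<in> M \<Longrightarrow> c \<mu> \<in> polys_in V" and V: "admissible V" and \<nu>: "\<nu> \<in> M"
  shows "c \<nu> \<in> J"
proof -
  have "reducible_to V (c ` M)" using M(1) c by (intro reducible V) auto
  then obtain h where h: "regular h" "\<And>\<mu>. \<mu> \<in> M \<Longrightarrow> \<exists>y. red y \<and> y \<in> polys_in V \<and> h * c \<mu> - y \<in> J"
    unfolding reducible_to_def by blast
  then obtain y where y: "\<And>\<mu>. \<mu> \<in> M \<Longrightarrow> red (y \<mu>)" "\<And>\<mu>. \<mu> \<in> M \<Longrightarrow> y \<mu> \<in> polys_in V"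
    "\<And>\<mu>. \<mu> \<in> M \<Longrightarrow> h * c \<mu> - y \<mu> \<in> J" by metis
  define z where "z = (\<Sum>\<mu>\<in>M. y \<mu> * mon \<mu>)"
  have "red z" unfolding z_def
  proof (intro red_sum red_mult_disjoint red_mon)
    fix \<mu> assume "\<mu> \<in> M"
    then show "vars (y \<mu>) \<inter> vars (mon \<mu> :: ('d, 'y, 'k) dpoly) = {}"
      using y(2) \<mu>(2) by (auto simp: polys_in_def vars_single)
  qed (use y \<mu> in auto)
  moreover have "h * (\<Sum>\<mu>\<in>M. c \<mu> * mon \<mu>) - z = (\<Sum>\<mu>\<in>M. (h * c \<mu> - y \<mu>) * mon \<mu>)"
    by (simp add: z_def sum_distrib_left sum_subtractf left_diff_distrib mult.assoc)
  then have "h * (\<Sum>\<mu>\<in>M. c \<mu> * mon \<mu>) - z \<in> J" using y(3) by (auto intro: J_sum J_mult_right)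
  then have "z \<in> J" using J_mult[OF M(2), of h] ideal_cong[OF ideal_J] by blast
  ultimately have "z = 0" by (rule red_eq_0)
  moreover have "cpart (- V) \<nu> z = y \<nu>"
    unfolding z_def using y(2) \<mu>(2) \<nu> by (intro cpart_sum_mon M(1)) (auto simp: polys_in_def)
  ultimately have "y \<nu> = 0" by simp
  then show ?thesis using y(3)[OF \<nu>] h(1) by (simp add: regular_def)
qed

text \<open>The case where the monomials are powers of the highest variable; the lower variables are
  an admissible set. The degree condition is essential: an element of \<open>A\<close> violates it
  at its leader, and its initial is not in \<open>J\<close>.\<close>

lemma coeff_in_J:
  assumes "f \<in> J" "f \<in> polys_in {v. le v w}" "redmon (single w (deg_in w f))"
  shows "coeff_in w k f \<in> J"
proof (cases "k \<le> deg_in w f")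
  case True
  let ?M = "single w ` {..deg_in w f}"
  have "f = (\<Sum>k\<le>deg_in w f. coeff_in w k f * var w ^ k)"
    using poly_upoly[of w f] by (simp add: poly_altdef)
  also have "\<dots> = (\<Sum>\<mu>\<in>?M. cpart {w} \<mu> f * mon \<mu>)"
    by (subst sum.reindex) (auto simp: inj_on_def coeff_in_eq_cpart mon_single dest: arg_cong[where f = "\<lambda>m. lookup m w"])
  finally have f: "f = (\<Sum>\<mu>\<in>?M. cpart {w} \<mu> f * mon \<mu>)" .
  have "cpart {w} (single w k) f \<in> J"
  proof (rule coeffs_in_J)
    show "(\<Sum>\<mu>\<in>?M. cpart {w} \<mu> f * mon \<mu>) \<in> J" using assms(1) f by simp
    show "admissible {v. lt v w}"
      by (rule admissible_downclosed) (auto intro: le_lt_trans)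
    fix \<mu> assume "\<mu> \<in> ?M"
    then obtain j where j: "j \<le> deg_in w f" "\<mu> = single w j" by auto
    show "redmon \<mu>" unfolding j(2)
      by (rule redmon_mono[OF assms(3)]) (use j(1) in \<open>auto simp: lookup_single when_def\<close>)
    show "keys \<mu> \<inter> {v. lt v w} = {}" by (auto simp: j(2))
    have "vars (cpart {w} \<mu> f) \<subseteq> {v. le v w} - {w}"
      using vars_cpart[of "{w}" \<mu> f] assms(2) unfolding polys_in_def by blast
    then show "cpart {w} \<mu> f \<in> polys_in {v. lt v w}" by (auto simp: polys_in_def lt_def)
  qed (use True in auto)
  then show ?thesis by (simp add: coeff_in_eq_cpart)
qed (simp add: J_0 coeff_in_above_deg)

text \<open>If \<open>y\<close> is a reduction of \<open>f\<close>, then \<open>c * y\<close> is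
  reduced and lies in \<open>J\<close>, hence is zero; so \<open>y\<close> is zero.\<close>

lemma regular_N:
  assumes c: "vars c \<subseteq> N" "c \<noteq> 0"
  shows "regular c"
  unfolding regular_def
proof (intro allI impI)
  fix f assume f: "c * f \<in> J"
  have "reducible_to UNIV {f}"
    by (intro reducible admissible_downclosed) (auto simp: polys_in_def)
  then obtain h y where h: "regular h" and y: "red y" "h * f - y \<in> J"
    unfolding reducible_to_def by auto
  have "h * (c * f) - c * y = c * (h * f - y)" by (simp add: algebra_simps)
  then have "h * (c * f) - c * y \<in> J" using J_mult[OF y(2), of c] by simp
  then have "c * y \<in> J" using J_mult[OF f, of h] ideal_cong[OF ideal_J] by blast
  moreover have "red (c * y)" using c(1) y(1) by (rule red_N_mult)
  ultimately have "y = 0" using red_eq_0 dpoly_no_zero_divisors c(2) by blast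
  then show "f \<in> J" using y(2) h by (simp add: regular_def)
qed

text \<open>The reduced monomials in the leaders: they form a basis of the quotient by \<open>J\<close> over the
  field of fractions of the polynomials in the parametric variables.\<close>

definition basis_mons :: "('d, 'y) dvar set \<Rightarrow> (('d, 'y) dvar \<Rightarrow>\<^sub>0 nat) set" where
  "basis_mons V = {\<mu>. keys \<mu> \<subseteq> leader le ` A \<inter> V \<and> redmon \<mu>}"

lemma finite_basis_mons: "finite (basis_mons V)"
proof -
  let ?L = "leader le ` A"
  define B where "B = Max ((\<lambda>a. deg_in (leader le a) a) ` A)"
  let ?r = "\<lambda>\<mu>. restrict (lookup \<mu>) ?L"
  have "?r ` basis_mons V \<subseteq> PiE ?L (\<lambda>_. {..B})"
  proof (intro image_subsetI PiE_I)
    fix \<mu> u assume \<mu>: "\<mu> \<in> basis_mons V" and "u \<in> ?L"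
    then obtain a where a: "a \<in> A" "u = leader le a" by blast
    have "lookup \<mu> u < deg_in (leader le a) a"
      using \<mu> a by (auto simp: basis_mons_def redmon_def)
    moreover have "deg_in (leader le a) a \<le> B" unfolding B_def using a finite_A by (intro Max_ge) auto
    ultimately show "?r \<mu> u \<in> {..B}" using a by auto
  qed auto
  moreover have "finite (PiE ?L (\<lambda>_. {..B}))" using finite_A by (intro finite_PiE) auto
  moreover have "inj_on ?r (basis_mons V)"
  proof (intro inj_onI poly_mapping_eqI)
    fix \<mu> \<nu> v assume *: "\<mu> \<in> basis_mons V" "\<nu> \<in> basis_mons V" "?r \<mu> = ?r \<nu>"
    show "lookup \<mu> v = lookup \<nu> v"
    proof (cases "v \<in> ?L")
      case True
      then show ?thesis using fun_cong[OF *(3), of v] by simp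
    next
      case False
      then have "v \<notin> keys \<mu>" "v \<notin> keys \<nu>"
        using *(1,2) unfolding basis_mons_def by blast+
      then show ?thesis by (simp add: in_keys_iff)
    qed
  qed
  ultimately show ?thesis using finite_subset finite_imageD by metis
qed

text \<open>The reductions of the \<open>x i\<close> by a common multiplier have their coordinates
  with respect to \<open>basis_mons V\<close> in k[N \<inter> V]. More elements than coordinates
  forces a relation, and the regular multiplier is cancelled at the end. Downward closure keeps the
  reduction inside \<open>V\<close>.\<close>

lemma algebraic_dependence:
  fixes x :: "'i \<Rightarrow> ('d, 'y, 'k) dpoly"
  assumes V: "\<And>v u. v \<in> V \<Longrightarrow> le u v \<Longrightarrow> u \<in> V"
    and X: "finite X" "card (basis_mons V) < card X" "\<And>i. i \<in> X \<Longrightarrow> x i \<in> polys_in V"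
  shows "\<exists>e. (\<forall>i\<in>X. e i \<in> polys_in (N \<inter> V)) \<and> (\<exists>i\<in>X. e i \<noteq> 0) \<and> (\<Sum>i\<in>X. e i * x i) \<in> J"
proof -
  let ?L = "leader le ` A"
  let ?K = "polys_in (N \<inter> V) :: ('d, 'y, 'k) dpoly set"
  have "reducible_to V (x ` X)" using X V by (intro reducible admissible_downclosed) auto
  then obtain h y where h: "regular h" and y: "\<And>i. i \<in> X \<Longrightarrow> red (y i)" "\<And>i. i \<in> X \<Longrightarrow> y i \<in> polys_in V"
    "\<And>i. i \<in> X \<Longrightarrow> h * x i - y i \<in> J"
    unfolding reducible_to_def by (auto simp: ball_simps) metis
  define c where "c i \<mu> = cpart ?L \<mu> (y i)" for i \<mu>
  have y_eq: "y i = (\<Sum>\<mu>\<in>basis_mons V. c i \<mu> * mon \<mu>)" if i: "i \<in> X" for i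
    unfolding c_def
  proof (rule cpart_expansion[OF finite_basis_mons])
    show "restr ?L ` keys (y i) \<subseteq> basis_mons V"
    proof
      fix \<mu> assume "\<mu> \<in> restr ?L ` keys (y i)"
      then obtain m where m: "lookup (y i) m \<noteq> 0" "\<mu> = restr ?L m" by (auto simp: in_keys_iff)
      have "redmon m" using y(1)[OF i] m(1) by (simp add: red_iff)
      then have "redmon \<mu>" by (rule redmon_mono) (simp add: m(2) lookup_restr)
      moreover have "keys m \<subseteq> vars (y i)" using m(1) by (auto simp: vars_def in_keys_iff)
      then have "keys m \<subseteq> V" using y(2)[OF i] by (auto simp: polys_in_def)
      ultimately show "\<mu> \<in> basis_mons V" by (auto simp: basis_mons_def m(2) keys_restr)
    qed
  qed (auto simp: basis_mons_def)
  have cK: "c i \<mu> \<in> ?K" if i: "i \<in> X" for i \<mu>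
  proof -
    have "v \<in> N" if v: "v \<in> vars (c i \<mu>)" for v
    proof -
      have "v \<in> vars (y i)" "v \<notin> ?L" using v vars_cpart[of ?L \<mu> "y i"] by (auto simp: c_def)
      then show ?thesis using in_N_or[of v] y(1)[OF i] by (auto simp: red_def reduced_def)
    qed
    moreover have "vars (c i \<mu>) \<subseteq> V" using y(2)[OF i] vars_cpart[of ?L \<mu> "y i"] by (auto simp: c_def polys_in_def)
    ultimately show ?thesis by (auto simp: polys_in_def)
  qed
  have "\<exists>e. (\<forall>i\<in>X. e i \<in> ?K) \<and> (\<exists>i\<in>X. e i \<noteq> 0) \<and> (\<forall>\<mu>\<in>basis_mons V. (\<Sum>i\<in>X. e i * c i \<mu>) = 0)"
    using cK X finite_basis_mons
    by (intro linear_dependence) (auto intro: polys_in_diff polys_in_mult dest: dpoly_no_zero_divisors)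
  then obtain e where e: "\<And>i. i \<in> X \<Longrightarrow> e i \<in> ?K" "\<exists>i\<in>X. e i \<noteq> 0"
    "\<And>\<mu>. \<mu> \<in> basis_mons V \<Longrightarrow> (\<Sum>i\<in>X. e i * c i \<mu>) = 0" by blast
  have "(\<Sum>i\<in>X. e i * y i) = (\<Sum>i\<in>X. \<Sum>\<mu>\<in>basis_mons V. e i * c i \<mu> * mon \<mu>)"
    by (intro sum.cong) (auto simp: y_eq sum_distrib_left mult.assoc)
  also have "\<dots> = (\<Sum>\<mu>\<in>basis_mons V. (\<Sum>i\<in>X. e i * c i \<mu>) * mon \<mu>)"
    by (subst sum.swap) (simp add: sum_distrib_right)
  also have "\<dots> = 0" using e(3) by simp
  finally have "(\<Sum>i\<in>X. e i * y i) = 0" .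
  then have "h * (\<Sum>i\<in>X. e i * x i) = h * (\<Sum>i\<in>X. e i * x i) - (\<Sum>i\<in>X. e i * y i)" by simp
  also have "\<dots> = (\<Sum>i\<in>X. e i * (h * x i - y i))"
    by (simp add: sum_distrib_left sum_subtractf right_diff_distrib ac_simps)
  also have "\<dots> \<in> J" using y(3) by (intro J_sum J_mult) auto
  finally have "(\<Sum>i\<in>X. e i * x i) \<in> J" using h by (simp add: regular_def)
  then show ?thesis using e(1,2) by blast
qed

lemma pdiff_in_J:
  assumes "\<And>k. coeff_in w k r \<in> J"
  shows "pdiff w r \<in> J"
proof -
  have "pdiff w r = (\<Sum>k\<le>deg_in w (pdiff w r). coeff_in w k (pdiff w r) * var w ^ k)"
    using poly_upoly[of w "pdiff w r"] by (simp add: poly_altdef)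
  also have "\<dots> \<in> J"
    unfolding coeff_in_pdiff by (intro J_sum J_mult_right J_mult assms)
  finally show ?thesis .
qed

text \<open>Pseudo-divide the square of \<open>f\<close> by \<open>p\<close> and differentiate with respect to \<open>w\<close>: the square of the
  quotient lies in \<open>J\<close> as well, and the quotient has lower degree than \<open>f\<close>.\<close>

lemma leading_coeff_square:
  assumes p: "p \<in> J" "p \<in> polys_in {v. le v w}" "regular (coeff_in w (deg_in w p) p)"
      "regular (pdiff w p)" "redmon (single w (deg_in w p - 1))"
    and f: "f \<in> polys_in {v. le v w}" "deg_in w f < deg_in w p" "f * f \<in> J"
    and IH: "\<And>q. q \<in> polys_in {v. le v w} \<Longrightarrow> deg_in w q < deg_in w f \<Longrightarrow> q * q \<in> J \<Longrightarrow> q \<in> J"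
  shows "\<exists>h. regular h \<and> h * (coeff_in w (deg_in w f) f * coeff_in w (deg_in w f) f) \<in> J"
proof -
  define e d l where "e = deg_in w f" and "d = deg_in w p" and "l = coeff_in w d p"
  \<comment> \<open>Just large enough to divide the square of \<open>f\<close>, of degree at most
    \<open>2 * e\<close>. Since \<open>e < d\<close>, it is at most \<open>e\<close>, which makes
    the quotient accessible to \<open>IH\<close>.\<close>
  define n where "n = Suc (2 * e) - d"
  have "deg_in w (f * f) < n + d"
    using degree_mult_le[of "upoly w f" "upoly w f"] by (simp add: n_def e_def flip: upoly_mult)
  then obtain q r where qr: "l ^ n * (f * f) = q * p + r" "\<And>k. d \<le> k \<Longrightarrow> coeff_in w k r = 0"
    "\<And>k. n \<le> k \<Longrightarrow> coeff_in w k q = 0" "vars q \<subseteq> vars p \<union> vars (f * f) \<union> {w}" "vars r \<subseteq> vars p \<union> vars (f * f) \<union> {w}"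
    using pseudo_division[of w "f * f" n p] unfolding l_def d_def by blast
  have "vars p \<union> vars (f * f) \<union> {w} \<subseteq> {v. le v w}"
    using p(2) f(1) vars_mult[of f f] by (auto simp: polys_in_def)
  then have qW: "q \<in> polys_in {v. le v w}" and rW: "r \<in> polys_in {v. le v w}"
    using qr(4,5) unfolding polys_in_def by blast+
  have small: "redmon (single w (deg_in w g))" if "\<And>k. d \<le> k \<Longrightarrow> coeff_in w k g = 0" for g
  proof (rule redmon_mono[OF p(5)])
    have "deg_in w g = 0 \<or> deg_in w g < d"
    proof (rule ccontr)
      assume *: "\<not> ?thesis"
      then have "coeff_in w (deg_in w g) g = 0" using that by simp
      then have "g = 0" using coeff_in_deg_nonzero by blast
      then show False using * by (simp add: deg_in_def)
    qed
    then have "deg_in w g \<le> d - 1" by auto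
    then show "lookup (single w (deg_in w g)) v
        \<le> lookup (single w (deg_in w p - 1)) v" for v
      by (auto simp: lookup_single when_def d_def)
  qed
  have "q * p + r \<in> J" using J_mult[OF f(3), of "l ^ n"] qr(1) by simp
  then have "r \<in> J" using J_diff[OF _ J_mult[OF p(1), of q], of "q * p + r"] by simp
  then have rJ: "coeff_in w k r \<in> J" for k using coeff_in_J rW small[OF qr(2)] by blast
  define S where "S = pdiff w p"
  have nd: "n \<le> e" "n \<le> d" using f(2) by (auto simp: n_def e_def d_def)
  have "q \<in> J"
  proof -
    have l: "w \<notin> vars (l ^ n)" using vars_power[of l n] vars_coeff_in[of w d p] by (auto simp: l_def)
    define X where "X = l ^ n * (pdiff w f * f + f * pdiff w f)"
    have "pdiff w (l ^ n * (f * f)) = X"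
      by (simp add: X_def pdiff_mult pdiff_free[OF l])
    then have "X = pdiff w q * p + q * S + pdiff w r"
      unfolding qr(1) by (simp add: pdiff_add pdiff_mult S_def)
    then have "q * S - X = - 1 * (pdiff w q * p + pdiff w r)" by simp
    also have "\<dots> \<in> J" by (intro J_mult J_add p(1) pdiff_in_J rJ)
    finally have qS: "q * S - X \<in> J" .
    \<comment> \<open>The derivative \<open>X\<close> of the left side has its square in the ideal
      generated by \<open>f * f\<close>. As \<open>q * S\<close> agrees with \<open>X\<close> modulo
      \<open>J\<close>, the square of \<open>q * S\<close> lies in \<open>J\<close>, and the regular
      \<open>S\<close> can be cancelled.\<close>
    have XX: "X * X = (l ^ n * l ^ n * 4 * pdiff w f * pdiff w f) * (f * f)"
      by (simp add: X_def algebra_simps)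
    have "X * X \<in> J" unfolding XX by (rule J_mult[OF f(3)])
    moreover have "S * (S * (q * q)) = (q * S + X) * (q * S - X) + X * X" by (simp add: algebra_simps)
    ultimately have "S * (S * (q * q)) \<in> J" using J_add[OF J_mult[OF qS, of "q * S + X"]] by simp
    then have qq: "q * q \<in> J" using p(4) by (simp add: regular_def S_def)
    show "q \<in> J"
    proof (cases "q = 0")
      case False
      have "deg_in w q < n"
      proof (rule ccontr)
        assume "\<not> deg_in w q < n"
        then have "coeff_in w (deg_in w q) q = 0" using qr(3) by simp
        then show False using False coeff_in_deg_nonzero by blast
      qed
      then show ?thesis using IH[OF qW _ qq] nd(1) by (simp add: e_def)
    qed (simp add: J_0)
  qed
  then have qJ: "coeff_in w k q \<in> J" for k
    by (rule coeff_in_J[OF _ qW small]) (use qr(3) nd(2) in auto)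
  \<comment> \<open>Compare coefficients of degree \<open>2 * e\<close> in the division identity:
    that of \<open>q * p + r\<close> lies in \<open>J\<close>, and the other side gives
    \<open>l ^ n\<close> times the square of the leading coefficient of \<open>f\<close>.\<close>
  have "coeff (upoly w q * upoly w p) k \<in> J" for k
    unfolding coeff_mult coeff_upoly by (intro J_sum J_mult_right qJ)
  then have "coeff_in w (2 * e) (q * p + r) \<in> J"
    using rJ by (auto simp: upoly_add upoly_mult simp flip: coeff_upoly intro!: J_add)
  moreover have "coeff_in w (2 * e) (l ^ n * (f * f)) = l ^ n * (coeff_in w e f * coeff_in w e f)"
  proof -
    have "w \<notin> vars (l ^ n)" using vars_power[of l n] vars_coeff_in[of w d p] by (auto simp: l_def)
    then have "coeff_in w (2 * e) (l ^ n * (f * f)) = l ^ n * coeff (upoly w f * upoly w f) (e + e)"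
      by (simp add: upoly_mult upoly_free mult_2 flip: coeff_upoly)
    also have "coeff (upoly w f * upoly w f) (e + e) = coeff_in w e f * coeff_in w e f"
      using coeff_mult_degree_sum[of "upoly w f" "upoly w f"] by (simp add: e_def)
    finally show ?thesis .
  qed
  ultimately have "l ^ n * (coeff_in w e f * coeff_in w e f) \<in> J" by (simp add: qr(1))
  then show ?thesis using regular_power[OF p(3), of n] unfolding l_def d_def e_def by blast
qed

lemma const_square_in_J:
  assumes "vars f = {}" "f * f \<in> J"
  shows "f \<in> J"
proof (cases "f = 0")
  case False
  obtain c where c: "f = const c" using vars_empty_imp_const[OF assms(1)] by blast
  then have "c \<noteq> 0" using False by auto
  then have inv: "inverse c * (c * c) = c" by (simp flip: mult.assoc)
  have "const (inverse c) * (f * f) = const (inverse c * (c * c))" by (simp add: c mult_single)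
  also have "\<dots> = f" unfolding inv c ..
  finally show ?thesis using J_mult[OF assms(2), of "const (inverse c)"] by simp
qed (simp add: J_0)

text \<open>Outer induction on \<open>w\<close>, inner induction on the degree in \<open>w\<close>.
  Once the square of the leading coefficient is in \<open>J\<close>, the outer induction puts the
  coefficient itself in \<open>J\<close> and the leading term can be subtracted. For
  \<open>w\<close> in \<open>N\<close> that square is a coefficient of \<open>f * f\<close>;
  otherwise it comes from \<open>leading_coeff_square\<close>.\<close>

lemma radical_le:
  assumes "f \<in> polys_in {v. le v w}" "f * f \<in> J"
  shows "f \<in> J"
  using wf_lt assms
proof (induction w arbitrary: f)
  case (less w)
  let ?W = "{v. le v w}"
  have lower: "g \<in> J" if g: "g \<in> polys_in {v. lt v w}" "g * g \<in> J" for g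
  proof (cases "vars g = {}")
    case False
    then have "lt (leader le g) w" "g \<in> polys_in {v. le v (leader le g)}"
      using leader_in_vars[OF False] le_leader[OF False] g(1) by (auto simp: polys_in_def)
    then show ?thesis using less.IH g(2) by blast
  qed (use const_square_in_J g in blast)
  have step: "g \<in> J"
    if g: "g \<in> polys_in ?W" "g * g \<in> J"
      and h: "\<exists>h. regular h \<and> h * (coeff_in w (deg_in w g) g * coeff_in w (deg_in w g) g) \<in> J"
      and IH: "\<And>q. q \<in> polys_in ?W \<Longrightarrow> deg_in w q < deg_in w g \<Longrightarrow> q * q \<in> J \<Longrightarrow> q \<in> J" for g
  proof -
    let ?c = "coeff_in w (deg_in w g) g"
    have c: "?c \<in> polys_in {v. lt v w}"
      using vars_coeff_in[of w "deg_in w g" g] g(1) by (auto simp: polys_in_def lt_def)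
    have "?c * ?c \<in> J" using h unfolding regular_def by blast
    then have cJ: "?c \<in> J" using lower[OF c] by blast
    define t where "t = ?c * var w ^ deg_in w g"
    have tJ: "t \<in> J" unfolding t_def using cJ by (rule J_mult_right)
    have tW: "t \<in> polys_in ?W"
      unfolding t_def using polys_in_lt_imp_le[OF c]
      by (intro polys_in_mult polys_in_power) (auto simp: polys_in_def)
    have "(g - t) * (g - t) = g * g - t * (2 * g - t)" by (simp add: algebra_simps)
    then have sq: "(g - t) * (g - t) \<in> J" using J_diff[OF g(2) J_mult_right[OF tJ]] by simp
    have "coeff_in w k (g - t) = (if k = deg_in w g then 0 else coeff_in w k g)" for k
    proof -
      have "upoly w t = monom ?c (deg_in w g)"
        unfolding t_def
        by (rule upoly_unique) (use vars_coeff_in[of w _ g] in \<open>auto simp: poly_monom\<close>)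
      then have "coeff (upoly w (g - t)) k = (if k = deg_in w g then 0 else coeff_in w k g)"
        by (simp add: upoly_diff)
      then show ?thesis by simp
    qed
    then have z: "coeff_in w k (g - t) = 0" if "deg_in w g \<le> k" for k
      using that coeff_in_above_deg[of w g k] by auto
    have "g - t \<in> J"
    proof (cases "g - t = 0")
      case False
      then have "deg_in w (g - t) < deg_in w g"
        using z[of "deg_in w (g - t)"] coeff_in_deg_nonzero[OF False, of w] by (meson not_le)
      then show ?thesis using IH[OF polys_in_diff[OF g(1) tW] _ sq] by blast
    qed (simp add: J_0)
    then show ?thesis using J_add[OF _ tJ, of "g - t"] by simp
  qed
  show ?case
  proof (cases "w \<in> N")
    case True
    show ?thesis using less.prems
    proof (induction "deg_in w f" arbitrary: f rule: less_induct)
      case (less f)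
      have "f * f \<in> polys_in ?W" using less.prems(1) by (intro polys_in_mult)
      then have "coeff_in w (deg_in w f + deg_in w f) (f * f) \<in> J"
        using less.prems(2) N_single[OF True] by (intro coeff_in_J)
      also have "coeff_in w (deg_in w f + deg_in w f) (f * f) =
          coeff (upoly w f * upoly w f) (degree (upoly w f) + degree (upoly w f))"
        by (simp flip: upoly_mult)
      finally have "coeff_in w (deg_in w f) f * coeff_in w (deg_in w f) f \<in> J"
        unfolding coeff_mult_degree_sum by simp
      then have "\<exists>h. regular h \<and> h * (coeff_in w (deg_in w f) f * coeff_in w (deg_in w f) f) \<in> J"
        using regular_1 by (intro exI[of _ 1]) simp
      then show ?case by (rule step[OF less.prems]) (rule less.hyps)
    qed
  next
    case False
    have "admissible UNIV" by (rule admissible_downclosed) auto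
    then obtain p where p: "p \<in> J" "p \<in> polys_in ?W" "regular (coeff_in w (deg_in w p) p)"
      "regular (pdiff w p)" "0 < deg_in w p" "redmon (single w (deg_in w p - 1))"
      using ex_divisor[of UNIV w] False by auto
    have low: "g \<in> J" if "g \<in> polys_in ?W" "g * g \<in> J" "deg_in w g < deg_in w p" for g
      using that
    proof (induction "deg_in w g" arbitrary: g rule: less_induct)
      case (less g)
      have IH: "q \<in> J" if "q \<in> polys_in ?W" "deg_in w q < deg_in w g" "q * q \<in> J" for q
        using less.hyps[of q] that less.prems(3) by simp
      have "\<exists>h. regular h \<and> h * (coeff_in w (deg_in w g) g * coeff_in w (deg_in w g) g) \<in> J"
        by (rule leading_coeff_square[OF p(1-4,6) less.prems(1,3,2)]) (rule IH)
      then show ?case by (rule step[OF less.prems(1,2)]) (rule IH)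
    qed
    \<comment> \<open>For arbitrary degree pass to the pseudo-remainder modulo \<open>p\<close>: its
      square is again in \<open>J\<close>, and its degree is covered by \<open>low\<close>.\<close>
    let ?l = "coeff_in w (deg_in w p) p"
    define n where "n = Suc (deg_in w f)"
    have "deg_in w f < n + deg_in w p" by (simp add: n_def)
    then obtain q r where qr: "?l ^ n * f = q * p + r" "\<And>k. deg_in w p \<le> k \<Longrightarrow> coeff_in w k r = 0"
      "vars r \<subseteq> vars p \<union> vars f \<union> {w}"
      using pseudo_division[of w f n p] by blast
    have "r = ?l ^ n * f - q * p" by (simp add: qr(1))
    moreover have "(?l ^ n * f - q * p) * (?l ^ n * f - q * p) =
        (?l ^ n * ?l ^ n) * (f * f) + (q * q * p - 2 * q * ?l ^ n * f) * p" by (simp add: algebra_simps)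
    ultimately have rr: "r * r \<in> J"
      using J_add[OF J_mult[OF less.prems(2)] J_mult[OF p(1)]] by simp
    have rW: "r \<in> polys_in ?W" using qr(3) p(2) less.prems(1) unfolding polys_in_def by auto
    have "r \<in> J"
    proof (cases "r = 0")
      case False
      then have "deg_in w r < deg_in w p"
        using qr(2)[of "deg_in w r"] coeff_in_deg_nonzero[OF False, of w] by (meson not_le)
      then show ?thesis using low[OF rW rr] by blast
    qed (simp add: J_0)
    then have "?l ^ n * f \<in> J" unfolding qr(1) by (intro J_add J_mult p(1))
    then show ?thesis using regular_power[OF p(3), of n] by (simp add: regular_def)
  qed
qed

lemma radical:
  assumes "f * f \<in> J"
  shows "f \<in> J"
proof (cases "vars f = {}")
  case False
  then have "f \<in> polys_in {v. le v (leader le f)}" using le_leader by (auto simp: polys_in_def)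
  then show ?thesis using radical_le assms by blast
qed (use const_square_in_J assms in blast)

end

subsection \<open>Leaders of the essential components\<close>

context regular_set
begin

lemma essential_regular:
  assumes "P \<in> essential_prime_components D J" "regular h"
  shows "h \<notin> P"
  using essential_prime_component_regular[OF differential_ideal_J assms(1)] assms(2)
  unfolding regular_def by blast

lemma essential_prime: "P \<in> essential_prime_components D J \<Longrightarrow> prime_ideal P"
  and essential_superset: "P \<in> essential_prime_components D J \<Longrightarrow> J \<subseteq> P"
  by (auto simp: essential_prime_components_def prime_differential_ideal_iff)

lemma essential_nonempty: "essential_prime_components D J \<noteq> {}"
  using radical_essential_prime_component[OF differential_ideal_J radical one_notin_J] by blast

text \<open>Too many components would give elements \<open>x P\<close>, each outside
  \<open>P\<close> but in all the other chosen components, with a relation over k[N] modulo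
  \<open>J\<close>. Modulo \<open>P\<close> only the term \<open>e P * x P\<close> survives, so
  \<open>e P\<close> would lie in \<open>P\<close>, although nonzero elements of k[N] are
  regular.\<close>

lemma finite_essential_prime_components: "finite (essential_prime_components D J)"
proof (rule ccontr)
  let ?E = "essential_prime_components D J"
  assume "infinite ?E"
  then obtain X where X: "finite X" "card X = Suc (card (basis_mons UNIV))" "X \<subseteq> ?E"
    using infinite_arbitrarily_large by blast
  have "\<exists>g. g \<in> Q \<and> g \<notin> P" if "P \<in> X" "Q \<in> X" "P \<noteq> Q" for P Q
    using that X(3) unfolding essential_prime_components_def by blast
  then obtain g where g: "\<And>P Q. P \<in> X \<Longrightarrow> Q \<in> X \<Longrightarrow> P \<noteq> Q \<Longrightarrow> g P Q \<in> Q \<and> g P Q \<notin> P"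
    by metis
  define x where "x P = (\<Prod>Q\<in>X - {P}. g P Q)" for P
  have in_other: "x P \<in> Q" if "P \<in> X" "Q \<in> X" "P \<noteq> Q" for P Q
  proof -
    have "x P = g P Q * (\<Prod>Q\<in>X - {P} - {Q}. g P Q)"
      unfolding x_def using that X(1) by (intro prod.remove) auto
    moreover have "ideal Q" using essential_prime[of Q] X(3) that(2) by (auto simp: prime_ideal_def)
    ultimately show ?thesis using g[OF that] by (simp add: ideal_mult_right)
  qed
  have notin: "x P \<notin> P" if P: "P \<in> X" for P
  proof -
    have pr: "prime_ideal P" using P X(3) essential_prime by blast
    have "(\<Prod>Q\<in>Y. g P Q) \<notin> P" if "finite Y" "Y \<subseteq> X - {P}" for Y
      using that
    proof (induction Y)
      case empty
      then show ?case using pr ideal_UNIV_iff by (auto simp: prime_ideal_def)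
    next
      case (insert Q Y)
      then have "g P Q \<notin> P" using g[OF P, of Q] by auto
      then show ?case using insert pr by (auto simp: prime_ideal_def)
    qed
    then show ?thesis unfolding x_def using X(1) by blast
  qed
  have "\<exists>e. (\<forall>P\<in>X. e P \<in> polys_in (N \<inter> UNIV)) \<and> (\<exists>P\<in>X. e P \<noteq> 0) \<and> (\<Sum>P\<in>X. e P * x P) \<in> J"
    using X by (intro algebraic_dependence) (auto simp: polys_in_def)
  then obtain e where e: "\<And>P. P \<in> X \<Longrightarrow> vars (e P) \<subseteq> N" "\<exists>P\<in>X. e P \<noteq> 0" "(\<Sum>P\<in>X. e P * x P) \<in> J"
    by (auto simp: polys_in_def)
  then obtain P where P: "P \<in> X" "e P \<noteq> 0" by blast
  have PE: "P \<in> ?E" using P X(3) by blast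
  have pr: "prime_ideal P" using PE by (rule essential_prime)
  then have id: "ideal P" by (simp add: prime_ideal_def)
  have all: "(\<Sum>Q\<in>X. e Q * x Q) \<in> P" using e(3) essential_superset[OF PE] by blast
  have split: "(\<Sum>Q\<in>X. e Q * x Q) = e P * x P + (\<Sum>Q\<in>X - {P}. e Q * x Q)"
    using X(1) P(1) by (rule sum.remove)
  have rest: "(\<Sum>Q\<in>X - {P}. e Q * x Q) \<in> P"
    using in_other P(1) by (intro ideal_sum[OF id] ideal_mult[OF id]) auto
  have "e P * x P \<in> P" using ideal_diff[OF id all rest] unfolding split by simp
  then have "e P \<in> P" using notin[OF P(1)] pr unfolding prime_ideal_def by blast
  then show False using essential_regular[OF PE regular_N[OF e(1)[OF P(1)] P(2)]] by blast
qed

lemma leader_no_proper_derivative: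
  assumes "a \<in> A" "b \<in> A" "leader le a = dapply \<theta> (leader le b)"
  shows "\<theta> = 0"
proof (cases "a = b")
  case True
  then show ?thesis using assms(3) dapply_eq_iff by metis
next
  case False
  then show ?thesis
    using reduced_A[OF assms(1,2)] assms(3) leader_in_vars[OF vars_A[OF assms(1)]]
    unfolding reduced_def by metis
qed

context
  fixes P C
  assumes P: "P \<in> essential_prime_components D J" and C: "regular_set D le P C"
begin

interpretation P: regular_set D le P C by (rule C)

text \<open>A power of an element of \<open>P\<close>, multiplied by a suitable element outside \<open>P\<close> in no higher
  variables, lies in \<open>J\<close>; extract coefficients with respect to the leader.\<close>

lemma component_leader_notin_N:
  assumes c: "c \<in> C"
  shows "leader le c \<notin> N"
proof
  define v where "v = leader le c"
  define V where "V = {u. le u v}"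
  assume "leader le c \<in> N"
  then have vN: "v \<in> N" by (simp add: v_def)
  have pr: "prime_ideal P" using P by (rule essential_prime)
  have cP: "c \<in> P" using c P.A_subset by blast
  have cV: "c \<in> polys_in V" using le_leader[OF P.vars_A[OF c]] by (auto simp: polys_in_def V_def v_def)
  \<comment> \<open>The powers of \<open>c\<close> with exponents 0 to \<open>n\<close> are one more
    than the basis monomials, hence dependent.\<close>
  define n where "n = card (basis_mons V)"
  have "\<exists>e. (\<forall>k\<in>{..n}. e k \<in> polys_in (N \<inter> V)) \<and> (\<exists>k\<in>{..n}. e k \<noteq> 0) \<and> (\<Sum>k\<in>{..n}. e k * c ^ k) \<in> J"
  proof (rule algebraic_dependence)
    show "u \<in> V" if "w \<in> V" "le u w" for w u using that by (auto simp: V_def intro: le_trans)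
  qed (auto simp: n_def intro: polys_in_power cV)
  then obtain e where e': "\<forall>k\<in>{..n}. e k \<in> polys_in (N \<inter> V)" "\<exists>k\<in>{..n}. e k \<noteq> 0"
    and e3: "(\<Sum>k\<le>n. e k * c ^ k) \<in> J" by (elim exE conjE) (rule that)
  have e: "\<And>k. k \<le> n \<Longrightarrow> e k \<in> polys_in (N \<inter> V)" "\<exists>k\<le>n. e k \<noteq> 0"
    using e' by auto
  \<comment> \<open>Taking out the largest possible power of \<open>c\<close> leaves a cofactor
    \<open>s\<close> congruent to the regular \<open>e j\<close> modulo \<open>P\<close>, so
    \<open>s\<close> is outside \<open>P\<close>.\<close>
  define j where "j = (LEAST k. e k \<noteq> 0)"
  have j: "e j \<noteq> 0" "\<And>k. k < j \<Longrightarrow> e k = 0"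
    unfolding j_def using LeastI_ex[of "\<lambda>k. e k \<noteq> 0"] not_less_Least e(2) by auto
  have jn: "j \<le> n"
  proof -
    obtain k where "k \<le> n" "e k \<noteq> 0" using e(2) by blast
    then have "j \<le> k" unfolding j_def by (intro Least_le)
    then show ?thesis using \<open>k \<le> n\<close> by simp
  qed
  define s where "s = (\<Sum>k\<in>{j..n}. e k * c ^ (k - j))"
  have "(\<Sum>k\<le>n. e k * c ^ k) = (\<Sum>k\<in>{j..n}. e k * c ^ k)"
    by (rule sum.mono_neutral_right) (auto simp: j(2) not_le)
  also have "\<dots> = c ^ j * s"
    unfolding s_def sum_distrib_left by (intro sum.cong) (auto simp flip: power_add simp add: mult.left_commute)
  finally have cs: "c ^ j * s \<in> J" using e3 by simp
  have s_split: "s = e j + (\<Sum>k\<in>{Suc j..n}. e k * c ^ (k - j))"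
    unfolding s_def using jn by (simp add: sum.atLeast_Suc_atMost)
  have rest: "(\<Sum>k\<in>{Suc j..n}. e k * c ^ (k - j)) \<in> P"
  proof (intro P.J_sum P.J_mult)
    fix k assume "k \<in> {Suc j..n}"
    then have "c ^ (k - j) = c * c ^ (k - j - 1)" by (cases "k - j") auto
    then show "c ^ (k - j) \<in> P" using P.J_mult_right[OF cP] by simp
  qed
  have ejP: "e j \<notin> P"
    using e(1)[OF jn] j(1) by (intro essential_regular[OF P] regular_N) (auto simp: polys_in_def)
  have sP: "s \<notin> P" using ejP P.J_diff[OF _ rest, of s] unfolding s_split by auto
  have sV: "s \<in> polys_in V"
    unfolding s_def using e(1) cV polys_in_mono[of "N \<inter> V" V]
    by (intro polys_in_sum polys_in_mult polys_in_power) auto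
  \<comment> \<open>Both \<open>s\<close> and \<open>c\<close> have a coefficient in
    \<open>v\<close> outside the prime \<open>P\<close>, so \<open>c ^ j * s\<close> has one too.
    But \<open>v\<close> was assumed parametric, which puts all coefficients of this element of
    \<open>J\<close> into \<open>J\<close>.\<close>
  have "\<exists>i. coeff (upoly v s) i \<notin> P"
  proof (rule ccontr)
    assume *: "\<not> ?thesis"
    have "s = (\<Sum>k\<le>deg_in v s. coeff_in v k s * var v ^ k)"
      using poly_upoly[of v s] by (simp add: poly_altdef)
    also have "\<dots> \<in> P" using * by (intro P.J_sum P.J_mult_right) simp
    finally show False using sP by blast
  qed
  then obtain i where i: "coeff (upoly v s) i \<notin> P" by blast
  have "initial le c \<notin> P"
    using P.initial_regular[OF c, of 1] P.one_notin_J by auto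
  then have "coeff (upoly v c) (deg_in v c) \<notin> P" by (simp add: initial_def v_def)
  then obtain i' where "coeff (upoly v c ^ j) i' \<notin> P"
    using prime_ideal_poly_power[OF pr] by blast
  then obtain k where "coeff (upoly v c ^ j * upoly v s) k \<notin> P"
    using prime_ideal_poly_mult[OF pr _ i] by blast
  then have "coeff_in v k (c ^ j * s) \<notin> P" by (simp add: upoly_mult upoly_power flip: coeff_upoly)
  moreover have "c ^ j * s \<in> polys_in V" by (intro polys_in_mult polys_in_power cV sV)
  then have "coeff_in v k (c ^ j * s) \<in> J"
    using cs N_single[OF vN] unfolding V_def by (intro coeff_in_J)
  ultimately show False using essential_superset[OF P] by blast
qed

text \<open>Were the leader parametric for \<open>P\<close>, coefficient extraction in
  \<open>P\<close> would put the regular initial of \<open>a\<close> into \<open>P\<close>.\<close>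

lemma component_leader_derivative:
  assumes a: "a \<in> A"
  shows "leader le a \<notin> P.N"
proof
  assume u: "leader le a \<in> P.N"
  have "initial le a \<in> P"
    unfolding initial_def
  proof (rule P.coeff_in_J)
    show "a \<in> P" using a A_subset essential_superset[OF P] by blast
    show "a \<in> polys_in {v. le v (leader le a)}"
      using le_leader[OF vars_A[OF a]] by (auto simp: polys_in_def)
  qed (rule P.N_single[OF u])
  moreover have "regular (initial le a)" using initial_regular[OF a] by (auto simp: regular_def)
  ultimately show False using essential_regular[OF P] by blast
qed

text \<open>A leader of \<open>A\<close> is a derivative of a leader of \<open>C\<close>, which is a
  derivative of a leader of \<open>A\<close>. The composite operator is trivial because
  \<open>A\<close> is autoreduced, so both operators are.\<close>

lemma component_leaders_superset: "leader le ` A \<subseteq> leader le ` C"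
proof
  fix u assume "u \<in> leader le ` A"
  then obtain a where a: "a \<in> A" "u = leader le a" by blast
  obtain c \<theta> where c: "c \<in> C" "u = dapply \<theta> (leader le c)"
    using component_leader_derivative[OF a(1)] a(2) by (auto simp: P.N_def)
  obtain b \<theta>' where b: "b \<in> A" "leader le c = dapply \<theta>' (leader le b)"
    using component_leader_notin_N[OF c(1)] by (auto simp: N_def)
  have "leader le a = dapply (\<theta> + \<theta>') (leader le b)"
    using a(2) b(2) c(2) by (simp add: dapply_dapply)
  then have sum0: "\<theta> + \<theta>' = 0" using leader_no_proper_derivative[OF a(1) b(1)] by blast
  have "\<theta> = 0"
  proof (rule poly_mapping_eqI)
    fix i show "lookup \<theta> i = lookup 0 i"
      using arg_cong[OF sum0, of "\<lambda>m. lookup m i"] by (simp add: lookup_add)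
  qed
  then show "u \<in> leader le ` C" using c by simp
qed

lemma component_N: "P.N = N"
proof
  show "P.N \<subseteq> N"
  proof
    fix v assume v: "v \<in> P.N"
    have "v \<noteq> dapply \<theta> (leader le a)" if "a \<in> A" for a \<theta>
    proof -
      have "leader le a \<in> leader le ` C"
        by (rule subsetD[OF component_leaders_superset imageI[OF that]])
      then obtain c where "c \<in> C" "leader le a = leader le c" by (elim imageE)
      then show ?thesis using v by (auto simp: P.N_def)
    qed
    then show "v \<in> N" by (simp add: N_def)
  qed
  show "N \<subseteq> P.N"
  proof
    fix v assume v: "v \<in> N"
    have "v \<noteq> dapply \<theta> (leader le c)" if c: "c \<in> C" for c \<theta>
    proof -
      obtain b \<theta>' where "b \<in> A" "leader le c = dapply \<theta>' (leader le b)"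
        using component_leader_notin_N[OF c] by (auto simp: N_def)
      then show ?thesis using v by (auto simp: N_def dapply_dapply)
    qed
    then show "v \<in> P.N" by (simp add: P.N_def)
  qed
qed

end

end

section \<open>Replacing the elements of \<open>A\<close>\<close>

lemma coeff_in_cpart:
  assumes "u \<notin> S" "keys \<nu> \<subseteq> S"
  shows "coeff_in u d (cpart S \<nu> f) = cpart S \<nu> (coeff_in u d f)"
proof (rule poly_mapping_eqI)
  fix n
  have "lookup \<nu> u = 0" using assms by (auto simp: in_keys_iff)
  moreover have "keys (n + single u d) \<inter> S = keys n \<inter> S"
    using assms(1) by (auto simp: in_keys_iff lookup_add lookup_single when_def split: if_splits)
  ultimately show "lookup (coeff_in u d (cpart S \<nu> f)) n =
      lookup (cpart S \<nu> (coeff_in u d f)) n"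
    by (simp add: lookup_coeff_in lookup_cpart lookup_add ac_simps)
qed

lemma deg_in_cpart: "deg_in v (cpart S \<nu> f) \<le> deg_in v f"
proof (rule deg_in_le)
  fix n assume "lookup (cpart S \<nu> f) n \<noteq> 0"
  then have "lookup f (n + \<nu>) \<noteq> 0" by (auto simp: lookup_cpart split: if_splits)
  from lookup_le_deg_in[OF this, of v] show "lookup n v \<le> deg_in v f"
    by (simp add: lookup_add)
qed

context regular_set
begin

lemma leader_notin_N: "a \<in> A \<Longrightarrow> leader le a \<notin> N"
  unfolding N_def using dapply_0[of "leader le a"] by (metis (mono_tags, lifting) mem_Collect_eq)

text \<open>The power \<open>u ^ d\<close> together with the basis monomials below \<open>u\<close>
  is one element too many, so it satisfies a relation over k[N] modulo \<open>J\<close>. This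
  relation is \<open>b\<close>, and the coefficient of \<open>u ^ d\<close> is its initial.\<close>

lemma ex_parametric_initial:
  assumes a: "a \<in> A"
  shows "\<exists>b. b \<in> J \<and> vars b \<subseteq> N \<union> leader le ` A \<and> vars b \<subseteq> {v. le v (leader le a)} \<and>
    (\<forall>a'\<in>A. deg_in (leader le a') b < deg_in (leader le a') a' \<or> a' = a) \<and>
    deg_in (leader le a) b \<le> deg_in (leader le a) a \<and>
    vars (coeff_in (leader le a) (deg_in (leader le a) a) b) \<subseteq> N \<and>
    coeff_in (leader le a) (deg_in (leader le a) a) b \<noteq> 0"
proof -
  define u d V where "u = leader le a" and "d = deg_in u a" and "V = {v. le v u}"
  let ?top = "single u d"
  have d0: "0 < d" using deg_A_pos[OF a] by (simp add: d_def u_def)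
  have top: "?top \<notin> basis_mons V"
    using a lookup_single_eq[of u d] unfolding basis_mons_def redmon_def d_def u_def by fastforce
  have uN: "u \<notin> N" using leader_notin_N[OF a] by (simp add: u_def)
  let ?X = "insert ?top (basis_mons V)"
  have keys_X: "keys \<mu> \<subseteq> leader le ` A \<inter> V" if "\<mu> \<in> ?X" for \<mu>
    using that a by (auto simp: basis_mons_def u_def V_def split: if_splits)
  have "\<exists>e. (\<forall>\<mu>\<in>?X. e \<mu> \<in> polys_in (N \<inter> V)) \<and> (\<exists>\<mu>\<in>?X. e \<mu> \<noteq> 0) \<and> (\<Sum>\<mu>\<in>?X. e \<mu> * mon \<mu>) \<in> J"
  proof (rule algebraic_dependence)
    show "u \<in> V" if "w \<in> V" "le u w" for w u using that by (auto simp: V_def intro: le_trans)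
    show "card (basis_mons V) < card ?X" using top finite_basis_mons by simp
    show "mon \<mu> \<in> polys_in V" if "\<mu> \<in> ?X" for \<mu>
      using keys_X[OF that] by (intro polys_in_mon) auto
  qed (use finite_basis_mons in auto)
  then obtain e where e: "\<forall>\<mu>\<in>?X. e \<mu> \<in> polys_in (N \<inter> V)" "\<exists>\<mu>\<in>?X. e \<mu> \<noteq> 0"
    "(\<Sum>\<mu>\<in>?X. e \<mu> * mon \<mu>) \<in> J" by (elim exE conjE) (rule that)
  define r where "r = (\<Sum>\<mu>\<in>basis_mons V. e \<mu> * mon \<mu>)"
  define b where "b = e ?top * mon ?top + r"
  have bJ: "b \<in> J" using e(3) top finite_basis_mons by (simp add: b_def r_def)
  have eN: "vars (e \<mu>) \<subseteq> N" if "\<mu> \<in> ?X" for \<mu> using e(1) that by (auto simp: polys_in_def)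
  have "red r"
    unfolding r_def using eN by (intro red_sum red_N_mult red_mon) (auto simp: basis_mons_def)
  then have r: "deg_in (leader le a') r < deg_in (leader le a') a'" if "a' \<in> A" for a'
    using that by (simp add: red_def reduced_def)
  have eu: "u \<notin> vars (e \<mu>)" if "\<mu> \<in> ?X" for \<mu> using eN[OF that] uN by blast
  have "coeff_in u d (e ?top * mon ?top) = e ?top"
    using eu[of ?top] unfolding coeff_in_eq_cpart by (subst cpart_mult_mon) auto
  moreover have "coeff_in u d r = 0"
    using r[OF a] by (intro coeff_in_above_deg) (simp add: d_def u_def)
  ultimately have coeff: "coeff_in u d b = e ?top"
    by (simp add: b_def coeff_in_eq_cpart cpart_add)
  \<comment> \<open>Without the top term the relation would be a reduced element of
    \<open>J\<close>, hence zero, and all its coefficients would vanish.\<close>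
  have e_top: "e ?top \<noteq> 0"
  proof
    assume "e ?top = 0"
    then have "r \<in> J" using bJ by (simp add: b_def)
    then have r0: "r = 0" using \<open>red r\<close> red_eq_0 by blast
    have "e \<mu> = 0" if \<mu>: "\<mu> \<in> basis_mons V" for \<mu>
    proof -
      have "cpart (leader le ` A) \<mu> r = e \<mu>"
        unfolding r_def
      proof (rule cpart_sum_mon[OF finite_basis_mons _ _ \<mu>])
        fix \<nu> assume \<nu>: "\<nu> \<in> basis_mons V"
        show "vars (e \<nu>) \<inter> leader le ` A = {}" using leader_notin_N eN[of \<nu>] \<nu> by auto
        show "keys \<nu> \<subseteq> leader le ` A" using \<nu> by (simp add: basis_mons_def)
      qed
      then show ?thesis by (simp add: r0)
    qed
    then show False using e(2) \<open>e ?top = 0\<close> by auto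
  qed
  have deg_top: "deg_in v (e ?top * mon ?top) \<le> (if v = u then d else 0)" if "v \<notin> N" for v
  proof (rule deg_in_le)
    fix m assume "lookup (e ?top * mon ?top) m \<noteq> 0"
    then obtain p where p: "m = p + ?top" "lookup (e ?top) p \<noteq> 0"
      by (auto simp: lookup_mult_single exp_add_diff split: if_splits)
    have "v \<notin> vars (e ?top)" using eN[of ?top] that by blast
    then have "lookup p v = 0" using p(2) by (auto simp: in_vars_iff)
    then show "lookup m v \<le> (if v = u then d else 0)"
      by (auto simp: p(1) lookup_add lookup_single when_def)
  qed
  have deg_b: "deg_in v b \<le> max (deg_in v (e ?top * mon ?top)) (deg_in v r)" for v
  proof (rule deg_in_le)
    fix m assume "lookup b m \<noteq> 0"
    then have "lookup (e ?top * mon ?top) m \<noteq> 0 \<or> lookup r m \<noteq> 0"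
      by (auto simp: b_def lookup_add)
    then show "lookup m v \<le> max (deg_in v (e ?top * mon ?top)) (deg_in v r)"
      by (auto simp: le_max_iff_disj dest: lookup_le_deg_in)
  qed
  have deg1: "deg_in (leader le a') b < deg_in (leader le a') a'" if a': "a' \<in> A" "a' \<noteq> a" for a'
  proof -
    have "leader le a' \<noteq> u" using leader_inj[OF a'(1) a] a'(2) by (auto simp: u_def)
    then have "deg_in (leader le a') (e ?top * mon ?top) = 0"
      using deg_top[OF leader_notin_N[OF a'(1)]] by simp
    then show ?thesis using deg_b[of "leader le a'"] r[OF a'(1)] by simp
  qed
  have deg2: "deg_in u b \<le> d"
    using deg_b[of u] deg_top[OF uN] r[OF a] by (simp add: d_def u_def)
  have in_V: "(\<Sum>\<mu>\<in>?X. e \<mu> * mon \<mu>) \<in> polys_in (U :: ('d, 'y) dvar set)"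
    if "N \<inter> V \<subseteq> U" "leader le ` A \<inter> V \<subseteq> U" for U
  proof (intro polys_in_sum polys_in_mult)
    fix \<mu> assume \<mu>: "\<mu> \<in> ?X"
    show "e \<mu> \<in> polys_in U" using e(1) \<mu> that(1) polys_in_mono by blast
    show "mon \<mu> \<in> polys_in U" using keys_X[OF \<mu>] that(2) by (intro polys_in_mon) blast
  qed
  have "b = (\<Sum>\<mu>\<in>?X. e \<mu> * mon \<mu>)" using top finite_basis_mons by (simp add: b_def r_def)
  then have "vars b \<subseteq> N \<union> leader le ` A" "vars b \<subseteq> {v. le v u}"
    using in_V[of "N \<union> leader le ` A"] in_V[of V] by (auto simp: polys_in_def V_def)
  then show ?thesis
    using bJ coeff e_top eN[of ?top] deg1 deg2 unfolding u_def d_def by (intro exI[of _ b]) auto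
qed

definition replaces :: "('d, 'y, 'k) dpoly \<Rightarrow> ('d, 'y, 'k) dpoly \<Rightarrow> bool" where
  "replaces b a \<longleftrightarrow> b \<in> J \<and> vars b \<noteq> {} \<and> rank le b = rank le a \<and>
    (\<forall>a'\<in>A. a' \<noteq> a \<longrightarrow> reduced le b a') \<and> regular (initial le b) \<and> regular (separant le b)"

text \<open>The leading terms cancel in \<open>g\<close>, the difference of \<open>a\<close> and
  \<open>b\<close> cross-multiplied by initials, so its coefficients lie in \<open>J\<close> and so
  does its derivative by \<open>u\<close>. Hence I_a S_b is congruent to I_b S_a modulo
  \<open>J\<close>, and I_b S_a is regular.\<close>

lemma separant_regular_of_initial:
  assumes a: "a \<in> A" and b: "b \<in> J" "vars b \<subseteq> {v. le v (leader le a)}" "rank le b = rank le a"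
    and init: "regular (initial le b)"
  shows "regular (separant le b)"
proof -
  define u d where "u = leader le a" and "d = deg_in u a"
  have u: "leader le b = u" "deg_in u b = d" using b(3) by (auto simp: rank_def u_def d_def)
  let ?Ia = "initial le a" and ?Ib = "initial le b"
  have Ia: "?Ia = coeff_in u d a" and Ib: "?Ib = coeff_in u d b"
    by (simp_all add: initial_def u) (simp add: u_def d_def)
  have free: "u \<notin> vars ?Ia" "u \<notin> vars ?Ib" unfolding Ia Ib by (rule coeff_in_free)+
  define g where "g = ?Ia * b - ?Ib * a"
  have gJ: "g \<in> J" unfolding g_def using A_subset a b(1) by (intro J_diff J_mult) auto
  have bV: "b \<in> polys_in {v. le v u}" "a \<in> polys_in {v. le v u}"
    using b(2) le_leader[OF vars_A[OF a]] by (auto simp: polys_in_def u_def)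
  then have "?Ia \<in> polys_in {v. le v u}" "?Ib \<in> polys_in {v. le v u}"
    unfolding Ia Ib using vars_coeff_in[of u d a] vars_coeff_in[of u d b] by (auto simp: polys_in_def)
  then have gV: "g \<in> polys_in {v. le v u}"
    unfolding g_def using bV by (intro polys_in_diff polys_in_mult)
  have coeff_g: "coeff_in u k g = ?Ia * coeff_in u k b - ?Ib * coeff_in u k a" for k
  proof -
    have "coeff (upoly u g) k = ?Ia * coeff_in u k b - ?Ib * coeff_in u k a"
      by (simp add: g_def upoly_diff upoly_mult upoly_free[OF free(1)] upoly_free[OF free(2)])
    then show ?thesis by simp
  qed
  have "coeff_in u k g = 0" if "d \<le> k" for k
  proof (cases "k = d")
    case True
    then show ?thesis unfolding coeff_g by (simp add: Ia Ib)
  next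
    case False
    then show ?thesis unfolding coeff_g using that u(2) by (simp add: coeff_in_above_deg d_def)
  qed
  then have "deg_in u g < d \<or> g = 0" using coeff_in_deg_nonzero[of g u] by (meson not_le)
  then have "deg_in u g < d"
    using deg_A_pos[OF a] by (auto simp: deg_in_def u_def d_def)
  then have "redmon (single u (deg_in u g))"
    unfolding u_def d_def by (rule redmon_leader[OF a])
  then have "coeff_in u k g \<in> J" for k by (rule coeff_in_J[OF gJ gV])
  then have "pdiff u g \<in> J" by (rule pdiff_in_J)
  moreover have "pdiff u (f - f') = pdiff u f - pdiff u f'" for f f' :: "('d, 'y, 'k) dpoly"
    using pdiff_add[of u "f - f'" f'] by simp
  then have "pdiff u g = ?Ia * separant le b - ?Ib * separant le a"
    by (simp add: g_def pdiff_mult pdiff_free[OF free(1)] pdiff_free[OF free(2)] separant_def u) (simp add: u_def)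
  ultimately have eq: "?Ia * separant le b - ?Ib * separant le a \<in> J" by simp
  show ?thesis unfolding regular_def
  proof (intro allI impI)
    fix f assume f: "separant le b * f \<in> J"
    have "?Ib * (separant le a * f) = ?Ia * (separant le b * f) - (?Ia * separant le b - ?Ib * separant le a) * f"
      by (simp add: algebra_simps)
    also have "\<dots> \<in> J" by (rule J_diff[OF J_mult[OF f] J_mult_right[OF eq]])
    finally have "separant le a * f \<in> J" using init unfolding regular_def by blast
    then show "f \<in> J" using separant_regular[OF a] by blast
  qed
qed

lemma replacesI:
  assumes a: "a \<in> A" and b: "b \<in> J" "vars b \<subseteq> N \<union> leader le ` A" "vars b \<subseteq> {v. le v (leader le a)}"
    "deg_in (leader le a) b = deg_in (leader le a) a"
    "\<And>a'. a' \<in> A \<Longrightarrow> a' \<noteq> a \<Longrightarrow> deg_in (leader le a') b < deg_in (leader le a') a'"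
    and init: "regular (coeff_in (leader le a) (deg_in (leader le a) a) b)"
  shows "replaces b a"
proof -
  have u: "leader le a \<in> vars b" using deg_A_pos[OF a] b(4) deg_in_eq_0_iff[of "leader le a" b] by auto
  then have lead: "leader le b = leader le a" using b(3) by (intro leader_eqI) auto
  then have rank: "rank le b = rank le a" by (simp add: rank_def b(4))
  have init': "regular (initial le b)" using init by (simp add: initial_def lead b(4))
  have "reduced le b a'" if a': "a' \<in> A" "a' \<noteq> a" for a'
    unfolding reduced_def
  proof (intro conjI allI impI)
    fix \<theta> :: "'d \<Rightarrow>\<^sub>0 nat" assume \<theta>: "\<theta> \<noteq> 0"
    have "dapply \<theta> (leader le a') \<notin> N" using a'(1) by (auto simp: N_def)
    moreover have "dapply \<theta> (leader le a') \<notin> leader le ` A"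
      using leader_no_proper_derivative[OF _ a'(1), of _ \<theta>] \<theta> by fastforce
    ultimately show "dapply \<theta> (leader le a') \<notin> vars b" using b(2) by blast
  qed (rule b(5)[OF a'])
  then show ?thesis
    using b(1) u rank init' separant_regular_of_initial[OF a b(1,3) rank init']
    by (auto simp: replaces_def)
qed

section \<open>Replacements inside a set \<open>W\<close> of variables, later those of bounded
  order\<close>

context
  fixes W :: "('d, 'y) dvar set"
  assumes W: "\<And>P. P \<in> essential_prime_components D J \<Longrightarrow>
    \<exists>C. regular_set D le P C \<and> (\<forall>c\<in>C. vars c \<subseteq> W)"
begin

lemma leaders_in_W: "leader le ` A \<subseteq> W"
proof -
  obtain P where P: "P \<in> essential_prime_components D J" using essential_nonempty by blast
  then obtain C where C: "regular_set D le P C" "\<And>c. c \<in> C \<Longrightarrow> vars c \<subseteq> W" using W by blast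
  interpret P: regular_set D le P C by (rule C)
  have "leader le ` C \<subseteq> W" using C(2) leader_in_vars[OF P.vars_A] by blast
  then show ?thesis using component_leaders_superset[OF P C(1)] by blast
qed

text \<open>As \<open>J\<close> is radical, membership can be tested in each essential component.
  There reduction by \<open>C\<close>, whose variables lie in \<open>W\<close>, brings in no
  variable of \<open>N - W\<close>, so monomials in \<open>N - W\<close> can be split off.\<close>

lemma cpart_in_J:
  assumes f: "f \<in> J" "vars f \<subseteq> N \<union> leader le ` A" and \<nu>: "keys \<nu> \<subseteq> N - W"
  shows "cpart (N - W) \<nu> f \<in> J"
proof (rule ccontr)
  let ?S = "N - W"
  assume "cpart ?S \<nu> f \<notin> J"
  then obtain P where P: "P \<in> essential_prime_components D J" "cpart ?S \<nu> f \<notin> P"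
    using radical_essential_prime_component[OF differential_ideal_J radical] by blast
  then obtain C where C: "regular_set D le P C" "\<And>c. c \<in> C \<Longrightarrow> vars c \<subseteq> W" using W by blast
  interpret P: regular_set D le P C by (rule C)
  have NP: "P.N = N" by (rule component_N[OF P(1) C(1)])
  \<comment> \<open>The variables of \<open>C\<close> are parametric ones in \<open>W\<close> or
    leaders, because \<open>C\<close> is autoreduced; this makes \<open>V\<close> admissible for
    \<open>P\<close>.\<close>
  define V where "V = P.N \<inter> W \<union> leader le ` C"
  have adm: "P.admissible V"
    unfolding P.admissible_def
  proof
    fix w assume "w \<in> V"
    moreover have "vars c \<subseteq> V" if c: "c \<in> C" for c
    proof
      fix v assume v: "v \<in> vars c"
      have "v \<noteq> dapply \<theta> (leader le b)" if b: "b \<in> C" "\<theta> \<noteq> 0" for b \<theta>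
      proof (cases "b = c")
        case True
        then have "lt (leader le c) (dapply \<theta> (leader le b))" using lt_dapply b(2) by simp
        then show ?thesis using le_leader[OF P.vars_A[OF c] v] by (auto simp flip: not_lt_iff)
      next
        case False
        then show ?thesis using P.reduced_A[OF c b(1)] b(2) v by (auto simp: reduced_def)
      qed
      then show "v \<in> V" using P.in_N_or[of v] v C(2)[OF c] by (auto simp: V_def)
    qed
    ultimately show "w \<in> P.N \<or> (\<exists>a\<in>C. w = leader le a \<and> vars a \<subseteq> V) \<or>
        (\<exists>a\<in>C. \<exists>\<theta>. \<theta> \<noteq> 0 \<and> w = dapply \<theta> (leader le a) \<and> {v. le v w} \<subseteq> V)"
      by (auto simp: V_def)
  qed
  define M where "M = insert \<nu> (restr ?S ` keys f)"
  have keys_M: "keys \<mu> \<subseteq> ?S" if "\<mu> \<in> M" for \<mu>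
    using that \<nu> by (auto simp: M_def keys_restr)
  have L: "leader le ` C \<subseteq> W" using C(2) leader_in_vars[OF P.vars_A] by blast
  have "cpart ?S \<nu> f \<in> P"
  proof (rule P.coeffs_in_J)
    show "finite M" "\<nu> \<in> M" by (auto simp: M_def)
    have "f = (\<Sum>\<mu>\<in>M. cpart ?S \<mu> f * mon \<mu>)"
      using keys_M by (intro cpart_expansion) (auto simp: M_def)
    then show "(\<Sum>\<mu>\<in>M. cpart ?S \<mu> f * mon \<mu>) \<in> P" using f(1) essential_superset[OF P(1)] by auto
    fix \<mu> assume "\<mu> \<in> M"
    then have k: "keys \<mu> \<subseteq> ?S" by (rule keys_M)
    then show "P.redmon \<mu>" by (intro P.redmon_N) (auto simp: NP)
    have "V \<subseteq> W" using L by (auto simp: V_def)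
    then show "keys \<mu> \<inter> V = {}" using k by blast
    show "cpart ?S \<mu> f \<in> polys_in V"
      using vars_cpart[of ?S \<mu> f] f(2) component_leaders_superset[OF P(1) C(1)]
      unfolding polys_in_def V_def NP by blast
  qed (rule adm)
  then show False using P(2) by blast
qed

lemma ex_replacement:
  assumes a: "a \<in> A"
  shows "\<exists>b. replaces b a \<and> vars b \<subseteq> W"
proof -
  define u d S where "u = leader le a" and "d = deg_in u a" and "S = N - W"
  obtain b where b: "b \<in> J" "vars b \<subseteq> N \<union> leader le ` A" "vars b \<subseteq> {v. le v u}"
    "\<And>a'. a' \<in> A \<Longrightarrow> a' \<noteq> a \<Longrightarrow> deg_in (leader le a') b < deg_in (leader le a') a'"
    "deg_in u b \<le> d" "vars (coeff_in u d b) \<subseteq> N" "coeff_in u d b \<noteq> 0"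
    using ex_parametric_initial[OF a] unfolding u_def d_def by blast
  let ?c = "coeff_in u d b"
  have uS: "u \<notin> S" using leaders_in_W a by (auto simp: S_def u_def)
  \<comment> \<open>Some \<nu> occurs already in the coefficient of \<open>u ^ d\<close>; taking the
    part of \<open>b\<close> at this \<nu> preserves the rank, since \<open>u\<close> itself is not
    among the removed variables.\<close>
  have "\<exists>\<nu>. keys \<nu> \<subseteq> S \<and> cpart S \<nu> ?c \<noteq> 0"
  proof (rule ccontr)
    assume *: "\<not> ?thesis"
    have "?c = (\<Sum>\<mu>\<in>restr S ` keys ?c. cpart S \<mu> ?c * mon \<mu>)"
      by (rule cpart_expansion) (auto simp: keys_restr)
    also have "\<dots> = 0" using * by (intro sum.neutral) (auto simp: keys_restr)
    finally show False using b(7) by simp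
  qed
  then obtain \<nu> where \<nu>: "keys \<nu> \<subseteq> S" "cpart S \<nu> ?c \<noteq> 0" by blast
  define g where "g = cpart S \<nu> b"
  have coeff: "coeff_in u d g = cpart S \<nu> ?c"
    unfolding g_def by (rule coeff_in_cpart[OF uS \<nu>(1)])
  have vars_g: "vars g \<subseteq> vars b - S" unfolding g_def by (rule vars_cpart)
  have deg_g: "deg_in v g \<le> deg_in v b" for v unfolding g_def by (rule deg_in_cpart)
  have "replaces g a"
  proof (rule replacesI[OF a])
    show "g \<in> J" unfolding g_def S_def using b(1,2) \<nu>(1) by (intro cpart_in_J) (auto simp: S_def)
    show "vars g \<subseteq> N \<union> leader le ` A" "vars g \<subseteq> {v. le v (leader le a)}"
      using vars_g b(2,3) by (auto simp: u_def)
    have "\<not> deg_in u g < d" using coeff \<nu>(2) coeff_in_above_deg[of u g d] by auto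
    then show "deg_in (leader le a) g = deg_in (leader le a) a"
      using deg_g[of u] b(5) by (simp add: u_def d_def)
    show "deg_in (leader le a') g < deg_in (leader le a') a'" if "a' \<in> A" "a' \<noteq> a" for a'
      using deg_g[of "leader le a'"] b(4)[OF that] by simp
    have "vars (cpart S \<nu> ?c) \<subseteq> N" using vars_cpart[of S \<nu> ?c] b(6) by blast
    then have "regular (coeff_in u d g)" unfolding coeff using \<nu>(2) by (rule regular_N)
    then show "regular (coeff_in (leader le a) (deg_in (leader le a) a) g)" by (simp add: u_def d_def)
  qed
  moreover have "vars g \<subseteq> W" using vars_g b(2) leaders_in_W by (auto simp: S_def)
  ultimately show ?thesis by blast
qed

end

end

subsection \<open>Characteristic sets\<close>

lemma (in ranked) rank_less_cases: "rank_less le r s \<or> r = s \<or> rank_less le s r"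
  using le_total[of "fst r" "fst s"] by (cases "fst r = fst s") (auto simp: rank_less_def prod_eq_iff)

text \<open>A reduced element could be inserted into the characteristic set, dropping the elements of higher
  rank; this would lower the rank.\<close>

lemma (in ranked) characteristic_set_reduced:
  fixes A :: "('d, 'y, 'k::comm_ring_1) dpoly list"
  assumes A: "characteristic_set le I A" and f: "f \<in> I" "vars f \<noteq> {}"
  shows "\<exists>a\<in>set A. \<not> reduced le f a"
proof (rule ccontr)
  assume "\<not> ?thesis"
  then have red: "\<And>a. a \<in> set A \<Longrightarrow> reduced le f a" by blast
  have auto_A: "autoreduced le (set A)" "sorted_wrt (\<lambda>f g. rank_less le (rank le f) (rank le g)) A"
    "set A \<subseteq> I" using A by (auto simp: characteristic_set_def autoreduced_list_def)
  \<comment> \<open>\<open>f\<close> takes the place of the first element whose rank is not lower;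
    being reduced, it cannot have the same rank.\<close>
  define T where "T = takeWhile (\<lambda>a. rank_less le (rank le a) (rank le f)) A"
  define B where "B = T @ [f]"
  have T_sub: "set T \<subseteq> set A" unfolding T_def using set_takeWhileD by force
  have T_less: "rank_less le (rank le a) (rank le f)" if "a \<in> set T" for a
    using that set_takeWhileD unfolding T_def by fastforce
  have red_T: "reduced le a f" if a: "a \<in> set T" for a
  proof -
    have "leader le a \<noteq> leader le f"
      using T_less[OF a] red[of a] T_sub a by (auto simp: rank_less_def rank_def reduced_def)
    then have lt: "lt (leader le a) (leader le f)"
      using T_less[OF a] by (auto simp: rank_less_def rank_def lt_def)
    have va: "vars a \<noteq> {}" using auto_A(1) T_sub a by (auto simp: autoreduced_def)
    have notin: "w \<notin> vars a" if "le (leader le f) w" for w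
      using le_leader[OF va, of w] lt_le_trans[OF lt that] by (auto simp flip: not_lt_iff)
    have "deg_in (leader le f) a = 0" using notin[of "leader le f"] by (simp add: deg_in_eq_0_iff)
    then show ?thesis
      unfolding reduced_def using notin le_dapply deg_in_leader_pos[OF f(2)] by simp
  qed
  have "autoreduced_list le B"
    unfolding autoreduced_list_def
  proof
    have "reduced le g g'" if "g \<in> set T" "g' \<in> set T" "g \<noteq> g'" for g g'
      using auto_A(1) T_sub that unfolding autoreduced_def by blast
    moreover have "vars g \<noteq> {}" "reduced le f g" if "g \<in> set T" for g
      using auto_A(1) T_sub red that unfolding autoreduced_def by blast+
    ultimately show "autoreduced le (set B)"
      using f(2) red_T by (simp add: autoreduced_def B_def)
    have "sorted_wrt (\<lambda>f g. rank_less le (rank le f) (rank le g)) T"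
      unfolding T_def by (subst takeWhile_eq_take) (rule sorted_wrt_take[OF auto_A(2)])
    then show "sorted_wrt (\<lambda>f g. rank_less le (rank le f) (rank le g)) B"
      using T_less by (auto simp: B_def sorted_wrt_append)
  qed
  moreover have "set B \<subseteq> I" using T_sub auto_A(3) f(1) by (auto simp: B_def)
  moreover have "lower_rank le B A"
  \<comment> \<open>Either the rank drops at the position of \<open>f\<close>, or \<open>f\<close>
    is appended to all of \<open>A\<close> and a longer list with the same initial ranks is
    lower.\<close>
  proof (cases "length T < length A")
    case True
    let ?a = "A ! length T"
    have "\<not> rank_less le (rank le ?a) (rank le f)"
      using nth_length_takeWhile[of _ A] True unfolding T_def by blast
    moreover have "rank le ?a \<noteq> rank le f"
      using red[of ?a] True by (auto simp: rank_def reduced_def)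
    ultimately have "rank_less le (rank le f) (rank le ?a)" using rank_less_cases by blast
    moreover have "B ! i = A ! i" if "i < length T" for i
      using that by (simp add: B_def nth_append T_def takeWhile_nth)
    ultimately show ?thesis
      unfolding lower_rank_def using True
      by (intro disjI1 exI[of _ "length T"]) (auto simp: B_def)
  next
    case False
    then have "T = A" unfolding T_def using length_takeWhile_le[of _ A] by (metis le_antisym not_less takeWhile_eq_take take_all_iff)
    then show ?thesis by (auto simp: lower_rank_def B_def nth_append)
  qed
  ultimately show False using A by (auto simp: characteristic_set_def)
qed

text \<open>Minimality depends on ranks alone, and being reduced with respect to
  \<open>\<phi> a'\<close> depends only on the rank it shares with \<open>a'\<close>.\<close>

lemma (in ranked) characteristic_set_map:
  fixes A :: "('d, 'y, 'k::comm_ring_1) dpoly list"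
  assumes A: "characteristic_set le I A"
    and \<phi>: "\<And>a. a \<in> set A \<Longrightarrow> \<phi> a \<in> I" "\<And>a. a \<in> set A \<Longrightarrow> vars (\<phi> a) \<noteq> {}"
      "\<And>a. a \<in> set A \<Longrightarrow> rank le (\<phi> a) = rank le a"
      "\<And>a a'. a \<in> set A \<Longrightarrow> a' \<in> set A \<Longrightarrow> a \<noteq> a' \<Longrightarrow> reduced le (\<phi> a) a'"
  shows "characteristic_set le I (map \<phi> A)"
proof -
  have sorted: "sorted_wrt (\<lambda>f g. rank_less le (rank le f) (rank le g)) A"
    using A by (simp add: characteristic_set_def autoreduced_list_def)
  have ranks: "rank le (map \<phi> A ! i) = rank le (A ! i)" if "i < length A" for i
    using that \<phi>(3) by simp
  have "reduced le (\<phi> a) (\<phi> a')" if "a \<in> set A" "a' \<in> set A" "\<phi> a \<noteq> \<phi> a'" for a a'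
  proof -
    have "reduced le (\<phi> a) a'" using that by (intro \<phi>(4)) auto
    moreover have "leader le (\<phi> a') = leader le a'" "deg_in (leader le a') (\<phi> a') = deg_in (leader le a') a'"
      using \<phi>(3)[OF that(2)] by (auto simp: rank_def)
    ultimately show ?thesis by (simp add: reduced_def)
  qed
  then have "autoreduced le (set (map \<phi> A))" using \<phi>(2) by (auto simp: autoreduced_def)
  moreover have "sorted_wrt (\<lambda>f g. rank_less le (rank le f) (rank le g)) (map \<phi> A)"
    using sorted \<phi>(3) unfolding sorted_wrt_map
    by (rule_tac sorted_wrt_mono_rel[rotated]) auto
  moreover have "set (map \<phi> A) \<subseteq> I" using \<phi>(1) by auto
  moreover have "\<not> lower_rank le B (map \<phi> A)" if "autoreduced_list le B" "set B \<subseteq> I" for B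
  proof
    assume "lower_rank le B (map \<phi> A)"
    then have "lower_rank le B A"
      unfolding lower_rank_def length_map
    proof (elim disjE exE conjE)
      fix j assume j: "j < length B" "j < length A" "\<forall>i<j. rank le (B ! i) = rank le (map \<phi> A ! i)"
        "rank_less le (rank le (B ! j)) (rank le (map \<phi> A ! j))"
      then show "(\<exists>j<length B. j < length A \<and> (\<forall>i<j. rank le (B ! i) = rank le (A ! i)) \<and>
          rank_less le (rank le (B ! j)) (rank le (A ! j))) \<or>
        length A < length B \<and> (\<forall>i<length A. rank le (B ! i) = rank le (A ! i))"
        using ranks by (intro disjI1 exI[of _ j]) auto
    next
      assume "length A < length B" "\<forall>i<length A. rank le (B ! i) = rank le (map \<phi> A ! i)"
      then show "(\<exists>j<length B. j < length A \<and> (\<forall>i<j. rank le (B ! i) = rank le (A ! i)) \<and>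
          rank_less le (rank le (B ! j)) (rank le (A ! j))) \<or>
        length A < length B \<and> (\<forall>i<length A. rank le (B ! i) = rank le (A ! i))"
        using ranks by auto
    qed
    then show False using A that by (auto simp: characteristic_set_def)
  qed
  ultimately show ?thesis by (auto simp: characteristic_set_def autoreduced_list_def)
qed

subsection \<open>Saturation\<close>

lemma saturationI: "H ^ n * a \<in> G \<Longrightarrow> a \<in> saturation G H"
  by (auto simp: saturation_def)

lemma saturation_dvd:
  assumes G: "ideal G" and x: "x dvd H" "x * f \<in> saturation G H"
  shows "f \<in> saturation G H"
proof -
  obtain y where y: "H = x * y" using x(1) by (auto simp: dvd_def)
  obtain m where "H ^ m * (x * f) \<in> G" using x(2) by (auto simp: saturation_def)
  then have "y * (H ^ m * (x * f)) \<in> G" by (rule ideal_mult[OF G])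
  moreover have "y * (H ^ m * (x * f)) = H ^ Suc m * f" by (simp add: y ac_simps)
  ultimately show ?thesis by (intro saturationI[of H "Suc m"]) simp
qed

lemma (in diff_field) differential_ideal_saturation:
  fixes G :: "('d, 'y, 'k) dpoly set"
  assumes G: "differential_ideal D G"
  shows "differential_ideal D (saturation G H)"
proof -
  have id: "ideal G" and dG: "\<And>i f. f \<in> G \<Longrightarrow> pderivation D i f \<in> G"
    using G by (auto simp: differential_ideal_iff)
  have "ideal (saturation G H)"
    unfolding ideal_iff
  proof (intro conjI ballI allI)
    show "0 \<in> saturation G H" using ideal_0[OF id] by (simp add: saturation_def)
  next
    fix x y assume "x \<in> saturation G H" "y \<in> saturation G H"
    then obtain m n where "H ^ m * x \<in> G" "H ^ n * y \<in> G" by (auto simp: saturation_def)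
    then have "H ^ n * (H ^ m * x) + H ^ m * (H ^ n * y) \<in> G"
      using ideal_add[OF id] ideal_mult[OF id] by blast
    moreover have "H ^ n * (H ^ m * x) + H ^ m * (H ^ n * y) = H ^ (m + n) * (x + y)"
      by (simp add: power_add algebra_simps)
    ultimately show "x + y \<in> saturation G H" by (auto intro: saturationI)
  next
    fix c x assume "x \<in> saturation G H"
    then obtain m where "H ^ m * x \<in> G" by (auto simp: saturation_def)
    then have "c * (H ^ m * x) \<in> G" by (rule ideal_mult[OF id])
    then show "c * x \<in> saturation G H" by (intro saturationI[of H m]) (simp add: mult.left_commute)
  qed
  moreover have "pderivation D i a \<in> saturation G H" if a: "a \<in> saturation G H" for i a
  proof -
    obtain m where m: "H ^ m * a \<in> G" using a unfolding saturation_def by blast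
    \<comment> \<open>The derivative of a power of \<open>H\<close> loses at most one factor
      \<open>H\<close>, so one additional factor compensates.\<close>
    have "\<exists>t. H * pderivation D i (H ^ m) = t * H ^ m"
    proof (induction m)
      case 0
      show ?case by (intro exI[of _ 0]) simp
    next
      case (Suc m)
      then obtain t where t: "H * pderivation D i (H ^ m) = t * H ^ m" by blast
      have "H * pderivation D i (H ^ Suc m) = (pderivation D i H + t) * H ^ Suc m"
        by (simp add: pderivation_mult distrib_left distrib_right t ac_simps)
      then show ?case by blast
    qed
    then obtain t where t: "H * pderivation D i (H ^ m) = t * H ^ m" by blast
    have "H ^ Suc m * pderivation D i a = H * pderivation D i (H ^ m * a) - (H * pderivation D i (H ^ m)) * a"
      by (simp add: pderivation_mult algebra_simps)
    also have "\<dots> = H * pderivation D i (H ^ m * a) - t * (H ^ m * a)" by (simp add: t mult.assoc)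
    also have "\<dots> \<in> G" by (rule ideal_diff[OF id ideal_mult[OF id dG[OF m]] ideal_mult[OF id m]])
    finally show ?thesis by (rule saturationI)
  qed
  ultimately show ?thesis by (simp add: differential_ideal_iff)
qed

lemma differential_ideal_differential_ideal_gen: "differential_ideal D (differential_ideal_gen D F)"
  unfolding differential_ideal_iff differential_ideal_gen_def ideal_iff by blast

lemma subset_differential_ideal_gen: "F \<subseteq> differential_ideal_gen D F"
  unfolding differential_ideal_gen_def by blast

lemma differential_ideal_gen_least: "differential_ideal D I \<Longrightarrow> F \<subseteq> I \<Longrightarrow> differential_ideal_gen D F \<subseteq> I"
  unfolding differential_ideal_gen_def by blast

lemma init_sep_prod_dvd:
  assumes "f \<in> set A"
  shows "initial le f dvd init_sep_prod le A" "separant le f dvd init_sep_prod le A"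
proof -
  have "initial le f * separant le f dvd init_sep_prod le A"
    unfolding init_sep_prod_def using assms by (intro dvd_prodI) auto
  then show "initial le f dvd init_sep_prod le A" "separant le f dvd init_sep_prod le A"
    by (auto intro: dvd_mult_left dvd_mult_right)
qed

section \<open>Regular sets obtained from characteristic sets\<close>

lemma ideal_const_zero:
  fixes I :: "('d, 'y, 'k::field) dpoly set"
  assumes I: "ideal I" "f \<in> I" "I \<noteq> UNIV" and "vars f = {}"
  shows "f = 0"
proof (rule ccontr)
  assume "f \<noteq> 0"
  obtain c where c: "f = const c" using vars_empty_imp_const[OF assms(4)] by blast
  then have "inverse c * c = 1" using \<open>f \<noteq> 0\<close> by (intro left_inverse) auto
  then have "const (inverse c) * f = 1" by (simp add: c mult_single)
  then have "1 \<in> I" using ideal_mult[OF I(1,2), of "const (inverse c)"] by simp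
  then show False using I(3) ideal_UNIV_iff[OF I(1)] by blast
qed

text \<open>By minimality a reduced element of \<open>I\<close> is a constant, and a proper ideal
  contains no nonzero constant. Initials and separants divide the element saturated by, so they can
  be cancelled.\<close>

lemma regular_set_characterizes:
  fixes D :: "'d::finite \<Rightarrow> 'k::field_char_0 \<Rightarrow> 'k" and le :: "('d, 'y::finite) dvar \<Rightarrow> ('d, 'y) dvar \<Rightarrow> bool"
  assumes D: "differential_field D" and le: "ranking le"
    and I: "differential_ideal D I" "I \<noteq> UNIV" and A: "characterizes D le A I"
  shows "regular_set D le I (set A)"
proof -
  interpret diff_field_char_0 D by unfold_locales (rule D)
  interpret ranked le by unfold_locales (rule le)
  have id: "ideal I" using I(1) by (simp add: differential_ideal_iff)
  have cs: "characteristic_set le I A" and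
    sat: "I = saturation (differential_ideal_gen D (set A)) (init_sep_prod le A)"
    using A by (auto simp: characterizes_def)
  have gen: "ideal (differential_ideal_gen D (set A))"
    using differential_ideal_differential_ideal_gen[of D "set A"] by (simp add: differential_ideal_iff)
  show ?thesis
  proof
    show "f = 0" if f: "f \<in> I" "\<And>a. a \<in> set A \<Longrightarrow> reduced le f a" for f
    proof (rule ccontr)
      assume "f \<noteq> 0"
      have "vars f = {}" using characteristic_set_reduced[OF cs f(1)] f(2) by blast
      then show False using I(2) \<open>f \<noteq> 0\<close> ideal_const_zero[OF id f(1)] by blast
    qed
    show "f \<in> I" if "a \<in> set A" "initial le a * f \<in> I" for a f
      using saturation_dvd[OF gen init_sep_prod_dvd(1)[OF that(1)]] that(2) sat by blast
    show "f \<in> I" if "a \<in> set A" "separant le a * f \<in> I" for a f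
      using saturation_dvd[OF gen init_sep_prod_dvd(2)[OF that(1)]] that(2) sat by blast
  qed (use I cs in \<open>auto simp: characteristic_set_def autoreduced_list_def\<close>)
qed

text \<open>Initials and separants of a characteristic set are nonzero and themselves reduced, hence
  outside \<open>P\<close>; primality makes them regular.\<close>

lemma regular_set_prime:
  fixes D :: "'d::finite \<Rightarrow> 'k::field_char_0 \<Rightarrow> 'k" and le :: "('d, 'y::finite) dvar \<Rightarrow> ('d, 'y) dvar \<Rightarrow> bool"
  assumes D: "differential_field D" and le: "ranking le"
    and P: "prime_differential_ideal D P" and C: "characteristic_set le P C"
  shows "regular_set D le P (set C)"
proof -
  interpret diff_field_char_0 D by unfold_locales (rule D)
  interpret ranked le by unfold_locales (rule le)
  have pr: "prime_ideal P" and dP: "differential_ideal D P"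
    using P by (auto simp: prime_differential_ideal_iff prime_ideal_def differential_ideal_iff)
  have id: "ideal P" using pr by (simp add: prime_ideal_def)
  have auto: "autoreduced le (set C)" "set C \<subseteq> P"
    using C by (auto simp: characteristic_set_def autoreduced_list_def)
  have zero: "f = 0" if f: "f \<in> P" "\<And>a. a \<in> set C \<Longrightarrow> reduced le f a" for f
  proof (rule ccontr)
    assume "f \<noteq> 0"
    have "vars f = {}" using characteristic_set_reduced[OF C f(1)] f(2) by blast
    then show False using pr \<open>f \<noteq> 0\<close> ideal_const_zero[OF id f(1)] by (simp add: prime_ideal_def)
  qed
  have reduced: "reduced le g a"
    if c: "c \<in> set C" and a: "a \<in> set C" and g: "vars g \<subseteq> vars c" "\<And>v. deg_in v g \<le> deg_in v c"
      "deg_in (leader le c) g < deg_in (leader le c) c" for c a and g :: "('d, 'y, 'k) dpoly"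
  proof (cases "a = c")
    case True
    have vc: "vars c \<noteq> {}" using auto(1) c by (simp add: autoreduced_def)
    have "dapply \<theta> (leader le c) \<notin> vars c" if "\<theta> \<noteq> 0" for \<theta>
      using le_leader[OF vc, of "dapply \<theta> (leader le c)"] lt_dapply[OF that, of "leader le c"]
      by (auto simp flip: not_lt_iff)
    then show ?thesis using g True by (auto simp: reduced_def)
  next
    case False
    then have "reduced le c a" using auto(1) c a by (auto simp: autoreduced_def)
    then show ?thesis using g(1) g(2)[of "leader le a"] unfolding reduced_def by fastforce
  qed
  have initial: "initial le c \<notin> P" if c: "c \<in> set C" for c
  proof
    assume inP: "initial le c \<in> P"
    have vc: "vars c \<noteq> {}" using auto(1) c by (simp add: autoreduced_def)
    have "deg_in v (initial le c) \<le> deg_in v c" for v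
    proof (rule deg_in_le)
      fix m assume "lookup (initial le c) m \<noteq> 0"
      then have "lookup c (m + single (leader le c) (deg_in (leader le c) c)) \<noteq> 0"
        by (auto simp: initial_def lookup_coeff_in split: if_splits)
      from lookup_le_deg_in[OF this, of v] show "lookup m v \<le> deg_in v c"
        by (simp add: lookup_add)
    qed
    moreover have "deg_in (leader le c) (initial le c) = 0"
      using vars_initial[of c] by (auto simp: deg_in_eq_0_iff)
    ultimately have "initial le c = 0"
      using vars_initial[of c] deg_in_leader_pos[OF vc] by (intro zero[OF inP] reduced[OF c]) auto
    then show False using initial_nonzero[OF vc] by blast
  qed
  have separant: "separant le c \<notin> P" if c: "c \<in> set C" for c
  proof
    let ?u = "leader le c"
    assume inP: "separant le c \<in> P"
    have vc: "vars c \<noteq> {}" using auto(1) c by (simp add: autoreduced_def)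
    have lookup: "lookup c (m + single ?u 1) \<noteq> 0"
      if "lookup (separant le c) m \<noteq> 0" for m
      using that unfolding separant_def lookup_pdiff by (metis mult_zero_right)
    have "deg_in v (separant le c) \<le> deg_in v c" for v
      using lookup_le_deg_in[OF lookup, of _ v] by (intro deg_in_le) (force simp: lookup_add)
    moreover have "deg_in ?u (separant le c) \<le> deg_in ?u c - 1"
      using lookup_le_deg_in[OF lookup, of _ ?u] by (intro deg_in_le) (force simp: lookup_add)
    then have "deg_in ?u (separant le c) < deg_in ?u c" using deg_in_leader_pos[OF vc] by linarith
    ultimately have "separant le c = 0"
      using vars_pdiff[of ?u c] by (intro zero[OF inP] reduced[OF c]) (auto simp: separant_def)
    then have "coeff_in ?u (deg_in ?u c - 1) (pdiff ?u c) = 0"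
      by (simp add: separant_def coeff_in_eq_cpart)
    \<comment> \<open>In characteristic zero the separant cannot vanish: its leading coefficient is
      the degree times the initial.\<close>
    then have "(of_nat (deg_in ?u c) :: ('d, 'y, 'k) dpoly) * initial le c = 0"
      using deg_in_leader_pos[OF vc] by (simp add: coeff_in_pdiff initial_def del: of_nat_Suc)
    then have "(of_nat (deg_in ?u c) :: ('d, 'y, 'k) dpoly) = 0"
      using dpoly_no_zero_divisors initial_nonzero[OF vc] by blast
    then show False using deg_in_leader_pos[OF vc] by simp
  qed
  show ?thesis
  proof
    show "f \<in> P" if "a \<in> set C" "initial le a * f \<in> P" for a f
      using initial[OF that(1)] that(2) pr by (auto simp: prime_ideal_def)
    show "f \<in> P" if "a \<in> set C" "separant le a * f \<in> P" for a f
      using separant[OF that(1)] that(2) pr by (auto simp: prime_ideal_def)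
  qed (use dP auto zero in auto)
qed

text \<open>The saturation \<open>S\<close> by \<open>B\<close> lies in \<open>J\<close> because the
  replacements have regular initials and separants. Being contained in \<open>J\<close>, it has no
  nonzero reduced element, so \<open>B\<close> is a regular set for \<open>S\<close>; reducing an
  element of \<open>J\<close> modulo \<open>S\<close> gives a reduced element of \<open>J\<close>,
  which is zero.\<close>

lemma (in regular_set) replacement_characterizes:
  assumes \<phi>: "\<And>a. a \<in> A \<Longrightarrow> replaces (\<phi> a) a" and B: "set B = \<phi> ` A"
  shows "J = saturation (differential_ideal_gen D (set B)) (init_sep_prod le B)"
proof -
  let ?G = "differential_ideal_gen D (set B)" and ?H = "init_sep_prod le B"
  define S where "S = saturation ?G ?H"
  have rank: "leader le (\<phi> a) = leader le a" "deg_in (leader le a) (\<phi> a) = deg_in (leader le a) a"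
    if "a \<in> A" for a
    using \<phi>[OF that] by (auto simp: replaces_def rank_def)
  have GJ: "?G \<subseteq> J"
    using \<phi> by (intro differential_ideal_gen_least differential_ideal_J) (auto simp: B replaces_def)
  have "regular (\<Prod>f\<in>F. initial le f * separant le f)" if "finite F" "F \<subseteq> \<phi> ` A" for F
    using that
  proof (induction F)
    case (insert f F)
    then have "regular (initial le f * separant le f)"
      using \<phi> by (auto simp: replaces_def intro: regular_mult)
    then show ?case using insert by (simp add: regular_mult)
  qed (simp add: regular_1)
  from this[of "set B"] have H: "regular ?H" unfolding init_sep_prod_def by (simp add: B[symmetric])
  have SJ: "S \<subseteq> J"
  proof
    fix f assume "f \<in> S"
    then obtain m where "?H ^ m * f \<in> J" using GJ by (auto simp: S_def saturation_def)
    then show "f \<in> J" using regular_power[OF H, of m] by (simp add: regular_def)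
  qed
  have gen: "differential_ideal D ?G" by (rule differential_ideal_differential_ideal_gen)
  then have id_gen: "ideal ?G" by (simp add: differential_ideal_iff)
  have reduced_iff: "reduced le f (\<phi> a) \<longleftrightarrow> reduced le f a" if "a \<in> A" for f :: "('d, 'y, 'k) dpoly" and a
    using rank[OF that] by (simp add: reduced_def)
  interpret S: regular_set D le S "set B"
  proof
    show "differential_ideal D S" unfolding S_def using gen by (rule differential_ideal_saturation)
    show "set B \<subseteq> S"
      using subset_differential_ideal_gen[of "set B" D] by (auto simp: S_def intro!: saturationI[of _ 0])
    show "autoreduced le (set B)"
    proof -
      have "reduced le (\<phi> a) (\<phi> a')" if "a \<in> A" "a' \<in> A" "\<phi> a \<noteq> \<phi> a'" for a a'
      proof -
        have "a' \<noteq> a" using that(3) by blast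
        then show ?thesis using \<phi>[OF that(1)] that(2) by (simp add: reduced_iff replaces_def)
      qed
      moreover have "vars (\<phi> a) \<noteq> {}" if "a \<in> A" for a using \<phi>[OF that] by (simp add: replaces_def)
      ultimately show ?thesis unfolding autoreduced_def B by blast
    qed
    show "f = 0" if f: "f \<in> S" "\<And>a. a \<in> set B \<Longrightarrow> reduced le f a" for f
    proof (rule reduced_zero)
      show "reduced le f a" if "a \<in> A" for a
        using f(2)[of "\<phi> a"] that by (simp add: B reduced_iff)
    qed (use f(1) SJ in blast)
    show "f \<in> S" if "a \<in> set B" "initial le a * f \<in> S" for a f
      using saturation_dvd[OF id_gen init_sep_prod_dvd(1)[OF that(1)]] that(2) unfolding S_def by blast
    show "f \<in> S" if "a \<in> set B" "separant le a * f \<in> S" for a f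
      using saturation_dvd[OF id_gen init_sep_prod_dvd(2)[OF that(1)]] that(2) unfolding S_def by blast
  qed simp
  have "J \<subseteq> S"
  proof
    fix f assume f: "f \<in> J"
    have "S.reducible_to UNIV {f}"
      by (intro S.reducible S.admissible_downclosed) (auto simp: polys_in_def)
    then obtain h y where h: "S.regular h" and y: "S.red y" "h * f - y \<in> S"
      unfolding S.reducible_to_def by auto
    have "y \<in> J" using y(2) SJ J_mult[OF f, of h] ideal_cong[OF ideal_J, of "h * f" y] by blast
    moreover have "reduced le y a" if "a \<in> A" for a
      using y(1)[unfolded S.red_def] that reduced_iff[OF that, of y] B by auto
    ultimately have "y = 0" by (rule reduced_zero)
    then show "f \<in> S" using y(2) h by (simp add: S.regular_def)
  qed
  then show ?thesis using SJ by (simp add: S_def)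
qed

text \<open>The improper ideal has no essential components, so the maximum in the theorem is an unspecified
  number; this is harmless because its characteristic sets have order zero.\<close>

lemma (in ranked) characteristic_set_UNIV_order:
  fixes A :: "('d, 'y, 'k::comm_ring_1) dpoly list"
  assumes A: "characteristic_set le UNIV A" and f: "f \<in> set A"
  shows "poly_order f = 0"
proof -
  have auto: "autoreduced le (set A)"
    using A by (auto simp: characteristic_set_def autoreduced_list_def)
  have "fst v = 0" if v: "v \<in> vars f" for v
  proof (rule ccontr)
    assume v0: "fst v \<noteq> 0"
    let ?x = "(0, snd v) :: ('d, 'y) dvar"
    have x: "v = dapply (fst v) ?x" by (simp add: dapply_def)
    \<comment> \<open>The variable \<open>?x\<close> belongs to the improper ideal, so some
      \<open>a\<close> fails to have it reduced. Having order zero, \<open>?x\<close> is no proper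
      derivative and must be the leader of \<open>a\<close>; then \<open>v\<close> is a proper
      derivative of that leader, which cannot occur in \<open>f\<close>.\<close>
    obtain a where a: "a \<in> set A" "\<not> reduced le (var ?x) a"
      using characteristic_set_reduced[OF A, of "var ?x"] by auto
    have va: "vars a \<noteq> {}" using auto a(1) by (simp add: autoreduced_def)
    have "leader le a = ?x"
    proof (rule ccontr)
      assume ne: "leader le a \<noteq> ?x"
      have "dapply \<theta> (leader le a) \<noteq> ?x" if "\<theta> \<noteq> 0" for \<theta>
      proof
        assume "dapply \<theta> (leader le a) = ?x"
        then have sum0: "\<theta> + fst (leader le a) = 0" by (simp add: dapply_def)
        have "\<theta> = 0"
        proof (rule poly_mapping_eqI)
          fix i show "lookup \<theta> i = lookup 0 i"
            using arg_cong[OF sum0, of "\<lambda>m. lookup m i"] by (simp add: lookup_add)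
        qed
        then show False using that by blast
      qed
      moreover have "deg_in (leader le a) (var ?x :: ('d, 'y, 'k) dpoly) = 0"
        using ne by (simp add: deg_in_eq_0_iff)
      ultimately have "reduced le (var ?x) a"
        using deg_in_leader_pos[OF va] by (auto simp: reduced_def)
      then show False using a(2) by blast
    qed
    then have v': "v = dapply (fst v) (leader le a)" using x by simp
    show False
    proof (cases "f = a")
      case True
      then have "lt (leader le f) v" using lt_dapply[OF v0, of "leader le a"] v' by simp
      then show False using le_leader[OF va] v True by (auto simp flip: not_lt_iff)
    next
      case False
      then have "reduced le f a" using auto f a(1) by (simp add: autoreduced_def)
      then show False using v v' v0 unfolding reduced_def by metis
    qed
  qed
  then have orders: "insert 0 (dvar_order ` vars f) = {0}" by (auto simp: dvar_order_def)
  show ?thesis unfolding poly_order_def orders by simp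
qed

lemma poly_order_le_iff: "poly_order f \<le> n \<longleftrightarrow> (\<forall>v\<in>vars f. dvar_order v \<le> n)"
  by (auto simp: poly_order_def)

theorem theorem7:
  fixes D :: "'d::finite \<Rightarrow> 'k::field_char_0 \<Rightarrow> 'k"
    and le :: "('d, 'y::finite) dvar \<Rightarrow> ('d, 'y) dvar \<Rightarrow> bool"
    and h :: "('d, 'y, 'k) dpoly set \<Rightarrow> nat"
    and I :: "('d, 'y, 'k) dpoly set"
  assumes "differential_field D"
    and "ranking le"
    and "\<And>P. prime_differential_ideal D P \<Longrightarrow>
           \<exists>C. characteristic_set le P C \<and> (\<forall>f\<in>set C. poly_order f \<le> h P)"
    and "characterizable D le I"
  shows "\<exists>B. characteristic_set le I B \<and>
           I = saturation (differential_ideal_gen D (set B)) (init_sep_prod le B) \<and>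
           (\<forall>f\<in>set B. poly_order f \<le> Max (h ` essential_prime_components D I))"
proof -
  obtain A where I: "differential_ideal D I" and A: "characterizes D le A I"
    using assms(4) by (auto simp: characterizable_def)
  have cs: "characteristic_set le I A" using A unfolding characterizes_def by (rule conjunct1)
  interpret ranked le by unfold_locales (rule assms(2))
  show ?thesis
  proof (cases "I = UNIV")
    case True
    then have "poly_order f = 0" if "f \<in> set A" for f
      using characteristic_set_UNIV_order that cs by blast
    then show ?thesis
      using conjunct1[OF A[unfolded characterizes_def]] conjunct2[OF A[unfolded characterizes_def]]
      by (intro exI[of _ A] conjI) auto
  next
    case False
    interpret regular_set D le I "set A"
      using assms(1,2) I False A by (rule regular_set_characterizes)
    define M where "M = Max (h ` essential_prime_components D I)"
    define W where "W = {v :: ('d, 'y) dvar. dvar_order v \<le> M}"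
    have "\<exists>C. regular_set D le P C \<and> (\<forall>c\<in>C. vars c \<subseteq> W)" if P: "P \<in> essential_prime_components D I" for P
    proof -
      have pr: "prime_differential_ideal D P" using P by (simp add: essential_prime_components_def)
      obtain C where C: "characteristic_set le P C" "\<And>f. f \<in> set C \<Longrightarrow> poly_order f \<le> h P"
        using assms(3)[OF pr] by blast
      \<comment> \<open>Finiteness of the set of components is what makes \<open>Max\<close> an
        actual upper bound.\<close>
      have "h P \<le> M" unfolding M_def using P finite_essential_prime_components by (intro Max_ge) auto
      then have "vars c \<subseteq> W" if "c \<in> set C" for c
        using C(2)[OF that] by (auto simp: W_def poly_order_le_iff)
      then show ?thesis using regular_set_prime[OF assms(1,2) pr C(1)] by blast
    qed
    then have "\<exists>b. replaces b a \<and> vars b \<subseteq> W" if "a \<in> set A" for a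
      using ex_replacement that by blast
    then obtain \<phi> where \<phi>: "\<And>a. a \<in> set A \<Longrightarrow> replaces (\<phi> a) a" "\<And>a. a \<in> set A \<Longrightarrow> vars (\<phi> a) \<subseteq> W"
      by metis
    have "characteristic_set le I (map \<phi> A)"
      by (rule characteristic_set_map[OF cs]) (use \<phi>(1) in \<open>auto simp: replaces_def\<close>)
    moreover have "I = saturation (differential_ideal_gen D (set (map \<phi> A))) (init_sep_prod le (map \<phi> A))"
      by (rule replacement_characterizes[of \<phi>]) (use \<phi>(1) in auto)
    moreover have "poly_order f \<le> M" if "f \<in> set (map \<phi> A)" for f
      using \<phi>(2) that unfolding poly_order_le_iff W_def by auto
    ultimately show ?thesis unfolding M_def by blast
  qed
qed

end
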